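(* Let $a:\mathbb{N}\to\mathbb{C}$ be a multiplicative and automatic sequence. Then $a$ is $p$-automatic for some prime $p$ and takes the form \[ a(n)=f_1(\nu_p(n))\cdot f_2\big(n/p^{\nu_p(n)}\big)\qquad (n\in\mathbb{N}),\] where $f_1:\mathbb{N}_0\to\mathbb{C}$ is eventually periodic with $f_1(0)=1$, and $f_2:\mathbb{N}\to\mathbb{C}$ is multiplicative, eventually periodic and vanishes at all multiples of $p$. Furthermore, for any prime $p$, any sequence given by this formula with $f_1,f_2$ satisfying these conditions is multiplicative and $p$-automatic, and this decomposition (i.e. the pair $f_1,f_2$) is unique unless $a$ is eventually periodic.
   Context: $\mathbb{N}=\{1,2,\dots\}$, $\mathbb{N}_0=\{0,1,2,\dots\}$. A sequence $u:\mathbb{N}\to\mathbb{C}$ is multiplicative if $u(mn)=u(m)u(n)$ for all coprime $m,n\in\mathbb{N}$. For an integer $\lambda\ge 2$, a sequence $f$ is $\lambda$-automatic if its $\lambda$-kernel $\{(f(n\lambda^k+r))_{n\ge0}: k\ge0,\ 0\le r<\lambda^k\}$ is finite (equivalently, it is generated by a finite automaton reading base-$\lambda$ digits); a sequence is $1$-automatic iff it is eventually periodic; a sequence is automatic if it is $\lambda$-automatic for some $\lambda\ge2$. For a prime $p$, $\nu_p(n)$ is the $p$-adic valuation of $n$ (the largest $k$ with $p^k\mid n$). *)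

theory Defs
  imports Complex_Main "HOL-Computational_Algebra.Primes"
begin

text \<open>
  A sequence on the positive integers is represented by a function of type
  \<open>nat \<Rightarrow> complex\<close> whose value at \<open>0\<close> is arbitrary. The notions below either do not
  mention that value or do not depend on it: see \<open>automatic_base_upd_0\<close> and
  \<open>eventually_periodic_upd_0\<close>.
\<close>

definition multiplicative_seq :: "(nat \<Rightarrow> complex) \<Rightarrow> bool" where
  "multiplicative_seq u \<longleftrightarrow>
     (\<forall>m n. m \<ge> 1 \<longrightarrow> n \<ge> 1 \<longrightarrow> coprime m n \<longrightarrow> u (m * n) = u m * u n)"

definition kernel_of :: "nat \<Rightarrow> (nat \<Rightarrow> 'a) \<Rightarrow> (nat \<Rightarrow> 'a) set" where
  "kernel_of l f = {(\<lambda>n. f (n * l ^ k + r)) | k r. r < l ^ k}"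

definition automatic_base :: "nat \<Rightarrow> (nat \<Rightarrow> 'a) \<Rightarrow> bool" where
  "automatic_base l f \<longleftrightarrow> l \<ge> 2 \<and> finite (kernel_of l f)"

definition automatic :: "(nat \<Rightarrow> 'a) \<Rightarrow> bool" where
  "automatic f \<longleftrightarrow> (\<exists>l\<ge>2. automatic_base l f)"

definition eventually_periodic :: "(nat \<Rightarrow> 'a) \<Rightarrow> bool" where
  "eventually_periodic f \<longleftrightarrow> (\<exists>N. \<exists>d\<ge>1. \<forall>n\<ge>N. f (n + d) = f n)"

definition prime_decomposition ::
    "nat \<Rightarrow> (nat \<Rightarrow> complex) \<Rightarrow> (nat \<Rightarrow> complex) \<Rightarrow> (nat \<Rightarrow> complex) \<Rightarrow> bool" where
  "prime_decomposition p f1 f2 a \<longleftrightarrow>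
     eventually_periodic f1 \<and> f1 0 = 1 \<and>
     multiplicative_seq f2 \<and> eventually_periodic f2 \<and>
     (\<forall>n\<ge>1. p dvd n \<longrightarrow> f2 n = 0) \<and>
     (\<forall>n\<ge>1. a n = f1 (multiplicity p n) * f2 (n div p ^ multiplicity p n))"

lemma kernel_of_upd_0:
  "kernel_of l (f(0 := c)) \<subseteq> kernel_of l f \<union> (\<lambda>g. g(0 := c)) ` kernel_of l f"
proof
  fix h assume "h \<in> kernel_of l (f(0 := c))"
  then obtain k r where h: "h = (\<lambda>n. (f(0 := c)) (n * l ^ k + r))" and r: "r < l ^ k"
    unfolding kernel_of_def by blast
  let ?g = "\<lambda>n. f (n * l ^ k + r)"
  have g: "?g \<in> kernel_of l f"
    using r unfolding kernel_of_def by blast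
  have "h = ?g \<or> h = ?g(0 := c)"
    using r by (cases "r = 0") (auto simp: h fun_eq_iff)
  with g show "h \<in> kernel_of l f \<union> (\<lambda>g. g(0 := c)) ` kernel_of l f"
    by blast
qed

lemma automatic_base_upd_0: "automatic_base l (f(0 := c)) \<longleftrightarrow> automatic_base l f"
proof -
  have "automatic_base l (g(0 := d))" if "automatic_base l g" for g :: "nat \<Rightarrow> 'a" and d
    using that finite_subset[OF kernel_of_upd_0[of l g d]] by (simp add: automatic_base_def)
  from this[of f c] this[of "f(0 := c)" "f 0"] show ?thesis by auto
qed

lemma eventually_periodic_upd_0: "eventually_periodic (f(0 := c)) \<longleftrightarrow> eventually_periodic f"
proof -
  have "eventually_periodic (g(0 := d))" if g: "eventually_periodic g" for g :: "nat \<Rightarrow> 'a" and d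
  proof -
    obtain N e where "e \<ge> 1" "\<forall>n\<ge>N. g (n + e) = g n"
      using g unfolding eventually_periodic_def by blast
    then have "e \<ge> 1 \<and> (\<forall>n\<ge>Suc N. (g(0 := d)) (n + e) = (g(0 := d)) n)" by auto
    then show ?thesis unfolding eventually_periodic_def by blast
  qed
  from this[of f c] this[of "f(0 := c)" "f 0"] show ?thesis by auto
qed

end

theory Submission
  imports Defs "HOL-Number_Theory.Cong" "HOL-Analysis.Kronecker_Approximation_Theorem"
begin

text \<open>
  After passing to a power \<open>L\<close> of the base, \<open>a (n * L ^ c + r)\<close> does not depend on \<open>c\<close> once \<open>c\<close> is large.

  Suppose first that \<open>a\<close> is supported on products of finitely many primes. Pumping in the base-\<open>L\<close> expansion
  produces first-order linear recurrences in the support, so the \<open>n\<close> with \<open>a n \<noteq> 0\<close> that are not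
  divisible by \<open>L\<close> are bounded.

  Otherwise only finitely many primes \<open>q\<close> admit a zero \<open>a (q ^ j) = 0\<close>: infinitely many would produce long runs of
  zeros, hence leading digits all of whose continuations are zeros, whereas \<open>a (1 + M * m)\<close> is invariant under a
  dilation \<open>m \<mapsto> k * m\<close> and the powers of \<open>k\<close> have arbitrary leading digits. On the integers prime to a suitable
  \<open>P\<close>, identify \<open>r\<close> and \<open>r'\<close> if \<open>a (r + m * R * L ^ c) = a (r' + m * R * L ^ c)\<close> for all \<open>m\<close> and large \<open>c\<close>.
  There are finitely many classes. The maps \<open>\<rho> t\<close> sending the class of \<open>r\<close> to that of \<open>r + t * R * L ^ c\<close> form a
  semigroup, multiplication by \<open>d\<close> induces a permutation \<open>\<tau> d\<close> of the classes, and
  \<open>\<rho> (d * t) \<circ> \<tau> d = \<tau> d \<circ> \<rho> t\<close>. Again by the leading digits of powers, each \<open>\<rho> t\<close> factors through each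
  \<open>\<rho> t'\<close>. Therefore all \<open>\<rho> t\<close> are permutations, some \<open>\<rho> s\<close> is the identity, and \<open>a\<close> is constantly \<open>1\<close> on a
  progression \<open>1 + M * t\<close>; so \<open>a\<close> agrees with a Dirichlet character on the integers prime to \<open>M\<close>.

  For a prime \<open>q\<close> of which \<open>L\<close> is not a power, a coincidence in the kernel between two residues compares the values
  at high powers of \<open>q\<close> with that character, so \<open>a\<close> is periodic also along the powers of \<open>q\<close>. Hence \<open>a\<close> is
  eventually periodic away from at most one prime.
\<close>

section \<open>Arithmetic preliminaries\<close>

lemma pigeonhole_nat:
  fixes f :: "nat \<Rightarrow> 'a"
  assumes "finite A" "\<And>i. i \<le> card A \<Longrightarrow> f i \<in> A"
  obtains i j where "i < j" "j \<le> card A" "f i = f j"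
proof -
  have "card (f ` {..card A}) \<le> card A"
    using assms by (intro card_mono) auto
  hence "\<not> inj_on f {..card A}"
    by (intro pigeonhole) simp
  then obtain i j where "i \<noteq> j" "i \<le> card A" "j \<le> card A" "f i = f j"
    by (auto simp: inj_on_def)
  thus ?thesis using that by (metis linorder_neqE_nat)
qed

lemma cong_add_mult_self:
  "[x + k * m = x] (mod m)" "[x + m * k = x] (mod m)" for x k m :: nat
  unfolding Cong.cong_def by simp_all

lemma coprime_add_mult_self:
  "coprime (x + k * m) m \<longleftrightarrow> coprime x m" "coprime (x + m * k) m \<longleftrightarrow> coprime x m" for x k m :: nat
  by (rule coprime_cong_cong_left[OF cong_add_mult_self(1)], rule coprime_cong_cong_left[OF cong_add_mult_self(2)])

lemma coprime_one_add_mult: "coprime m (1 + m * k)" for m k :: nat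
  using coprime_add_mult_self(2)[of 1 m k] by (simp add: coprime_commute)

section \<open>Leading digits of powers in a coprime base\<close>

lemma log_irrational:
  fixes k L :: nat
  assumes "k \<ge> 2" "L \<ge> 2" "coprime k L"
  shows "log L k \<notin> \<rat>"
proof
  assume "log L k \<in> \<rat>"
  moreover have "log L k > 0" using assms by simp
  ultimately obtain m n :: nat where mn: "n \<noteq> 0" "\<bar>log L k\<bar> = m / n"
    by (meson Rats_abs_nat_div_natE)
  hence eq: "n * log L k = m" using \<open>log L k > 0\<close> by (simp add: field_simps)
  have "real (k ^ n) = real (L ^ m)"
  proof -
    have "real k ^ n = L powr log L (real k ^ n)" using assms by (simp add: powr_log_cancel)
    also have "\<dots> = L powr m" using assms eq by (simp add: log_nat_power)
    also have "\<dots> = real L ^ m" using assms by (simp add: powr_realpow)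
    finally show ?thesis by simp
  qed
  hence "k ^ n = L ^ m" using of_nat_eq_iff by blast
  moreover have "coprime (k ^ n) (L ^ m)" using assms by simp
  ultimately have "k ^ n = 1" by simp
  thus False using assms mn by simp
qed

text \<open>The multiples of the irrational number \<open>log L k\<close> are dense modulo
  \<open>1\<close>, so the base-\<open>L\<close> logarithm of \<open>C * k ^ i\<close> can be placed
  between those of \<open>\<alpha>\<close> and \<open>\<beta>\<close> up to an integer
  \<open>e\<close>.\<close>

lemma leading_digits:
  fixes k L E :: nat and C \<alpha> \<beta> :: real
  assumes "k \<ge> 2" "L \<ge> 2" "coprime k L" "C > 0" "0 < \<alpha>" "\<alpha> < \<beta>"
  shows "\<exists>i e. e \<ge> E \<and> \<alpha> * real L ^ e < C * real k ^ i \<and> C * real k ^ i < \<beta> * real L ^ e"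
proof -
  define \<theta> x y z where "\<theta> = log L k" and "x = log L \<alpha>" and "y = log L \<beta>" and "z = log L C"
  have L: "real L > 1" using assms by simp
  have \<theta>: "\<theta> \<notin> \<rat>" "\<theta> > 0" using log_irrational[OF assms(1-3)] assms by (simp_all add: \<theta>_def)
  have "x < y" using assms by (simp add: x_def y_def)
  \<comment> \<open>Starting from the multiple \<open>I * \<theta>\<close> forces the integer part
    \<open>h\<close> found below to exceed \<open>E\<close>.\<close>
  obtain I :: nat where "real I > (real E + y - z) / \<theta>" using reals_Archimedean2 by blast
  hence I: "real I * \<theta> > real E + y - z" using \<theta> by (simp add: field_simps)
  obtain h j :: int where hj: "j > 0" "\<bar>of_int j * \<theta> - of_int h - ((x + y) / 2 - z - real I * \<theta>)\<bar> < (y - x) / 2"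
    using sequence_of_fractional_parts_is_dense[OF \<theta>(1),
        where \<epsilon> = "(y - x) / 2" and \<alpha> = "(x + y) / 2 - z - real I * \<theta>"] \<open>x < y\<close>
    by (metis diff_gt_0_iff_gt half_gt_zero)
  define i where "i = I + nat j"
  have i: "real i * \<theta> = real I * \<theta> + of_int j * \<theta>" using hj(1) by (simp add: i_def algebra_simps)
  have lo: "x + h < z + real i * \<theta>" and hi: "z + real i * \<theta> < y + h"
    using hj(2) unfolding i abs_less_iff by (simp_all add: field_simps)
  have "of_int j * \<theta> > 0" using hj(1) \<theta> by simp
  hence "real_of_int h > real E" using hi I i by linarith
  hence h: "h > int E" by linarith
  define e where "e = nat h"
  have e: "real_of_int h = real e" "e \<ge> E" using h by (simp_all add: e_def)
  have 1: "L powr (x + h) = \<alpha> * real L ^ e" using assms L e(1) by (simp add: powr_add x_def powr_realpow)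
  have 2: "L powr (y + h) = \<beta> * real L ^ e" using assms L e(1) by (simp add: powr_add y_def powr_realpow)
  have "L powr (real i * \<theta>) = (L powr \<theta>) powr real i" by (simp add: powr_powr mult.commute)
  hence 3: "L powr (z + real i * \<theta>) = C * real k ^ i" using assms L by (simp add: powr_add z_def \<theta>_def powr_realpow)
  have "\<alpha> * real L ^ e < C * real k ^ i" using lo L 1 3 powr_less_mono by metis
  moreover have "C * real k ^ i < \<beta> * real L ^ e" using hi L 2 3 powr_less_mono by metis
  ultimately show ?thesis using e by blast
qed

text \<open>The prime divisors of \<open>Z\<close> not dividing \<open>r\<close> are put into the multiple of \<open>M\<close> that is added.\<close>
lemma coprime_in_residue_class:
  fixes r M Z B :: nat
  assumes "coprime r M" "Z > 0" "M > 0"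
  obtains w where "[w = r] (mod M)" "coprime w Z" "w \<ge> B"
proof -
  define s where "s = r + M * B"
  have s: "coprime s M" using assms(1) coprime_cong_cong_left[OF cong_add_mult_self(2)]
    unfolding s_def by blast
  define T where "T = \<Prod>{p \<in> prime_factors Z. \<not> p dvd s}"
  define w where "w = s + M * T"
  have "coprime w Z"
  proof (rule ccontr)
    assume "\<not> coprime w Z"
    then obtain p where p: "prime p" "p dvd w" "p dvd Z"
      using prime_factor_nat[of "gcd w Z"] by (auto simp: coprime_iff_gcd_eq_1)
    hence pf: "p \<in> prime_factors Z" using assms by (simp add: prime_factors_dvd)
    show False
    proof (cases "p dvd s")
      case True
      hence "p dvd M * T" using p(2) by (simp add: w_def dvd_add_right_iff)
      moreover have "\<not> p dvd M" using True s p(1) by (meson coprime_common_divisor_nat not_prime_unit coprime_common_divisor)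
      ultimately have "p dvd T" using p(1) by (simp add: prime_dvd_mult_iff)
      then obtain q where q: "q \<in> prime_factors Z" "\<not> q dvd s" "p dvd q"
        unfolding T_def using p(1) by (subst (asm) prime_dvd_prod_iff) auto
      hence "p = q" using p(1) primes_dvd_imp_eq by blast
      thus False using True q by simp
    next
      case False
      hence "p dvd T" unfolding T_def using pf by (intro dvd_prodI) auto
      hence "p dvd s" using p(2) by (metis dvd_add_left_iff dvd_mult w_def)
      thus False using False by simp
    qed
  qed
  moreover have "[w = r] (mod M)" using cong_trans[OF cong_add_mult_self(2) cong_add_mult_self(2)]
    unfolding w_def s_def .
  moreover have "w \<ge> B" using assms(3) by (simp add: w_def s_def trans_le_add1 trans_le_add2)
  ultimately show ?thesis using that by blast
qed

lemma coprime_cong_solution: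
  fixes x r M Z B :: nat
  assumes "coprime x M" "coprime r M" "Z > 0" "M > 0"
  obtains w where "[x * w = r] (mod M)" "coprime w Z" "w \<ge> B"
proof -
  obtain v where v: "[x * v = 1] (mod M)" using cong_solve_coprime_nat[OF assms(1)] by auto
  hence "coprime v M" by (metis One_nat_def coprime_iff_invertible_nat mult.commute)
  hence "coprime (v * r) M" using assms(2) by simp
  then obtain w where w: "[w = v * r] (mod M)" "coprime w Z" "w \<ge> B"
    using coprime_in_residue_class assms(3,4) by blast
  have "[x * w = x * v * r] (mod M)" using cong_scalar_left[OF w(1), of x] by (simp add: mult.assoc)
  also have "[x * v * r = 1 * r] (mod M)" using v by (rule cong_scalar_right)
  finally show ?thesis using that w by simp
qed

section \<open>Periodicity on the integers coprime to a modulus\<close>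

lemma multiplicative_seqD:
  "multiplicative_seq a \<Longrightarrow> coprime m n \<Longrightarrow> m > 0 \<Longrightarrow> n > 0 \<Longrightarrow> a (m * n) = a m * a n"
  by (simp add: multiplicative_seq_def Suc_le_eq)

lemma multiplicative_seq_prime_power:
  assumes "multiplicative_seq a" "prime p" "n > 0" "\<not> p dvd n"
  shows "a (p ^ k * n) = a (p ^ k) * a n"
  using assms by (intro multiplicative_seqD) (auto simp: prime_imp_coprime prime_gt_0_nat)

text \<open>Eventual periodicity of the restriction of \<open>a\<close> to the integers coprime to \<open>y\<close>, stated without choosing
  values outside that set.\<close>
definition periodic_coprime :: "nat \<Rightarrow> (nat \<Rightarrow> 'a) \<Rightarrow> bool" where
  "periodic_coprime y a \<longleftrightarrow> (\<exists>D N. D > 0 \<and> (\<forall>m n. m \<ge> N \<longrightarrow> n \<ge> N \<longrightarrow>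
     coprime m y \<longrightarrow> coprime n y \<longrightarrow> [m = n] (mod D) \<longrightarrow> a m = a n))"

lemma prime_valuation_decompose:
  fixes p m :: nat
  assumes "prime p" "m > 0"
  obtains x where "m = p ^ multiplicity p m * x" "\<not> p dvd x" "x > 0"
proof -
  have "\<not> is_unit p" using assms(1) not_prime_unit by blast
  then obtain x where x: "m = p ^ multiplicity p m * x" "\<not> p dvd x"
    using multiplicity_decompose'[of m p] assms(2) by (metis less_numeral_extra(3))
  moreover have "x > 0" using x assms(2) by (cases "x = 0") auto
  ultimately show ?thesis using that by blast
qed

lemma eventually_periodic_cong:
  fixes N :: nat
  assumes d: "\<And>n. n \<ge> N \<Longrightarrow> f (n + d) = f n" and "m \<ge> N" "n \<ge> N" "[m = n] (mod d)"
  shows "f m = (f n :: 'a)"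
proof -
  have *: "f (k + j * d) = f k" if "k \<ge> N" for k j :: nat
  proof (induction j)
    case (Suc j)
    have "f (k + Suc j * d) = f ((k + j * d) + d)" by (simp add: algebra_simps)
    also have "\<dots> = f (k + j * d)" using that by (intro d) simp
    finally show ?case using Suc by simp
  qed simp
  show ?thesis
  proof (cases "m \<le> n")
    case True
    then obtain j where "n = j * d + m" using cong_le_nat[OF True, of d] cong_sym[OF assms(4)] by blast
    thus ?thesis using *[of m j] *[of n j] assms(2,3) by (simp add: add.commute)
  next
    case False
    hence "n \<le> m" by simp
    then obtain j where "m = j * d + n" using cong_le_nat[of n m d] assms(4) by blast
    thus ?thesis using *[of m j] *[of n j] assms(2,3) by (simp add: add.commute)
  qed
qed

lemma periodic_coprime_iff:
  "periodic_coprime y a \<longleftrightarrow> eventually_periodic (\<lambda>n. if coprime n y then a n else (0::complex))"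
  (is "_ \<longleftrightarrow> eventually_periodic ?f")
proof
  assume "periodic_coprime y a"
  then obtain D N where D: "D > 0" and N: "\<And>m n. m \<ge> N \<Longrightarrow> n \<ge> N \<Longrightarrow>
     coprime m y \<Longrightarrow> coprime n y \<Longrightarrow> [m = n] (mod D) \<Longrightarrow> a m = a n"
    unfolding periodic_coprime_def by blast
  show "eventually_periodic ?f"
  \<comment> \<open>For \<open>y = 0\<close> the period \<open>D * y\<close> used below would be
    zero; there only \<open>n = 1\<close> is prime to \<open>y\<close>.\<close>
  proof (cases "y = 0")
    case True
    hence "\<forall>n\<ge>2. ?f (n + 1) = ?f n" by auto
    thus ?thesis unfolding eventually_periodic_def by blast
  next
    case False
    have "?f (n + D * y) = ?f n" if "n \<ge> N" for n
    proof -
      have "[n + D * y = n] (mod y)" by (rule cong_add_mult_self)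
      hence "coprime (n + D * y) y \<longleftrightarrow> coprime n y" by (rule coprime_cong_cong_left)
      moreover have "[n + D * y = n] (mod D)" by (rule cong_add_mult_self)
      ultimately show ?thesis using N[of "n + D * y" n] that by simp
    qed
    moreover have "D * y \<ge> 1" using D False by simp
    ultimately show ?thesis unfolding eventually_periodic_def by blast
  qed
next
  assume "eventually_periodic ?f"
  then obtain N d where "d \<ge> 1" and d: "\<And>n. n \<ge> N \<Longrightarrow> ?f (n + d) = ?f n"
    unfolding eventually_periodic_def by blast
  have "a m = a n" if "m \<ge> N" "n \<ge> N" "coprime m y" "coprime n y" "[m = n] (mod d)" for m n
    using eventually_periodic_cong[of N ?f d m n, OF d that(1,2,5)] that(3,4) by simp
  thus "periodic_coprime y a" using \<open>d \<ge> 1\<close> unfolding periodic_coprime_def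
    by (metis less_eq_Suc_le One_nat_def)
qed

text \<open>The part of the power of \<open>p\<close> beyond \<open>p ^ e\<close> is moved into the
  cofactor: \<open>p ^ i * u\<close> is congruent modulo \<open>D\<close> to
  \<open>p ^ e * w\<close> for some \<open>w\<close> prime to \<open>p\<close> and congruent to
  \<open>p ^ (i - e) * u\<close> modulo \<open>q ^ g * d\<close>. Both numbers are prime to
  \<open>y * q\<close>, so \<open>H\<close> applies, and \<open>P3\<close> replaces \<open>w\<close>
  by \<open>v\<close>.\<close>

lemma periodic_coprime_merge_aux:
  fixes a :: "nat \<Rightarrow> complex"
  assumes mult: "multiplicative_seq a" and pq: "prime p" "prime q" "p \<noteq> q"
    and D: "D = p ^ e * q ^ g * d" "d > 0" and eg: "e \<ge> 1" "g \<ge> 1"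
    and d: "coprime d p" "coprime d q" and y: "y dvd D" "coprime p y" "coprime q y"
    and H: "\<And>m n. m \<ge> N \<Longrightarrow> n \<ge> N \<Longrightarrow> coprime m (y * q) \<Longrightarrow> coprime n (y * q) \<Longrightarrow>
              [m = n] (mod D) \<Longrightarrow> a m = a n"
    and P3: "\<And>m n. m \<ge> N \<Longrightarrow> n \<ge> N \<Longrightarrow> coprime m (y * p * q) \<Longrightarrow> coprime n (y * p * q) \<Longrightarrow>
              [m = n] (mod d) \<Longrightarrow> a m = a n"
    and u: "coprime u (y * p * q)" "p ^ i * u \<ge> N" "i \<ge> e" "N \<ge> 1"
    and v: "coprime v (y * p * q)" "v \<ge> N" "[v = p ^ (i - e) * u] (mod d)"
  shows "a (p ^ i) * a u = a (p ^ e) * a v"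
proof -
  have p0: "p > 0" "q > 0" using pq by (auto simp: prime_gt_0_nat)
  have cpq: "coprime p q" using pq by (simp add: primes_coprime)
  define z where "z = p ^ (i - e) * u"
  have zq: "coprime z q" and zy: "coprime z y" using u(1) cpq y by (auto simp: z_def)
  obtain w0 where w0: "[w0 = z] (mod (q ^ g * d))" "[w0 = 1] (mod p)"
    using binary_chinese_remainder_nat[of "q ^ g * d" p z 1] cpq d by (auto simp: coprime_commute)
  define w where "w = w0 + N * (q ^ g * d * p)"
  have "w = w0 + q ^ g * d * (N * p)" "w = w0 + p * (N * q ^ g * d)" by (simp_all add: w_def)
  hence "[w = w0] (mod (q ^ g * d))" "[w = w0] (mod p)" using cong_add_mult_self(2) by metis+
  hence w: "[w = z] (mod (q ^ g * d))" "[w = 1] (mod p)" using w0 cong_trans by blast+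
  have wN: "w \<ge> N" using p0 D by (simp add: w_def trans_le_add2)
  have wp: "coprime w p" using w(2) by (metis coprime_1_left coprime_cong_cong_left)
  have "[w = z] (mod q)" using w(1) eg by (elim cong_dvd_modulus_nat) (simp add: dvd_mult2 dvd_power)
  hence wq: "coprime w q" using zq by (metis coprime_cong_cong_left)
  have "coprime p y" by fact
  hence "coprime y (p ^ e)" by (simp add: coprime_commute)
  hence "y dvd q ^ g * d" using y(1) D by (metis coprime_dvd_mult_right_iff mult.assoc)
  hence "[w = z] (mod y)" using w(1) by (rule cong_dvd_modulus_nat[rotated])
  hence wy: "coprime w y" using zy by (metis coprime_cong_cong_left)
  have w0': "w > 0" using wN u(4) by simp
  have u0: "u > 0" using u(2,4) by (cases "u = 0") auto
  have pu: "\<not> p dvd u" and pw: "\<not> p dvd w" using u(1) wp pq(1)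
    by (metis coprime_common_divisor coprime_mult_right_iff dvd_refl not_prime_unit)+
  have "a (p ^ i) * a u = a (p ^ i * u)"
    using pu u0 pq by (simp add: multiplicative_seq_prime_power[OF mult])
  also have "\<dots> = a (p ^ e * w)"
  proof (rule H)
    have "p ^ e * w \<ge> 1 * w" by (rule mult_right_mono) (use p0 in auto)
    thus "p ^ e * w \<ge> N" using wN by linarith
    show "coprime (p ^ i * u) (y * q)" "coprime (p ^ e * w) (y * q)"
      using cpq y u(1) wq wy by auto
    have "[p ^ e * z = p ^ e * w] (mod (p ^ e * (q ^ g * d)))"
      using w(1) unfolding Cong.cong_def by (simp flip: mult_mod_right)
    moreover have "p ^ e * z = p ^ i * u" using u(3) by (simp add: z_def flip: mult.assoc power_add)
    ultimately show "[p ^ i * u = p ^ e * w] (mod D)" by (simp add: D mult.assoc)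
  qed (use u in auto)
  also have "\<dots> = a (p ^ e) * a w"
    using pw w0' pq by (simp add: multiplicative_seq_prime_power[OF mult])
  also have "a w = a v"
  proof (rule P3)
    have "[w = z] (mod d)" using w(1) by (elim cong_dvd_modulus_nat) simp
    thus "[w = v] (mod d)" using v(3) unfolding z_def by (metis cong_sym cong_trans)
  qed (use wN wp wq wy v in auto)
  finally show ?thesis .
qed

lemma cong_mult_cancel_modulus:
  "[k * x = k * y] (mod (k * m)) \<longleftrightarrow> [x = y] (mod m)" if "k > 0" for k x y m :: nat
  using that unfolding Cong.cong_def by (simp flip: mult_mod_right)

text \<open>Modulo \<open>D * D\<close> the numbers \<open>m\<close> and \<open>n\<close> have the
  same \<open>p\<close>-adic valuation \<open>j < e\<close>. Dividing by \<open>p ^ j\<close>, a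
  divisor of \<open>D\<close>, still leaves a congruence modulo \<open>D\<close>, now between
  numbers prime to \<open>p\<close>, to which \<open>H\<close> applies.\<close>

lemma periodic_coprime_small_valuation:
  fixes a :: "nat \<Rightarrow> complex"
  assumes mult: "multiplicative_seq a" and p: "prime p"
    and H: "\<And>m n. m \<ge> N \<Longrightarrow> n \<ge> N \<Longrightarrow> coprime m (y * p) \<Longrightarrow> coprime n (y * p) \<Longrightarrow>
              [m = n] (mod D) \<Longrightarrow> a m = a n"
    and D: "p ^ e dvd D" "D > 0" "N \<ge> 1"
    and mn: "[m = n] (mod (D * D))" "m \<ge> N * D" "n \<ge> N * D" "coprime m y" "coprime n y"
    and pm: "\<not> p ^ e dvd m"
  shows "a m = a n"
proof -
  have p0: "p > 0" using p by (simp add: prime_gt_0_nat)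
  have m0: "m > 0" "n > 0" using mn D by (metis bot_nat_0.not_eq_extremum le_zero_eq mult_is_0 not_one_le_zero)+
  define j where "j = multiplicity p m"
  obtain m' where m: "m = p ^ j * m'" "\<not> p dvd m'"
    using prime_valuation_decompose[OF p m0(1)] unfolding j_def by blast
  have je: "j < e" using pm m(1) by (metis dvd_triv_left le_imp_power_dvd dvd_trans not_le)
  have dvdD: "p ^ i dvd D * D" if "i \<le> e" for i
    using that D(1) by (meson dvd_mult2 dvd_trans le_imp_power_dvd)
  have "p ^ j dvd n" using cong_dvd_iff[OF cong_dvd_modulus_nat[OF mn(1) dvdD[of j]]] je m by simp
  then obtain n' where n: "n = p ^ j * n'" by blast
  have pn: "\<not> p dvd n'"
  proof
    assume "p dvd n'"
    hence "p ^ Suc j dvd n" using n by simp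
    hence "p ^ Suc j dvd m"
      using cong_dvd_iff[OF cong_dvd_modulus_nat[OF mn(1) dvdD[of "Suc j"]]] je by simp
    thus False using m p0 by simp
  qed
  obtain D' where D': "D = p ^ j * D'" using D(1) je by (metis dvd_def dvd_trans le_imp_power_dvd less_imp_le)
  have "[p ^ j * m' = p ^ j * n'] (mod (p ^ j * (D' * D)))" using mn(1) m n D' by (simp add: mult.assoc)
  hence cong: "[m' = n'] (mod D)" using p0
    by (subst (asm) cong_mult_cancel_modulus) (auto elim: cong_dvd_modulus_nat)
  have le: "p ^ j \<le> D" using D(2) D' by (metis dvd_imp_le dvd_triv_left)
  have ge: "x \<ge> N" if "p ^ j * x \<ge> N * D" for x
  proof (rule ccontr)
    assume "\<not> x \<ge> N"
    hence "p ^ j * x < p ^ j * N" using p0 by simp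
    also have "\<dots> \<le> D * N" using le by (rule mult_right_mono) simp
    finally show False using that by (simp add: mult.commute)
  qed
  have "m' \<ge> N" "n' \<ge> N" using ge mn m n by auto
  moreover have "coprime m' (y * p)" "coprime n' (y * p)"
    using mn(4,5) m n pn p by (auto simp: coprime_commute[of _ p] prime_imp_coprime)
  ultimately have "a m' = a n'" using H cong by blast
  moreover have "m' > 0" "n' > 0" using m0 m n by auto
  ultimately show ?thesis
    unfolding m(1) n using m(2) pn p by (simp add: multiplicative_seq_prime_power[OF mult])
qed

text \<open>If neither the high powers of \<open>p\<close> nor those of \<open>q\<close> are all
  zeros of \<open>a\<close>, nonzero values at such powers can be cancelled, which removes both
  primes from the period on the integers prime to \<open>y * p * q\<close>. Excess powers of
  \<open>p\<close> and \<open>q\<close> are then exchanged for residues prime to both, so on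
  multiples of \<open>p ^ e * q ^ g\<close> the value depends only on the cofactor modulo
  \<open>d\<close>. Smaller valuations are treated by division.\<close>

lemma periodic_coprime_merge:
  fixes a :: "nat \<Rightarrow> complex"
  assumes mult: "multiplicative_seq a" and pq: "prime p" "prime q" "p \<noteq> q" and "y > 0"
    and "periodic_coprime (y * p) a" "periodic_coprime (y * q) a"
  shows "periodic_coprime y a"
proof (cases "coprime p y \<and> coprime q y")
  \<comment> \<open>If \<open>p\<close> or \<open>q\<close> divides \<open>y\<close>, one of the two
    assumptions is already the conclusion.\<close>
  case False
  hence "p dvd y \<or> q dvd y" using pq prime_imp_coprime by blast
  hence "(\<forall>m. coprime m (y * p) \<longleftrightarrow> coprime m y) \<or> (\<forall>m. coprime m (y * q) \<longleftrightarrow> coprime m y)"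
    using coprime_divisors[OF dvd_refl] by fastforce
  thus ?thesis
  proof
    assume *: "\<forall>m. coprime m (y * p) \<longleftrightarrow> coprime m y"
    show ?thesis using assms(6) unfolding periodic_coprime_def *[rule_format] .
  next
    assume *: "\<forall>m. coprime m (y * q) \<longleftrightarrow> coprime m y"
    show ?thesis using assms(7) unfolding periodic_coprime_def *[rule_format] .
  qed
next
  case True
  hence py: "coprime p y" and qy: "coprime q y" by auto
  from assms(6) obtain D1 N1 where D1: "D1 > 0" and H1: "\<And>m n. m \<ge> N1 \<Longrightarrow> n \<ge> N1 \<Longrightarrow>
     coprime m (y * p) \<Longrightarrow> coprime n (y * p) \<Longrightarrow> [m = n] (mod D1) \<Longrightarrow> a m = a n"
    unfolding periodic_coprime_def by blast
  from assms(7) obtain D2 N2 where D2: "D2 > 0" and H2: "\<And>m n. m \<ge> N2 \<Longrightarrow> n \<ge> N2 \<Longrightarrow>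
     coprime m (y * q) \<Longrightarrow> coprime n (y * q) \<Longrightarrow> [m = n] (mod D2) \<Longrightarrow> a m = a n"
    unfolding periodic_coprime_def by blast
  define D where "D = D1 * D2 * p * q * y"
  define N where "N = N1 + N2 + 1"
  have p0: "p > 0" "q > 0" using pq by (auto simp: prime_gt_0_nat)
  have D0: "D > 0" using D1 D2 p0 assms(5) by (simp add: D_def)
  have Hp: "a m = a n" if "m \<ge> N" "n \<ge> N" "coprime m (y * p)" "coprime n (y * p)" "[m = n] (mod D)" for m n
    using that by (intro H1) (auto simp: N_def D_def elim!: cong_dvd_modulus_nat)
  have Hq: "a m = a n" if "m \<ge> N" "n \<ge> N" "coprime m (y * q)" "coprime n (y * q)" "[m = n] (mod D)" for m n
    using that by (intro H2) (auto simp: N_def D_def elim!: cong_dvd_modulus_nat)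
  have cpq: "coprime p q" using pq by (simp add: primes_coprime)
  define e where "e = multiplicity p D"
  obtain D' where D': "D = p ^ e * D'" "\<not> p dvd D'"
    using prime_valuation_decompose[OF pq(1) D0] unfolding e_def by blast
  define g where "g = multiplicity q D'"
  obtain d where d: "D' = q ^ g * d" "\<not> q dvd d"
    using prime_valuation_decompose[OF pq(2), of D'] D0 D'(1) unfolding g_def
    by (metis mult_0_right not_gr_zero)
  have D: "D = p ^ e * q ^ g * d" using D' d by simp
  have pd: "coprime d p" using D' d pq by (metis coprime_commute dvd_mult prime_imp_coprime)
  have qd: "coprime d q" using d pq by (metis coprime_commute prime_imp_coprime)
  have d0: "d > 0" using D0 D by simp
  have "p dvd D" by (simp add: D_def)
  hence e1: "e \<ge> 1" using D' by (cases e) auto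
  have "q dvd D" by (simp add: D_def)
  moreover have "coprime q (p ^ e)" using cpq by (simp add: coprime_commute)
  ultimately have "q dvd D'" unfolding D' by (simp add: coprime_dvd_mult_right_iff)
  hence g1: "g \<ge> 1" using d by (cases g) auto
  have yD: "y dvd D" by (simp add: D_def)
  have "coprime y (p ^ e * q ^ g)" using py qy by (simp add: coprime_commute)
  hence yd: "y dvd d" using yD unfolding D by (simp add: coprime_dvd_mult_right_iff)
  have ex: "\<exists>v\<ge>N. coprime v (y * p * q) \<and> [v = x] (mod d)" if "coprime x y" for x
  proof -
    obtain v0 where v0: "[v0 = x] (mod d)" "[v0 = 1] (mod (p * q))"
      using binary_chinese_remainder_nat[of d "p * q" x 1] pd qd by auto
    define v where "v = v0 + N * (p * q * d)"
    have "v = v0 + d * (N * (p * q))" "v = v0 + (p * q) * (N * d)" by (simp_all add: v_def)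
    hence "[v = v0] (mod d)" "[v = v0] (mod (p * q))" using cong_add_mult_self(2) by metis+
    hence v: "[v = x] (mod d)" "[v = 1] (mod (p * q))" using v0 cong_trans by blast+
    have "coprime v (p * q)" using v(2) by (metis coprime_1_left coprime_cong_cong_left)
    moreover have "coprime v y" using that cong_dvd_modulus_nat[OF v(1) yd] by (metis coprime_cong_cong_left)
    moreover have "v \<ge> N" using p0 d0 by (simp add: v_def trans_le_add2)
    ultimately show ?thesis using v(1) by auto
  qed
  have val: "\<exists>i x. i \<ge> s \<and> m = r ^ i * x \<and> \<not> r dvd x" if r: "r ^ s dvd m" "m > 0" "prime r" for r s m :: nat
  proof -
    obtain x where "m = r ^ multiplicity r m * x" "\<not> r dvd x"
      using prime_valuation_decompose[OF r(3,2)] by blast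
    moreover have "multiplicity r m \<ge> s" using r by (intro multiplicity_geI) (auto simp: not_prime_unit)
    ultimately show ?thesis by blast
  qed
  have big: "a m = a n" if B: "m > 0" "n > 0" "m \<ge> N * N" "n \<ge> N * N" "coprime m y" "coprime n y" "[m = n] (mod D)"
    "p ^ e dvd m" "p ^ e dvd n" "q ^ g dvd m" "q ^ g dvd n" for m n
  proof -
    consider "\<forall>i\<ge>e. a (p ^ i) = 0" | "\<forall>j\<ge>g. a (q ^ j) = 0"
      | i j where "i \<ge> e" "a (p ^ i) \<noteq> 0" "j \<ge> g" "a (q ^ j) \<noteq> 0" by blast
    thus ?thesis
    proof cases
      case 1
      have "a x = 0" if "x > 0" "p ^ e dvd x" for x
        using val[OF that(2,1) pq(1)] 1 multiplicative_seq_prime_power[OF mult pq(1)] that(1) by fastforce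
      thus ?thesis using that by simp
    next
      case 2
      have "a x = 0" if "x > 0" "q ^ g dvd x" for x
        using val[OF that(2,1) pq(2)] 2 multiplicative_seq_prime_power[OF mult pq(2)] that(1) by fastforce
      thus ?thesis using that by simp
    next
      case (3 i0 j0)
      have N1: "N \<ge> 1" by (simp add: N_def)
      \<comment> \<open>Multiplication by \<open>p ^ i0\<close> supplies the factor
        \<open>p ^ e\<close> of the modulus \<open>D\<close>, and the nonzero value
        \<open>a (p ^ i0)\<close> is then cancelled.\<close>
      have P1: "a u = a v" if "u \<ge> N" "v \<ge> N" "coprime u (y * p * q)" "coprime v (y * p * q)"
        "[u = v] (mod (q ^ g * d))" for u v
      proof -
        have "[p ^ e * (p ^ (i0 - e) * u) = p ^ e * (p ^ (i0 - e) * v)] (mod (p ^ e * (q ^ g * d)))"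
          using p0 that(5) by (subst cong_mult_cancel_modulus) (auto intro: cong_scalar_left)
        hence "[p ^ i0 * u = p ^ i0 * v] (mod D)" using 3 D
          by (simp add: mult.assoc[symmetric] flip: power_add)
        moreover have "p ^ i0 * x \<ge> N" if "x \<ge> N" for x
          using that p0 by (metis dual_order.trans less_eq_Suc_le mult_le_mono1 nat_mult_1 nat_zero_less_power_iff One_nat_def)
        ultimately have "a (p ^ i0 * u) = a (p ^ i0 * v)"
          using that cpq py by (intro Hq) auto
        moreover have "\<not> p dvd u" "\<not> p dvd v" using that(3,4) pq
          by (metis coprime_common_divisor coprime_mult_right_iff dvd_refl not_prime_unit)+
        ultimately show ?thesis using that(1,2) N1 3 pq
          by (simp add: multiplicative_seq_prime_power[OF mult])
      qed
      have P2: "a u = a v" if "u \<ge> N" "v \<ge> N" "coprime u (y * p * q)" "coprime v (y * p * q)"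
        "[u = v] (mod (p ^ e * d))" for u v
      proof -
        have "[q ^ g * (q ^ (j0 - g) * u) = q ^ g * (q ^ (j0 - g) * v)] (mod (q ^ g * (p ^ e * d)))"
          using p0 that(5) by (subst cong_mult_cancel_modulus) (auto intro: cong_scalar_left)
        hence "[q ^ j0 * u = q ^ j0 * v] (mod D)" using 3 D
          by (simp add: mult.assoc[symmetric] mult.commute[of "q ^ g" "p ^ e"] flip: power_add)
        moreover have "q ^ j0 * x \<ge> N" if "x \<ge> N" for x
          using that p0 by (metis dual_order.trans less_eq_Suc_le mult_le_mono1 nat_mult_1 nat_zero_less_power_iff One_nat_def)
        ultimately have "a (q ^ j0 * u) = a (q ^ j0 * v)"
          using that cpq qy by (intro Hp) (auto simp: coprime_commute)
        moreover have "\<not> q dvd u" "\<not> q dvd v" using that(3,4) pq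
          by (metis coprime_common_divisor coprime_mult_right_iff dvd_refl not_prime_unit)+
        ultimately show ?thesis using that(1,2) N1 3 pq
          by (simp add: multiplicative_seq_prime_power[OF mult])
      qed
      \<comment> \<open>An intermediate \<open>w\<close> agrees with \<open>u\<close> modulo
        \<open>q ^ g * d\<close> and with \<open>v\<close> modulo \<open>p ^ e * d\<close>, so
        \<open>P1\<close> and \<open>P2\<close> link the three values.\<close>
      have P3: "a u = a v" if "u \<ge> N" "v \<ge> N" "coprime u (y * p * q)" "coprime v (y * p * q)"
        "[u = v] (mod d)" for u v
      proof -
        obtain w0 where w0: "[w0 = u] (mod (q ^ g * d))" "[w0 = v] (mod (p ^ e))"
          using binary_chinese_remainder_nat[of "q ^ g * d" "p ^ e" u v] cpq pd by (auto simp: coprime_commute)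
        define w where "w = w0 + N * D"
        have "w = w0 + (q ^ g * d) * (N * p ^ e)" "w = w0 + p ^ e * (N * (q ^ g * d))"
          by (simp_all add: w_def D)
        hence "[w = w0] (mod (q ^ g * d))" "[w = w0] (mod (p ^ e))" using cong_add_mult_self(2) by metis+
        hence w: "[w = u] (mod (q ^ g * d))" "[w = v] (mod (p ^ e))" using w0 cong_trans by blast+
        have wd: "[w = u] (mod d)" using w(1) by (elim cong_dvd_modulus_nat) simp
        have "coprime w y" using cong_dvd_modulus_nat[OF wd yd] that(3)
          by (metis coprime_cong_cong_left coprime_mult_right_iff)
        moreover have "[w = u] (mod q)" using w(1) g1 by (elim cong_dvd_modulus_nat) (simp add: dvd_mult2 dvd_power)
        hence "coprime w q" using that(3) by (metis coprime_cong_cong_left coprime_mult_right_iff)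
        moreover have "[w = v] (mod p)" using w(2) e1 by (elim cong_dvd_modulus_nat) (simp add: dvd_power)
        hence "coprime w p" using that(4) by (metis coprime_cong_cong_left coprime_mult_right_iff)
        ultimately have c: "coprime w (y * p * q)" by simp
        have wN: "w \<ge> N" using D0 by (simp add: w_def trans_le_add2)
        have "[w = v] (mod (p ^ e * d))"
          using w(2) cong_trans[OF wd that(5)] pd by (intro coprime_cong_mult_nat) (auto simp: coprime_commute)
        hence "a w = a v" using P2 c wN that by blast
        moreover have "a w = a u" using P1 c wN that w(1) by blast
        ultimately show ?thesis by simp
      qed
      have yqp: "y * p * q = y * q * p" by simp
      note P3' = P3[unfolded yqp]
      have D'': "D = q ^ g * p ^ e * d" by (simp add: D)
      have key: "a (p ^ e * q ^ g * x) = a (p ^ e) * a (q ^ g) * a z"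
        if x: "x > 0" "p ^ e * q ^ g * x \<ge> N * N" "coprime x y" and z: "z \<ge> N" "coprime z (y * p * q)" "[z = x] (mod d)" for x z
      proof -
        obtain s x1 where s: "x = p ^ s * x1" "\<not> p dvd x1"
          using val[of p 0 x] x pq by auto
        obtain t u where t: "x1 = q ^ t * u" "\<not> q dvd u"
          using val[of q 0 x1] s x(1) pq by auto
        have u0: "u > 0" using s t x by auto
        have pu: "\<not> p dvd u" using s t by auto
        have cu: "coprime u (y * p * q)"
          using x(3) s t pu pq by (auto simp: coprime_commute[of _ p] coprime_commute[of _ q] prime_imp_coprime)
        have eq: "p ^ e * q ^ g * x = p ^ (e + s) * (q ^ (g + t) * u)" by (simp add: s t power_add)
        have "\<not> p dvd q ^ (g + t) * u" using pu cpq pq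
          by (metis coprime_commute coprime_dvd_mult_right_iff coprime_power_right_iff coprime_power_left_iff)
        hence am: "a (p ^ e * q ^ g * x) = a (p ^ (e + s)) * (a (q ^ (g + t)) * a u)"
          unfolding eq using u0 p0 t(2) pq by (simp add: multiplicative_seq_prime_power[OF mult])
        have cpu: "coprime (p ^ s * u) y" "coprime (q ^ t * u) y" using cu py qy by auto
        have gr: "r ^ i * v \<ge> N" if "v \<ge> N" "r > 0" for r i v :: nat
          using that by (metis dual_order.trans less_eq_Suc_le mult_le_mono1 nat_mult_1 nat_zero_less_power_iff One_nat_def)
        show ?thesis
        \<comment> \<open>The product of \<open>p ^ (e + s) * u\<close> and
          \<open>q ^ (g + t) * u\<close> is at least \<open>N * N\<close>, so one of them is at
          least \<open>N\<close>. That prime is exchanged first; the new cofactor \<open>v\<close>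
          is at least \<open>N\<close>, which makes the second exchange possible.\<close>
        proof (cases "p ^ (e + s) * u \<ge> N")
          case True
          obtain v where v: "v \<ge> N" "coprime v (y * p * q)" "[v = p ^ s * u] (mod d)"
            using ex[OF cpu(1)] by blast
          have 1: "a (p ^ (e + s)) * a u = a (p ^ e) * a v"
            by (rule periodic_coprime_merge_aux[OF mult pq D d0 e1 g1 pd qd yD py qy Hq P3 cu True _ N1 v(2,1)])
               (use v in auto)
          have "[q ^ t * v = q ^ t * (p ^ s * u)] (mod d)" using v(3) by (rule cong_scalar_left)
          moreover have "q ^ t * (p ^ s * u) = x" by (simp add: s t)
          ultimately have zv: "[z = q ^ t * v] (mod d)" using z(3) by (metis cong_sym cong_trans)
          have "a (q ^ (g + t)) * a v = a (q ^ g) * a z"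
            by (rule periodic_coprime_merge_aux[OF mult pq(2,1) pq(3)[symmetric] D'' d0 g1 e1 qd pd yD qy py
                  Hp P3' v(2)[unfolded yqp] gr[OF v(1) p0(2)] _ N1 z(2)[unfolded yqp] z(1)])
               (use zv in auto)
          hence "(a (p ^ (e + s)) * a u) * a (q ^ (g + t)) = a (p ^ e) * (a (q ^ g) * a z)"
            unfolding 1 by (simp add: ac_simps)
          thus ?thesis using am by (simp add: ac_simps)
        next
          case False
          have "q ^ (g + t) * u \<ge> N"
          proof (rule ccontr)
            assume "\<not> q ^ (g + t) * u \<ge> N"
            hence "p ^ (e + s) * u * (q ^ (g + t) * u) < N * N" using False by (intro mult_strict_mono) auto
            moreover have "p ^ (e + s) * u * (q ^ (g + t) * u) = p ^ (e + s) * (q ^ (g + t) * u) * u" by simp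
            moreover have "\<dots> \<ge> p ^ (e + s) * (q ^ (g + t) * u)" using u0 by simp
            ultimately show False using x(2) unfolding eq by linarith
          qed
          obtain v where v: "v \<ge> N" "coprime v (y * p * q)" "[v = q ^ t * u] (mod d)"
            using ex[OF cpu(2)] by blast
          have 1: "a (q ^ (g + t)) * a u = a (q ^ g) * a v"
            by (rule periodic_coprime_merge_aux[OF mult pq(2,1) pq(3)[symmetric] D'' d0 g1 e1 qd pd yD qy py
                  Hp P3' cu[unfolded yqp] \<open>q ^ (g + t) * u \<ge> N\<close> _ N1 v(2)[unfolded yqp] v(1)])
               (use v in auto)
          have "[p ^ s * v = p ^ s * (q ^ t * u)] (mod d)" using v(3) by (rule cong_scalar_left)
          moreover have "p ^ s * (q ^ t * u) = x" by (simp add: s t)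
          ultimately have zv: "[z = p ^ s * v] (mod d)" using z(3) by (metis cong_sym cong_trans)
          have "a (p ^ (e + s)) * a v = a (p ^ e) * a z"
            by (rule periodic_coprime_merge_aux[OF mult pq D d0 e1 g1 pd qd yD py qy Hq P3 v(2) gr[OF v(1) p0(1)] _ N1 z(2,1)])
               (use zv in auto)
          hence "a (p ^ (e + s)) * (a (q ^ (g + t)) * a u) = a (q ^ g) * (a (p ^ e) * a z)"
            unfolding 1 by (simp add: ac_simps)
          thus ?thesis using am by (simp add: ac_simps)
        qed
      qed
      have "coprime (p ^ e) (q ^ g)" using cpq by simp
      then obtain m' n' where mn: "m = p ^ e * q ^ g * m'" "n = p ^ e * q ^ g * n'"
        using B(8-11) by (meson divides_mult dvd_def)
      have c: "[m' = n'] (mod d)" using B(7) p0 unfolding mn D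
        by (subst (asm) cong_mult_cancel_modulus) auto
      have "coprime m' y" "coprime n' y" using B mn by auto
      then obtain z where z: "z \<ge> N" "coprime z (y * p * q)" "[z = m'] (mod d)" using ex by blast
      have "[z = n'] (mod d)" using z(3) c cong_trans by blast
      thus ?thesis using key[of m' z] key[of n' z] z B mn \<open>coprime m' y\<close> \<open>coprime n' y\<close> by auto
    qed
  qed
  \<comment> \<open>The term \<open>N * D\<close> keeps the cofactors above \<open>N\<close> after
    division by a power of \<open>p\<close> or \<open>q\<close> dividing \<open>D\<close>; the term
    \<open>N * N\<close> is the threshold of \<open>big\<close>.\<close>
  have "a m = a n" if mn: "m \<ge> N * D + N * N" "n \<ge> N * D + N * N" "coprime m y" "coprime n y" "[m = n] (mod (D * D))" for m n
  proof -
    have N1: "N \<ge> 1" by (simp add: N_def)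
    have mn': "m \<ge> N * D" "n \<ge> N * D" using mn by auto
    have peD: "p ^ e dvd D" "q ^ g dvd D" unfolding D by auto
    have cD: "[m = n] (mod D)" using mn(5) by (elim cong_dvd_modulus_nat) simp
    consider "\<not> p ^ e dvd m" | "\<not> q ^ g dvd m" | "p ^ e dvd m" "q ^ g dvd m" by blast
    thus ?thesis
    proof cases
      case 1
      show ?thesis
        by (rule periodic_coprime_small_valuation[OF mult pq(1) Hp peD(1) D0 N1 mn(5) mn' mn(3,4) 1])
    next
      case 2
      show ?thesis
        by (rule periodic_coprime_small_valuation[OF mult pq(2) Hq peD(2) D0 N1 mn(5) mn' mn(3,4) 2])
    next
      case 3
      have "p ^ e dvd n" "q ^ g dvd n"
        using 3 cong_dvd_iff[OF cong_dvd_modulus_nat[OF cD peD(1)]]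
          cong_dvd_iff[OF cong_dvd_modulus_nat[OF cD peD(2)]] by auto
      moreover have "N * N > 0" using N1 by simp
      hence "m > 0" "n > 0" using mn(1,2) by linarith+
      moreover have "m \<ge> N * N" "n \<ge> N * N" using mn by auto
      ultimately show ?thesis using big 3 mn(3,4) cD by blast
    qed
  qed
  moreover have "D * D > 0" using D0 by simp
  ultimately show ?thesis unfolding periodic_coprime_def by blast
qed

section \<open>Stable bases and sparse supports\<close>

lemma kernel_of_memI: "r < l ^ k \<Longrightarrow> (\<lambda>n. f (n * l ^ k + r)) \<in> kernel_of l f"
  unfolding kernel_of_def by blast

lemma kernel_of_power_subset: "kernel_of (l ^ j) f \<subseteq> kernel_of l f"
  unfolding kernel_of_def by (force simp flip: power_mult)

text \<open>The dilations by powers of the base act on the finite kernel, eventually periodically. Passing to a power of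
  the base makes the period \<open>1\<close>.\<close>
lemma automatic_base_stable:
  assumes "automatic_base l a"
  shows "\<exists>L K. L \<ge> 2 \<and> finite (kernel_of L a) \<and>
    (\<forall>r c n. Suc r * L ^ K \<le> L ^ c \<longrightarrow> a (n * L ^ Suc c + r) = a (n * L ^ c + r))"
proof -
  have l: "l \<ge> 2" and fin: "finite (kernel_of l a)" using assms by (auto simp: automatic_base_def)
  \<comment> \<open>\<open>restrict\<close> makes each dilation a point of the finite set of
    functions from the kernel to itself.\<close>
  define T where "T = (\<lambda>i. restrict (\<lambda>g n. g (n * l ^ i)) (kernel_of l a))"
  have "T i \<in> kernel_of l a \<rightarrow>\<^sub>E kernel_of l a" for i
  proof -
    have "(\<lambda>n. g (n * l ^ i)) \<in> kernel_of l a" if g: "g \<in> kernel_of l a" for g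
    proof -
      obtain k r where g: "g = (\<lambda>n. a (n * l ^ k + r))" "r < l ^ k"
        using g unfolding kernel_of_def by blast
      have "l ^ k \<le> l ^ (i + k)" using l by (intro power_increasing) auto
      hence "r < l ^ (i + k)" using g by simp
      from kernel_of_memI[OF this, of a] show ?thesis by (simp add: g power_add mult.assoc)
    qed
    thus ?thesis by (auto simp: T_def)
  qed
  moreover have "finite (kernel_of l a \<rightarrow>\<^sub>E kernel_of l a)" using fin by (intro finite_PiE)
  ultimately obtain i j where ij: "i < j" "T i = T j"
    using pigeonhole_nat[of "kernel_of l a \<rightarrow>\<^sub>E kernel_of l a" T] by metis
  have eq: "g (n * l ^ i) = g (n * l ^ j)" if "g \<in> kernel_of l a" for g n
    using fun_cong[OF fun_cong[OF ij(2), of g], of n] that by (simp add: T_def)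
  define h where "h = j - i"
  have h: "j = i + h" "h \<ge> 1" using ij by (auto simp: h_def)
  define L where "L = l ^ h"
  have L2: "L \<ge> 2" using l h(2) self_le_power[of l h] by (simp add: L_def)
  have "a (n * L ^ Suc c + r) = a (n * L ^ c + r)" if r: "Suc r * L ^ i \<le> L ^ c" for r c n
  proof -
    have "L ^ i \<le> L ^ c" using r by (metis le_add1 le_trans mult_Suc)
    hence ic: "i \<le> c" using L2 by simp
    then obtain b where c: "c = i + b" using le_Suc_ex by blast
    have "Suc r * L ^ i \<le> L ^ b * L ^ i" using r unfolding c power_add by (simp add: mult.commute)
    hence "Suc r \<le> L ^ b" using L2 by (intro mult_right_le_imp_le[of "Suc r" "L ^ i"]) auto
    hence g: "(\<lambda>n. a (n * l ^ (h * b) + r)) \<in> kernel_of l a"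
      by (intro kernel_of_memI) (simp add: L_def power_mult)
    \<comment> \<open>Of the base-\<open>l\<close> digits above the \<open>h * b\<close> digits
      reserved for \<open>r\<close> at least \<open>i\<close> are available; the coincidence of
      \<open>T i\<close> and \<open>T j\<close> replaces these \<open>i\<close> digits by
      \<open>j = i + h\<close>, which is one more digit in base \<open>L\<close>.\<close>
    have "i \<le> h * i" using h(2) by simp
    then obtain s where s: "h * i = s + i" by (metis add.commute le_Suc_ex)
    have "h * c = h * b + s + i" "h * Suc c = h * b + s + j" using s h(1) unfolding c by (simp_all add: algebra_simps)
    hence "L ^ c = l ^ s * l ^ i * l ^ (h * b)" "L ^ Suc c = l ^ s * l ^ j * l ^ (h * b)"
      unfolding L_def power_mult[symmetric] by (simp_all only: power_add mult.assoc mult.commute mult.left_commute)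
    thus ?thesis using eq[OF g, of "n * l ^ s"] by (simp only: mult.assoc)
  qed
  moreover have "finite (kernel_of L a)" unfolding L_def by (rule finite_subset[OF kernel_of_power_subset fin])
  ultimately show ?thesis using L2 by (intro exI[of _ L] exI[of _ i]) simp
qed

text \<open>The stability produced by \<open>automatic_base_stable\<close> is built in. The
  condition \<open>a 1 = 1\<close> excludes only the sequence that vanishes on all positive
  integers.\<close>

locale multiplicative_automatic =
  fixes a :: "nat \<Rightarrow> complex" and L K :: nat
  assumes mult: "multiplicative_seq a" and a_1: "a 1 = 1" and L_ge_2: "L \<ge> 2"
    and fin: "finite (kernel_of L a)"
    and stable_Suc: "\<And>r c n. Suc r * L ^ K \<le> L ^ c \<Longrightarrow> a (n * L ^ Suc c + r) = a (n * L ^ c + r)"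
begin

lemma L_pos [simp]: "L > 0" using L_ge_2 by simp

lemma stable:
  assumes "Suc r * L ^ K \<le> L ^ c" "c \<le> c'"
  shows "a (n * L ^ c' + r) = a (n * L ^ c + r)"
  using assms(2)
proof (induction c' rule: dec_induct)
  case (step c')
  have "L ^ c \<le> L ^ c'" using step by (intro power_increasing) (auto simp: Suc_le_eq)
  hence "Suc r * L ^ K \<le> L ^ c'" using assms(1) by simp
  thus ?case using stable_Suc step by simp
qed simp

lemma stable_large: "Suc r * L ^ K \<le> L ^ c" if "c \<ge> K + r"
proof -
  have "Suc r \<le> 2 ^ r" by (induction r) auto
  also have "\<dots> \<le> L ^ r" using L_ge_2 by (intro power_mono) auto
  finally have "Suc r * L ^ K \<le> L ^ r * L ^ K" by (rule mult_right_mono) simp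
  also have "\<dots> = L ^ (K + r)" by (simp add: power_add)
  also have "\<dots> \<le> L ^ c" using that by (intro power_increasing) (auto simp: Suc_le_eq)
  finally show ?thesis .
qed

lemma less_of_stable: "r < L ^ c" if "Suc r * L ^ K \<le> L ^ c"
proof -
  have "Suc r * 1 \<le> Suc r * L ^ K" by (intro mult_left_mono) (auto simp: Suc_le_eq)
  thus ?thesis using that by simp
qed

lemma nonzero_prime_power:
  assumes "a n \<noteq> 0" "n > 0" "prime q"
  shows "a (q ^ multiplicity q n) \<noteq> 0"
proof -
  obtain x where "n = q ^ multiplicity q n * x" "\<not> q dvd x" "x > 0"
    using prime_valuation_decompose[OF assms(3,2)] by blast
  thus ?thesis using assms multiplicative_seq_prime_power[OF mult] by (metis mult_eq_0_iff)
qed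

text \<open>Pumping: a factor of the base-\<open>L\<close> expansion of \<open>n\<close> can be repeated without changing the
  value of \<open>a\<close>. The resulting numbers satisfy a first-order linear recurrence, so they cannot all be
  composed of finitely many primes.\<close>
lemma nonzero_bounded_of_finitely_many_primes:
  assumes Q: "finite Q" "\<And>q j. prime q \<Longrightarrow> j \<ge> 1 \<Longrightarrow> a (q ^ j) \<noteq> 0 \<Longrightarrow> q \<in> Q"
    and Qp: "\<And>q. q \<in> Q \<Longrightarrow> prime q"
    and n: "a n \<noteq> 0" "\<not> L dvd n"
  shows "n < L ^ Suc (card (kernel_of L a))"
proof (rule ccontr)
  assume "\<not> n < L ^ Suc (card (kernel_of L a))"
  hence n_ge: "n \<ge> L ^ Suc (card (kernel_of L a))" by simp
  define f where "f = (\<lambda>i m. a (m * L ^ Suc i + n mod L ^ Suc i))"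
  have "f i \<in> kernel_of L a" for i
    unfolding f_def by (intro kernel_of_memI) simp
  then obtain i j where ij: "i < j" "j \<le> card (kernel_of L a)" "f i = f j"
    using pigeonhole_nat[OF fin, of f] by metis
  define b r r' B where "b = Suc i" and "r = n mod L ^ Suc i" and "r' = n mod L ^ Suc j" and "B = L ^ (j - i)"
  have LB: "L ^ Suc j = B * L ^ b" using ij(1) by (simp add: B_def b_def flip: power_add)
  have "r' mod L ^ b = r" unfolding r'_def r_def b_def LB[unfolded b_def] by (simp add: mod_mod_cancel)
  then obtain y where y: "r' = y * L ^ b + r" by (metis div_mult_mod_eq)
  have r0: "r \<noteq> 0" using n(2) unfolding r_def by (metis dvd_trans dvd_power mod_0_imp_dvd zero_less_Suc)
  have rb: "r < L ^ b" unfolding r_def b_def by simp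
  have B2: "B \<ge> 2" using ij(1) L_ge_2 self_le_power[of L "j - i"] by (simp add: B_def)
  have "L dvd B" using ij(1) by (simp add: B_def dvd_power)
  \<comment> \<open>Each step inserts one more copy of the block \<open>y\<close> directly above the
    low digits \<open>r\<close>.\<close>
  define M where "M = rec_nat (n div L ^ b) (\<lambda>_ m. m * B + y)"
  have M0: "M 0 = n div L ^ b" and MS: "M (Suc t) = M t * B + y" for t by (simp_all add: M_def)
  define x where "x = (\<lambda>t. M t * L ^ b + r)"
  have x0: "x 0 = n" unfolding x_def M0 r_def b_def by (rule div_mult_mod_eq)
  have a_x: "a (x t) = a n" for t
  proof (induction t)
    case (Suc t)
    have "x (Suc t) = M t * L ^ Suc j + r'" unfolding LB y x_def MS by (simp add: algebra_simps)
    hence "a (x (Suc t)) = f j (M t)" by (simp add: f_def r'_def)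
    also have "\<dots> = f i (M t)" using ij(3) by simp
    also have "\<dots> = a (x t)" by (simp add: f_def x_def r_def b_def)
    finally show ?case using Suc by simp
  qed (simp add: x0)
  have "L ^ b \<le> L ^ Suc (card (kernel_of L a))"
    using ij(1,2) unfolding b_def by (intro power_increasing) (auto simp: Suc_le_eq)
  hence "M 0 \<ge> 1" unfolding M0 using n_ge by (simp add: Suc_le_eq div_greater_zero_iff)
  hence M_gt: "M t > t" for t
  proof (induction t)
    case (Suc t)
    have "M t * B \<ge> M t * 2" using B2 by (intro mult_left_mono) auto
    thus ?case using Suc unfolding MS by linarith
  qed auto
  have x_gt: "x t > t" for t
  proof -
    have "M t * 1 \<le> M t * L ^ b" by (intro mult_left_mono) (auto simp: Suc_le_eq)
    thus ?thesis using M_gt[of t] unfolding x_def by linarith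
  qed
  \<comment> \<open>The recurrence reads \<open>x (Suc t) = B * x t - c\<close>, so
    \<open>(B - 1) * x t - c\<close> is a geometric progression. If \<open>c\<close> were
    \<open>0\<close>, then \<open>L ^ b\<close>, being coprime to \<open>B - 1\<close>, would divide
    \<open>r\<close>; but \<open>0 < r < L ^ b\<close>.\<close>
  define c where "c = (int B - 1) * int r - int y * int (L ^ b)"
  have c0: "c \<noteq> 0"
  proof
    assume "c = 0"
    hence "(int B - 1) * int r = int y * int (L ^ b)" by (simp add: c_def)
    hence "int ((B - 1) * r) = int (y * L ^ b)" using B2 by (simp add: of_nat_diff)
    hence "L ^ b dvd (B - 1) * r" by (simp only: of_nat_eq_iff) simp
    moreover have "coprime (L ^ b) (B - 1)"
    proof -
      have "coprime B (B - 1)" using B2 by (intro coprime_diff_one_right_nat) simp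
      thus ?thesis using \<open>L dvd B\<close> by (meson coprime_divisors coprime_power_left_iff dvd_refl)
    qed
    ultimately have "L ^ b dvd r" by (simp add: coprime_dvd_mult_right_iff)
    thus False using r0 rb by (simp add: nat_dvd_not_less)
  qed
  have closed: "(int B - 1) * int (x t) - c = int B ^ t * ((int B - 1) * int n - c)" for t
  proof (induction t)
    case (Suc t)
    have "(int B - 1) * int (x (Suc t)) - c = int B * ((int B - 1) * int (x t) - c)"
      by (simp add: x_def MS c_def algebra_simps)
    thus ?case using Suc by simp
  qed (simp add: x0)
  define e where "e = nat \<bar>c\<bar> + 1"
  define t0 where "t0 = e"
  \<comment> \<open>For \<open>q\<close> dividing \<open>B\<close> and large \<open>t\<close>,
    \<open>q ^ e\<close> divides \<open>B ^ t\<close> but not the nonzero number \<open>c\<close>,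
    so it cannot divide \<open>x t\<close>.\<close>
  have val_base: "multiplicity q (x t) \<le> e" if q: "prime q" "q dvd B" "t \<ge> t0" for q t
  proof (rule ccontr)
    assume "\<not> multiplicity q (x t) \<le> e"
    hence "q ^ e dvd x t" by (intro multiplicity_dvd') simp
    hence "int q ^ e dvd int (x t)" by (metis of_nat_dvd_iff of_nat_power)
    hence 1: "int q ^ e dvd (int B - 1) * int (x t)" by (rule dvd_mult)
    have "q ^ e dvd B ^ t" using q(2,3) unfolding t0_def by (meson dvd_power_le)
    hence "int q ^ e dvd int B ^ t" by (metis of_nat_dvd_iff of_nat_power)
    hence 2: "int q ^ e dvd (int B - 1) * int (x t) - c" unfolding closed by (rule dvd_mult2)
    from dvd_diff[OF 1 2] have "int q ^ e dvd c" by simp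
    hence "int q ^ e \<le> \<bar>c\<bar>" using c0 by (metis abs_ge_self dvd_imp_le_int order_trans)
    moreover have "e < q ^ e" using q(1) by (intro power_gt_expt) (simp add: prime_gt_Suc_0_nat)
    hence "int e < int q ^ e" by (metis of_nat_less_iff of_nat_power)
    ultimately show False by (simp add: e_def)
  qed
  define X where "X = x t0"
  have X0: "X > 0" using x_gt[of t0] by (simp add: X_def)
  \<comment> \<open>For the primes in \<open>Q\<close> not dividing \<open>B\<close>:
    \<open>B\<close> is invertible modulo \<open>Z\<close>, so the recurrence is purely periodic
    modulo \<open>Z\<close>, and along multiples of the period the valuations of \<open>x t\<close>
    stay below \<open>X\<close>.\<close>
  define Q' where "Q' = {q \<in> Q. \<not> q dvd B}"
  define Z where "Z = (\<Prod>Q') ^ X"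
  have Z0: "Z > 0" unfolding Z_def using Q(1) Qp by (auto simp: Q'_def prime_gt_0_nat intro!: prod_pos)
  have "coprime (\<Prod>Q') B" unfolding Q'_def using Qp by (intro prod_coprime_left) (auto intro: prime_imp_coprime)
  hence cZ: "coprime B Z" unfolding Z_def by (simp add: coprime_commute)
  define m where "m = (\<lambda>t. M t mod Z)"
  have "m t \<in> {..<Z}" for t using Z0 by (simp add: m_def)
  then obtain s1 s2 where s: "s1 < s2" "m s1 = m s2"
    using pigeonhole_nat[of "{..<Z}" m] by (metis finite_lessThan)
  have down: "[M k = M (h + k)] (mod Z) \<Longrightarrow> [M 0 = M h] (mod Z)" for h k
  proof (induction k)
    case (Suc k)
    hence "[M k * B = M (h + k) * B] (mod Z)" by (simp add: MS cong_add_rcancel_nat)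
    thus ?case using Suc cZ by (simp add: cong_mult_rcancel_nat)
  qed simp
  have "[M s1 = M ((s2 - s1) + s1)] (mod Z)" using s by (simp add: m_def Cong.cong_def)
  hence per0: "[M 0 = M (s2 - s1)] (mod Z)" by (rule down)
  have per: "[M (s2 - s1 + t) = M t] (mod Z)" for t
  proof (induction t)
    case 0 thus ?case using per0 cong_sym by simp
  next
    case (Suc t)
    have "[M (s2 - s1 + t) * B + y = M t * B + y] (mod Z)"
      using Suc by (intro cong_add cong_mult) auto
    thus ?case by (simp add: MS)
  qed
  have per': "[M (k * (s2 - s1) + t0) = M t0] (mod Z)" for k
  proof (induction k)
    case (Suc k)
    have "[M (s2 - s1 + (k * (s2 - s1) + t0)) = M (k * (s2 - s1) + t0)] (mod Z)" by (rule per)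
    hence "[M (s2 - s1 + (k * (s2 - s1) + t0)) = M t0] (mod Z)" using Suc by (rule cong_trans)
    thus ?case by (simp add: add.assoc)
  qed simp
  \<comment> \<open>The valuations of \<open>x t\<close> will be at most those of \<open>G\<close>,
    so \<open>x t\<close> divides \<open>G\<close>; a choice of \<open>t\<close> that is at least
    \<open>G\<close> contradicts \<open>x t > t\<close>.\<close>
  define G where "G = (\<Prod>Q) ^ (e + X)"
  have G0: "G > 0" unfolding G_def using Q(1) Qp by (auto simp: prime_gt_0_nat intro!: prod_pos)
  define t where "t = G * (s2 - s1) + t0"
  have "x t dvd G"
  proof (rule multiplicity_le_imp_dvd)
    show "x t \<noteq> 0" using x_gt[of t] by simp
  next
    fix q :: nat assume q: "prime q"
    show "multiplicity q (x t) \<le> multiplicity q G"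
    proof (cases "multiplicity q (x t) = 0")
      case False
      have "a (q ^ multiplicity q (x t)) \<noteq> 0"
        using a_x[of t] n(1) x_gt[of t] q by (intro nonzero_prime_power) auto
      hence qQ: "q \<in> Q" using Q(2)[OF q, of "multiplicity q (x t)"] False by simp
      hence "q dvd \<Prod>Q" using Q(1) by (intro dvd_prodI) auto
      hence "q ^ (e + X) dvd G" unfolding G_def by (rule dvd_power_same)
      hence "multiplicity q G \<ge> e + X" using G0 q by (intro multiplicity_geI) (auto simp: not_prime_unit)
      moreover have "multiplicity q (x t) \<le> e + X"
      proof (cases "q dvd B")
        case True
        thus ?thesis using val_base[OF q True, of t] by (simp add: t_def)
      next
        case False
        hence "q dvd \<Prod>Q'" using Q(1) qQ unfolding Q'_def by (intro dvd_prodI) auto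
        hence qZ: "q ^ X dvd Z" unfolding Z_def by (rule dvd_power_same)
        have "[x t = X] (mod Z)" unfolding x_def X_def t_def
          by (intro cong_add cong_mult per') auto
        hence cq: "[x t = X] (mod (q ^ X))" using qZ by (rule cong_dvd_modulus_nat)
        have "X < q ^ X" using q by (intro power_gt_expt) (simp add: prime_gt_Suc_0_nat)
        hence "\<not> q ^ X dvd X" using X0 by (simp add: nat_dvd_not_less)
        hence "\<not> q ^ X dvd x t" using cq by (simp add: cong_dvd_iff)
        hence "multiplicity q (x t) < X" by (meson multiplicity_dvd' not_le)
        thus ?thesis by simp
      qed
      ultimately show ?thesis by simp
    qed simp
  qed
  hence "x t \<le> G" using G0 by (simp add: dvd_imp_le)
  moreover have "G * 1 \<le> G * (s2 - s1)" using s by (intro mult_left_mono) auto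
  hence "G \<le> t" unfolding t_def by linarith
  ultimately show False using x_gt[of t] by simp
qed

end

section \<open>Removing primes from the modulus\<close>

context multiplicative_automatic
begin

text \<open>As \<open>L\<close> is not a power of a prime, it divides no prime power. Each prime
  power exactly dividing some \<open>n\<close> with \<open>a n \<noteq> 0\<close> is therefore below
  the pumping bound \<open>N\<close>, and \<open>n\<close> divides \<open>fact N\<close>.\<close>

lemma eventually_zero_of_finitely_many_primes:
  assumes Q: "finite Q" "\<And>q j. prime q \<Longrightarrow> j \<ge> 1 \<Longrightarrow> a (q ^ j) \<noteq> 0 \<Longrightarrow> q \<in> Q"
    and Qp: "\<And>q. q \<in> Q \<Longrightarrow> prime q"
    and nP: "\<And>p i. prime p \<Longrightarrow> L \<noteq> p ^ i"
  shows "periodic_coprime 1 a"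
proof -
  define N where "N = L ^ Suc (card (kernel_of L a))"
  have N1: "N > 1" unfolding N_def using L_ge_2 by (intro one_less_power) auto
  have "n \<le> fact N" if n: "a n \<noteq> 0" "n > 0" for n
  proof -
    have "n dvd fact N"
    proof (rule multiplicity_le_imp_dvd)
      fix q :: nat assume q: "prime q"
      define v where "v = multiplicity q n"
      have "a (q ^ v) \<noteq> 0" unfolding v_def by (rule nonzero_prime_power[OF n q])
      moreover have "\<not> L dvd q ^ v" using nP[OF q] q by (metis divides_primepow_nat)
      ultimately have "q ^ v < N" unfolding N_def
        by (intro nonzero_bounded_of_finitely_many_primes[OF Q Qp]) auto
      hence "q ^ v dvd fact N" using q by (intro dvd_fact) (auto simp: Suc_le_eq prime_gt_0_nat)
      thus "multiplicity q n \<le> multiplicity q (fact N)" unfolding v_def[symmetric]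
        using q by (intro multiplicity_geI) (auto simp: not_prime_unit)
    qed (use n in auto)
    thus ?thesis by (rule dvd_imp_le) simp
  qed
  hence "a n = 0" if "n \<ge> Suc (fact N)" for n using that by fastforce
  thus ?thesis unfolding periodic_coprime_def by (metis zero_less_one)
qed

text \<open>An integer prime to \<open>p\<close> is not divisible by \<open>L\<close>, so by pumping
  \<open>a\<close> vanishes at all large integers prime to \<open>p\<close>.\<close>

lemma periodic_coprime_of_finitely_many_primes:
  assumes Q: "finite Q" "\<And>q j. prime q \<Longrightarrow> j \<ge> 1 \<Longrightarrow> a (q ^ j) \<noteq> 0 \<Longrightarrow> q \<in> Q"
    and Qp: "\<And>q. q \<in> Q \<Longrightarrow> prime q"
    and p: "prime p" "L = p ^ i"
  shows "periodic_coprime p a"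
proof -
  have "i > 0" using p L_ge_2 by (cases i) auto
  hence pL: "p dvd L" using p by (simp add: dvd_power)
  have "a n = 0" if n: "n \<ge> L ^ Suc (card (kernel_of L a))" "coprime n p" for n
  proof (rule ccontr)
    assume "a n \<noteq> 0"
    moreover have "\<not> L dvd n" using pL n(2) p(1)
      by (metis coprime_common_divisor dvd_refl dvd_trans not_prime_unit)
    ultimately have "n < L ^ Suc (card (kernel_of L a))"
      by (intro nonzero_bounded_of_finitely_many_primes[OF Q Qp])
    thus False using n(1) by linarith
  qed
  thus ?thesis unfolding periodic_coprime_def by (metis zero_less_one)
qed

text \<open>A common inverse \<open>w\<close> of \<open>m\<close> and \<open>n\<close> modulo
  \<open>M\<close>, chosen coprime to both as integers, satisfies
  \<open>a m * a w = 1 = a n * a w\<close>.\<close>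

lemma coprime_cong_eq:
  assumes M: "M > 1" "\<And>t. a (1 + M * t) = 1" and mn: "[m = n] (mod M)" "coprime m M"
  shows "a m = a n" "a m \<noteq> 0"
proof -
  have n: "coprime n M" using mn by (metis coprime_cong_cong_left)
  have m0: "m > 0" and n0: "n > 0" using M(1) mn(2) n by (auto intro: Nat.gr0I)
  obtain w where w: "[m * w = 1] (mod M)" "coprime w (m * n)" "w \<ge> 1"
    using coprime_cong_solution[of m M 1 "m * n" 1] mn(2) m0 n0 M(1) by (auto simp: coprime_commute)
  have one: "a x = 1" if x: "[x = 1] (mod M)" "x \<ge> 1" for x
  proof -
    obtain t where "x = t * M + 1" using cong_le_nat[of 1 x M] x by blast
    thus ?thesis using M(2)[of t] by (simp add: ac_simps)
  qed
  have "[n * w = m * w] (mod M)" using mn(1) by (intro cong_scalar_right) (rule cong_sym)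
  hence nw: "[n * w = 1] (mod M)" using w(1) cong_trans by blast
  have "a m * a w = 1"
    using one[OF w(1)] w(2,3) m0 by (subst multiplicative_seqD[OF mult, symmetric]) (auto simp: coprime_commute)
  moreover have "a n * a w = 1"
    using one[OF nw] w(2,3) n0 by (subst multiplicative_seqD[OF mult, symmetric]) (auto simp: coprime_commute)
  ultimately show "a m = a n" "a m \<noteq> 0"
    by (metis mult.commute mult.left_commute mult.right_neutral, force)
qed

text \<open>A coincidence \<open>a (q ^ s * X) = a (q ^ s * (X + d))\<close> in the kernel holds for all large \<open>X\<close> in a
  residue class modulo the prime-to-\<open>q\<close> part of \<open>L ^ k\<close>. If \<open>X\<close> is divisible by a high power of \<open>q\<close>, the
  right-hand side only sees residues of \<open>X\<close> prime to \<open>q\<close>.\<close>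
lemma periodic_coprime_remove_prime:
  assumes M: "\<And>t. a (1 + M * t) = 1" "L dvd M" "M > 0"
    and q: "prime q" "q dvd M" and My: "M = q ^ \<mu> * y" "\<not> q dvd y" and nP: "\<And>i. L \<noteq> q ^ i"
  shows "periodic_coprime y a"
proof -
  have M1: "M > 1" using q M(3) by (metis One_nat_def Suc_lessI gr_zeroI nat_dvd_1_iff_1 not_prime_1)
  note per = coprime_cong_eq[OF M1 M(1)]
  have q0: "q > 0" using q by (simp add: prime_gt_0_nat)
  have y0: "y > 0" using M(3) My by auto
  have \<mu>: "\<mu> \<ge> 1" using q(2) My by (cases \<mu>) auto
  have qy: "coprime q y" using q(1) My(2) by (simp add: prime_imp_coprime)
  define \<alpha> where "\<alpha> = multiplicity q L"
  obtain \<Lambda>0 where \<Lambda>0: "L = q ^ \<alpha> * \<Lambda>0" "\<not> q dvd \<Lambda>0" "\<Lambda>0 > 0"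
    using prime_valuation_decompose[OF q(1) L_pos] unfolding \<alpha>_def by blast
  have "\<Lambda>0 \<noteq> 1" using nP[of \<alpha>] \<Lambda>0(1) by auto
  hence \<Lambda>2: "\<Lambda>0 \<ge> 2" using \<Lambda>0(3) by simp
  have q\<Lambda>: "coprime q \<Lambda>0" using q(1) \<Lambda>0(2) by (simp add: prime_imp_coprime)
  have "\<Lambda>0 dvd q ^ \<mu> * y" using M(2) \<Lambda>0(1) My(1) by (metis dvd_mult_right)
  hence \<Lambda>y: "\<Lambda>0 dvd y" using q\<Lambda> by (simp add: coprime_commute coprime_dvd_mult_right_iff)
  \<comment> \<open>With this \<open>k\<close> the bound \<open>\<Lambda>0 ^ k > k\<close> leaves
    room below \<open>L ^ k\<close> for all residues \<open>q ^ s * (1 + M * i)\<close> with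
    \<open>i \<le> card (kernel_of L a)\<close>.\<close>
  define k where "k = 1 + M * card (kernel_of L a)"
  define \<Lambda> where "\<Lambda> = \<Lambda>0 ^ k"
  have \<Lambda>: "\<Lambda> > k" unfolding \<Lambda>_def using \<Lambda>2 by (intro power_gt_expt) simp
  have \<Lambda>pos: "\<Lambda> > 0" using \<Lambda> by simp
  define s where "s = k * \<alpha>"
  have Lk: "L ^ k = q ^ s * \<Lambda>" by (simp add: \<Lambda>0(1) \<Lambda>_def s_def power_mult_distrib power_mult mult.commute)
  define f where "f = (\<lambda>i m. a (m * L ^ k + q ^ s * (1 + M * i)))"
  have "f i \<in> kernel_of L a" if "i \<le> card (kernel_of L a)" for i
  proof -
    have "M * i \<le> M * card (kernel_of L a)" using that by simp
    hence "1 + M * i < \<Lambda>" using \<Lambda> unfolding k_def by linarith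
    hence "q ^ s * (1 + M * i) < L ^ k" unfolding Lk using q0 by (intro mult_strict_left_mono) auto
    thus ?thesis unfolding f_def by (rule kernel_of_memI)
  qed
  then obtain i0 j0 where ij: "i0 < j0" "f i0 = f j0" using pigeonhole_nat[OF fin, of f] by metis
  define w d where "w = 1 + M * i0" and "d = M * (j0 - i0)"
  have wd: "1 + M * j0 = w + d" using ij(1) by (simp add: w_def d_def flip: distrib_left)
  have shift: "a (q ^ s * X) = a (q ^ s * (X + d))" if X: "X \<ge> w" "[X = w] (mod \<Lambda>)" for X
  proof -
    obtain m where m: "X = m * \<Lambda> + w" using cong_le_nat[of w X \<Lambda>] X by blast
    have "f i0 m = a (q ^ s * X)" unfolding f_def Lk w_def[symmetric] m by (simp add: algebra_simps)
    moreover have "f j0 m = a (q ^ s * (X + d))" unfolding f_def Lk wd m by (simp add: algebra_simps)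
    ultimately show ?thesis using ij(2) by simp
  qed
  have d0: "d > 0" using M(3) ij(1) by (simp add: d_def)
  define \<delta> where "\<delta> = multiplicity q d"
  obtain d' where d': "d = q ^ \<delta> * d'" "\<not> q dvd d'"
    using prime_valuation_decompose[OF q(1) d0] unfolding \<delta>_def by blast
  have "y dvd q ^ \<delta> * d'" using My(1) by (simp add: d_def flip: d'(1))
  hence yd': "y dvd d'" using qy by (simp add: coprime_commute coprime_dvd_mult_right_iff)
  have w\<Lambda>: "coprime w \<Lambda>"
  proof -
    have "coprime w M" unfolding w_def coprime_add_mult_self by simp
    moreover have "\<Lambda>0 dvd M" using \<Lambda>y My(1) by simp
    ultimately show ?thesis unfolding \<Lambda>_def by (meson coprime_divisors coprime_power_right_iff dvd_refl)
  qed
  \<comment> \<open>After removal of \<open>q ^ s\<close>, a multiple of \<open>q ^ e\<close> is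
    still divisible by \<open>q ^ (\<delta> + \<mu>)\<close>. Adding \<open>d\<close> then gives
    \<open>q\<close>-adic valuation exactly \<open>\<delta>\<close>, with a cofactor congruent to
    \<open>d'\<close> modulo \<open>q ^ \<mu>\<close>.\<close>
  define e where "e = s + \<delta> + \<mu>"
  define D where "D = q ^ e * M * \<Lambda>"
  have D0: "D > 0" using q0 M(3) \<Lambda>pos by (simp add: D_def)
  have H: "a m = a n" if "m \<ge> 1" "n \<ge> 1" "coprime m (y * q)" "coprime n (y * q)" "[m = n] (mod D)" for m n
  proof (rule per(1))
    show "[m = n] (mod M)" using that(5) by (elim cong_dvd_modulus_nat) (simp add: D_def)
    show "coprime m M" using that(3) by (simp add: My(1))
  qed
  have pow: "\<exists>U. a m * a v = a (q ^ (s + \<delta>)) * a U \<and> coprime U M \<and> [U = d'] (mod (q ^ \<mu>)) \<and>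
      q ^ (s + \<delta>) * U = m * v + q ^ s * d"
    if m: "q ^ e dvd m" "coprime m y" "m > 0" and v: "coprime v (M * m)" "v > 0"
      "[m * v = q ^ s * w] (mod \<Lambda>)" "v \<ge> w" for m v
  proof -
    obtain m' where m': "m = q ^ e * m'" using m(1) by blast
    define X where "X = q ^ (\<delta> + \<mu>) * m' * v"
    have mX: "m * v = q ^ s * X" by (simp add: m' X_def e_def power_add)
    have "m' > 0" using m(3) m' by auto
    have "q ^ (\<delta> + \<mu>) * m' * v \<ge> 1 * v" using \<open>m' > 0\<close> q0 by (intro mult_right_mono) (auto simp: Suc_le_eq)
    hence Xw: "X \<ge> w" using v(4) unfolding X_def by linarith
    have "coprime (q ^ s) \<Lambda>" using q\<Lambda> by (simp add: \<Lambda>_def)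
    hence "[X = w] (mod \<Lambda>)" using v(3) unfolding mX by (simp add: cong_mult_lcancel_nat)
    from shift[OF Xw this] have sh: "a (m * v) = a (q ^ s * (X + d))" by (simp add: mX)
    define U where "U = q ^ \<mu> * (m' * v) + d'"
    have "X + d = q ^ \<delta> * U" by (simp add: X_def U_def d'(1) power_add algebra_simps)
    hence eq: "q ^ s * (X + d) = q ^ (s + \<delta>) * U" by (simp add: power_add)
    have qU: "\<not> q dvd U" using d'(2) \<mu> unfolding U_def by (simp add: dvd_add_right_iff dvd_mult2 dvd_power)
    hence U0: "U > 0" by (cases U) auto
    have "[U = q ^ \<mu> * (m' * v)] (mod y)" unfolding U_def using yd' by (simp add: cong_add_lcancel_0_nat cong_0_iff)
    moreover have "coprime (q ^ \<mu> * (m' * v)) y" using m(2) m' v(1) qy by (simp add: My(1))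
    ultimately have "coprime U y" by (metis coprime_cong_cong_left)
    hence UM: "coprime U M" using prime_imp_coprime[OF q(1) qU] by (simp add: My(1) coprime_commute)
    have "a (m * v) = a m * a v" using v(1,2) m(3) by (intro multiplicative_seqD[OF mult]) (auto simp: coprime_commute)
    moreover have "a (q ^ (s + \<delta>) * U) = a (q ^ (s + \<delta>)) * a U"
      using qU U0 q(1) by (simp add: multiplicative_seq_prime_power[OF mult])
    moreover have "[U = d'] (mod (q ^ \<mu>))" unfolding U_def by (simp add: cong_add_rcancel_0_nat cong_0_iff)
    moreover have "q ^ (s + \<delta>) * U = m * v + q ^ s * d" using eq mX by (simp add: distrib_left)
    ultimately show ?thesis using sh UM eq by metis
  qed
  have "a m = a n" if mn: "m \<ge> 1 * D" "n \<ge> 1 * D" "coprime m y" "coprime n y" "[m = n] (mod (D * D))" for m n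
  proof (cases "q ^ e dvd m")
    case False
    have "q ^ e dvd D" by (simp add: D_def)
    thus ?thesis by (intro periodic_coprime_small_valuation[OF mult q(1) H _ D0 _ mn(5) mn(1,2,3,4) False]) auto
  next
    case True
    have cD: "[m = n] (mod D)" using mn(5) by (elim cong_dvd_modulus_nat) simp
    have "q ^ e dvd n" using True cong_dvd_iff[OF cong_dvd_modulus_nat[OF cD]] by (simp add: D_def)
    have m0: "m > 0" "n > 0" using mn(1,2) D0 by auto
    obtain m' where m': "m = q ^ e * m'" using True by blast
    have cong\<Lambda>: "[m = n] (mod \<Lambda>)" using cD by (elim cong_dvd_modulus_nat) (simp add: D_def)
    define m1 where "m1 = q ^ (\<delta> + \<mu>) * m'"
    have mm1: "m = q ^ s * m1" by (simp add: m' m1_def e_def power_add)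
    have "coprime m' \<Lambda>" using mn(3) m' \<Lambda>y unfolding \<Lambda>_def
      by (metis coprime_divisors coprime_mult_left_iff coprime_power_right_iff dvd_refl)
    hence "coprime m1 \<Lambda>" unfolding m1_def using q\<Lambda> by (simp add: \<Lambda>_def)
    \<comment> \<open>One \<open>v\<close> serves both \<open>m\<close> and \<open>n\<close>, which
      agree modulo \<open>\<Lambda>\<close>: it moves them, up to the factor \<open>q ^ s\<close>,
      into the class of \<open>w\<close>, where \<open>shift\<close> applies.\<close>
    then obtain v where v: "[m1 * v = w] (mod \<Lambda>)" "coprime v (M * m * n)" "v \<ge> w"
      using coprime_cong_solution[of m1 \<Lambda> w "M * m * n" w] w\<Lambda> M(3) m0 \<Lambda>pos by auto
    have v0: "v > 0" using v(3) by (simp add: w_def)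
    have vm: "[m * v = q ^ s * w] (mod \<Lambda>)" using cong_scalar_left[OF v(1), of "q ^ s"] by (simp add: mm1 mult.assoc)
    have "[n * v = m * v] (mod \<Lambda>)" using cong\<Lambda> by (intro cong_scalar_right) (rule cong_sym)
    hence vn: "[n * v = q ^ s * w] (mod \<Lambda>)" using vm cong_trans by blast
    obtain U where U: "a m * a v = a (q ^ (s + \<delta>)) * a U" "coprime U M" "[U = d'] (mod (q ^ \<mu>))"
      "q ^ (s + \<delta>) * U = m * v + q ^ s * d"
      using pow[OF True mn(3) m0(1) _ v0 vm v(3)] v(2) by auto
    obtain V where V: "a n * a v = a (q ^ (s + \<delta>)) * a V" "coprime V M" "[V = d'] (mod (q ^ \<mu>))"
      "q ^ (s + \<delta>) * V = n * v + q ^ s * d"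
      using pow[OF \<open>q ^ e dvd n\<close> mn(4) m0(2) _ v0 vn v(3)] v(2) by auto
    have "[m = n] (mod y)" using cD by (elim cong_dvd_modulus_nat) (simp add: D_def My(1))
    hence "[q ^ (s + \<delta>) * U = q ^ (s + \<delta>) * V] (mod y)" unfolding U(4) V(4)
      by (intro cong_add cong_mult) auto
    hence "[U = V] (mod y)" using qy by (simp add: cong_mult_lcancel_nat)
    moreover have "[U = V] (mod (q ^ \<mu>))" using U(3) V(3) by (metis cong_sym cong_trans)
    ultimately have "[U = V] (mod M)" unfolding My(1) using qy by (intro coprime_cong_mult_nat) auto
    hence "a U = a V" using U(2) per(1) by blast
    hence "a m * a v = a n * a v" using U(1) V(1) by simp
    moreover have "coprime v M" using v(2) by simp
    hence "a v \<noteq> 0" using per(2)[of v v] by simp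
    ultimately show ?thesis by simp
  qed
  moreover have "D * D > 0" using D0 by simp
  ultimately show ?thesis unfolding periodic_coprime_def by blast
qed

end

section \<open>Zeros\<close>

context multiplicative_automatic
begin

text \<open>\<open>S e\<close> collects the subsequences along all residues modulo
  \<open>L ^ e\<close>, and \<open>S (Suc e)\<close> is a function of \<open>S e\<close>; so the
  sets \<open>S e\<close> are eventually periodic. Whether \<open>x\<close> followed by any
  \<open>e\<close> digits gives zeros depends only on \<open>S e\<close>.\<close>

lemma zero_block_extends:
  "\<exists>e \<delta>. \<delta> \<ge> 1 \<and> (\<forall>x. (\<forall>r<L ^ e. a (x * L ^ e + r) = 0) \<longrightarrow>
     (\<forall>i. \<forall>r<L ^ (e + i * \<delta>). a (x * L ^ (e + i * \<delta>) + r) = 0))"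
proof -
  define S where "S = (\<lambda>e. (\<lambda>r n. a (n * L ^ e + r)) ` {..<L ^ e})"
  define \<Theta> where "\<Theta> = (\<lambda>A :: (nat \<Rightarrow> complex) set. (\<lambda>(g, d) n. g (n * L + d)) ` (A \<times> {..<L}))"
  have step: "S (Suc e) = \<Theta> (S e)" for e
  proof (intro equalityI subsetI)
    fix g assume "g \<in> S (Suc e)"
    then obtain r where r: "r < L ^ Suc e" "g = (\<lambda>n. a (n * L ^ Suc e + r))" by (auto simp: S_def)
    have 1: "r div L ^ e < L" using r(1) by (simp add: less_mult_imp_div_less)
    have 2: "n * L ^ Suc e + r = (n * L + r div L ^ e) * L ^ e + r mod L ^ e" for n
      by (simp add: algebra_simps)
    have "r mod L ^ e < L ^ e" by simp
    hence "(\<lambda>n. a (n * L ^ e + r mod L ^ e)) \<in> S e" by (auto simp: S_def)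
    hence "(\<lambda>(g, d) n. g (n * L + d)) ((\<lambda>n. a (n * L ^ e + r mod L ^ e)), r div L ^ e) \<in> \<Theta> (S e)"
      unfolding \<Theta>_def using 1 by (intro imageI) auto
    thus "g \<in> \<Theta> (S e)" unfolding r(2) 2 by simp
  next
    fix g assume "g \<in> \<Theta> (S e)"
    then obtain r d where rd: "r < L ^ e" "d < L" "g = (\<lambda>n. a ((n * L + d) * L ^ e + r))"
      by (auto simp: \<Theta>_def S_def)
    have "d * L ^ e + r < Suc d * L ^ e" using rd(1) by simp
    also have "\<dots> \<le> L * L ^ e" using rd(2) by (intro mult_right_mono) auto
    finally have "d * L ^ e + r < L ^ Suc e" by simp
    moreover have "(n * L + d) * L ^ e + r = n * L ^ Suc e + (d * L ^ e + r)" for n by (simp add: algebra_simps)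
    hence "g = (\<lambda>n. a (n * L ^ Suc e + (d * L ^ e + r)))" unfolding rd(3) by (simp only:)
    ultimately show "g \<in> S (Suc e)" unfolding S_def by blast
  qed
  have "S e \<in> Pow (kernel_of L a)" for e unfolding S_def by (auto intro: kernel_of_memI)
  moreover have "finite (Pow (kernel_of L a))" using fin by simp
  ultimately obtain e e' where e: "e < e'" "S e = S e'"
    using pigeonhole_nat[of "Pow (kernel_of L a)" S] by metis
  have shift: "S (e + i) = S (e' + i)" for i by (induction i) (simp_all add: e step)
  have per: "S (e + i * (e' - e)) = S e" for i
  proof (induction i)
    case (Suc i)
    have "e + Suc i * (e' - e) = e' + i * (e' - e)" using e(1) by simp
    thus ?case using shift[of "i * (e' - e)"] Suc by simp
  qed simp
  have zero: "(\<forall>r<L ^ e. a (x * L ^ e + r) = 0) \<longleftrightarrow> (\<forall>g\<in>S e. g x = 0)" for x e by (auto simp: S_def)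
  show ?thesis
    by (rule exI[of _ e], rule exI[of _ "e' - e"], unfold zero per) (use e in auto)
qed

text \<open>By the Chinese remainder theorem some \<open>x\<close> has each \<open>x + i\<close>
  exactly divisible by \<open>f i ^ J i\<close>, for distinct primes \<open>f i\<close> with
  \<open>a (f i ^ J i) = 0\<close>.\<close>

lemma zero_run:
  assumes "infinite {q. prime q \<and> (\<exists>j\<ge>1. a (q ^ j) = 0)}"
  shows "\<exists>n. \<forall>i<N. a (n + i) = 0"
proof -
  obtain f :: "nat \<Rightarrow> nat" where f: "inj f" "range f \<subseteq> {q. prime q \<and> (\<exists>j\<ge>1. a (q ^ j) = 0)}"
    using infinite_countable_subset[OF assms] by blast
  hence "\<forall>i. \<exists>j. a (f i ^ j) = 0" by blast
  then obtain J where J: "\<And>i. a (f i ^ J i) = 0" by metis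
  have p: "prime (f i)" for i using f(2) by blast
  \<comment> \<open>The summand \<open>(f i ^ Suc (J i) - 1) * i\<close> stands for
    \<open>- i\<close> in the natural numbers.\<close>
  have "\<exists>x. \<forall>i\<in>{..<N}. [x = f i ^ J i + (f i ^ Suc (J i) - 1) * i] (mod (f i ^ Suc (J i)))"
  proof (rule chinese_remainder_nat)
    show "\<forall>i\<in>{..<N}. \<forall>j\<in>{..<N}. i \<noteq> j \<longrightarrow> coprime (f i ^ Suc (J i)) (f j ^ Suc (J j))"
      using p f(1) by (auto intro!: primes_coprime simp: inj_eq)
  qed simp
  then obtain x where x: "\<And>i. i < N \<Longrightarrow> [x = f i ^ J i + (f i ^ Suc (J i) - 1) * i] (mod (f i ^ Suc (J i)))"
    by auto
  have "a (x + i) = 0" if i: "i < N" for i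
  proof -
    define q j where "q = f i" and "j = J i"
    have q: "prime q" "a (q ^ j) = 0" using p J by (auto simp: q_def j_def)
    have q0: "q > 0" using q by (simp add: prime_gt_0_nat)
    have "q ^ Suc j > 0" using q0 by simp
    then obtain Q where "q ^ Suc j = Suc Q" using gr0_implies_Suc by blast
    hence eq: "q ^ j + (q ^ Suc j - 1) * i + i = q ^ j + q ^ Suc j * i" by (simp only:) simp
    have "[x + i = q ^ j + (q ^ Suc j - 1) * i + i] (mod (q ^ Suc j))"
      using x[OF i] unfolding q_def j_def by (intro cong_add) auto
    hence "[x + i = q ^ j] (mod (q ^ Suc j))" unfolding eq using cong_add_mult_self(2) cong_trans by blast
    note c = this
    have "[x + i = q ^ j] (mod (q ^ j))" using c by (elim cong_dvd_modulus_nat) simp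
    hence "q ^ j dvd x + i" by (simp add: cong_dvd_iff)
    then obtain y where y: "x + i = q ^ j * y" by blast
    have ny: "\<not> q dvd y"
    proof
      assume "q dvd y"
      hence "q ^ Suc j dvd x + i" using y by simp
      hence "q ^ Suc j dvd q ^ j" using cong_dvd_iff[OF c] by simp
      thus False using q(1) q0 by (simp add: dvd_power_iff_le prime_ge_2_nat)
    qed
    hence "y > 0" by (cases y) auto
    thus ?thesis unfolding y using q ny by (simp add: multiplicative_seq_prime_power[OF mult])
  qed
  thus ?thesis by blast
qed

text \<open>The powers of an integer \<open>k\<close> prime to \<open>L\<close> have arbitrary leading digits in base \<open>L\<close>. Hence a block of zeros
  of \<open>a\<close>, which by automaticity makes all continuations of some leading digits zeros, is incompatible with a
  dilation \<open>m \<mapsto> k * m\<close> preserving \<open>a (1 + M * m)\<close>.\<close>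
lemma finitely_many_zero_primes:
  assumes inf: "infinite {q. prime q \<and> (\<exists>j\<ge>1. a (q ^ j) \<noteq> 0)}"
  shows "finite {q. prime q \<and> (\<exists>j\<ge>1. a (q ^ j) = 0)}"
proof (rule ccontr)
  assume infz: "infinite {q. prime q \<and> (\<exists>j\<ge>1. a (q ^ j) = 0)}"
  define A where "A = {q. prime q \<and> (\<exists>j\<ge>1. a (q ^ j) \<noteq> 0)} - {q. q dvd L}"
  have "finite {q. q dvd L}" using L_pos by (intro finite_divisors_nat)
  hence "infinite A" unfolding A_def using inf by (rule Diff_infinite_finite)
  then obtain f :: "nat \<Rightarrow> nat" where f: "inj f" "range f \<subseteq> A" using infinite_countable_subset by blast
  hence "\<forall>i. \<exists>j. j \<ge> 1 \<and> a (f i ^ j) \<noteq> 0" unfolding A_def by blast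
  then obtain J where J: "\<And>i. J i \<ge> 1" "\<And>i. a (f i ^ J i) \<noteq> 0" by metis
  have p: "prime (f i)" "\<not> f i dvd L" for i using f(2) unfolding A_def by blast+
  define v where "v = (\<lambda>i. f i ^ J i)"
  have v0: "v i > 0" for i using p(1)[of i] by (simp add: v_def prime_gt_0_nat)
  have v2: "v i \<ge> 2" for i
    using prime_ge_2_nat[OF p(1)[of i]] self_le_power[of "f i" "J i"] J(1)[of i] unfolding v_def by linarith
  have vc: "coprime (v i) (v j)" if "i \<noteq> j" for i j
    using p that f(1) unfolding v_def by (auto intro!: primes_coprime simp: inj_eq)
  have vL: "coprime (v i) L" for i using p[of i] unfolding v_def by (simp add: prime_imp_coprime)
  \<comment> \<open>Products over disjoint index ranges are coprime to each other and to
    \<open>L\<close>, and \<open>a\<close> is nonzero at each of them.\<close>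
  define W where "W = (\<lambda>i j. \<Prod>t\<in>{i..<j}. v t)"
  have W0: "W i j > 0" for i j unfolding W_def using v0 by (simp add: prod_pos)
  have WL: "coprime (W i j) L" for i j unfolding W_def using vL by (intro prod_coprime_left)
  have Wc: "coprime (W i j) (W k l)" if "j \<le> k" for i j k l
    unfolding W_def using that by (intro prod_coprime_left prod_coprime_right vc) auto
  have Wm: "W i k = W i j * W j k" if "i \<le> j" "j \<le> k" for i j k
    unfolding W_def using that by (simp add: prod.atLeastLessThan_concat)
  have W2: "W i j \<ge> 2" if "i < j" for i j
  proof -
    have "v i dvd W i j" unfolding W_def using that by (intro dvd_prodI) auto
    thus ?thesis using v2[of i] W0[of i j] by (meson dvd_imp_le le_trans)
  qed
  have aW: "a (W i j) \<noteq> 0" for i j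
  proof (induction j)
    case 0 thus ?case using a_1 by (simp add: W_def)
  next
    case (Suc j)
    show ?case
    proof (cases "i \<le> j")
      case True
      hence "W i (Suc j) = W i j * v j" by (simp add: W_def)
      moreover have "v j = W j (Suc j)" by (simp add: W_def)
      hence "coprime (W i j) (v j)" using Wc[of j j i "Suc j"] by simp
      ultimately show ?thesis using Suc J(2)[of j] W0 v0 multiplicative_seqD[OF mult] by (simp add: v_def)
    next
      case False thus ?thesis using a_1 by (simp add: W_def)
    qed
  qed
  \<comment> \<open>A coincidence among these kernel elements yields \<open>r\<close> and
    \<open>k\<close> such that \<open>r\<close> and \<open>r * k\<close> are interchangeable as low
    digits.\<close>
  define g where "g = (\<lambda>i m. a (m * L ^ (K + W 0 i) + W 0 i))"
  have "g i \<in> kernel_of L a" for i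
    unfolding g_def by (intro kernel_of_memI less_of_stable stable_large) simp
  then obtain i j where ij: "i < j" "g i = g j" using pigeonhole_nat[OF fin, of g] by metis
  define r k c where "r = W 0 i" and "k = W i j" and "c = K + W 0 i + W 0 j"
  have rk: "W 0 j = r * k" using Wm[of 0 i j] ij(1) by (simp add: r_def k_def)
  have eq: "a (m * L ^ c + r) = a (m * L ^ c + r * k)" for m
  proof -
    have "a (m * L ^ c + r) = g i m"
      unfolding g_def r_def by (intro stable stable_large) (auto simp: c_def)
    also have "\<dots> = g j m" using ij(2) by simp
    also have "\<dots> = a (m * L ^ c + r * k)"
      unfolding g_def rk[symmetric] by (intro stable[symmetric] stable_large) (auto simp: c_def)
    finally show ?thesis .
  qed
  have r0: "r > 0" "k > 0" using W0 by (auto simp: r_def k_def)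
  have crk: "coprime r k" unfolding r_def k_def by (rule Wc) simp
  have ar: "a r \<noteq> 0" "a (r * k) = a r" using aW eq[of 0] by (auto simp: r_def)
  define M where "M = L ^ c * (r * k)"
  have M0: "M > 0" using r0 by (simp add: M_def)
  \<comment> \<open>\<open>r * (1 + M * (k * m))\<close> and \<open>r * k * (1 + M * m)\<close> have
    the same leading part, and low digits \<open>r\<close> and \<open>r * k\<close>
    respectively.\<close>
  have dil: "a (1 + M * (k * m)) = a (1 + M * m)" for m
  proof -
    have "a r * a (1 + M * (k * m)) = a (r * (1 + M * (k * m)))"
      using r0 coprime_one_add_mult[of r "L ^ c * k * (k * m)"]
      by (intro multiplicative_seqD[OF mult, symmetric]) (simp_all add: M_def ac_simps)
    also have "r * (1 + M * (k * m)) = (r * r * (k * k) * m) * L ^ c + r" by (simp add: M_def algebra_simps)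
    also have "a \<dots> = a ((r * r * (k * k) * m) * L ^ c + r * k)" by (rule eq)
    also have "(r * r * (k * k) * m) * L ^ c + r * k = (r * k) * (1 + M * m)" by (simp add: M_def algebra_simps)
    also have "a \<dots> = a (r * k) * a (1 + M * m)"
      using r0 coprime_one_add_mult[of "r * k" "L ^ c * m"]
      by (intro multiplicative_seqD[OF mult]) (simp_all add: M_def ac_simps)
    finally show ?thesis using ar by simp
  qed
  have dil': "a (1 + M * (k ^ i * m)) = a (1 + M * m)" for i m
  proof (induction i)
    case (Suc i) thus ?case using dil[of "k ^ i * m"] by (simp add: mult.assoc)
  qed simp
  have k2: "k \<ge> 2" unfolding k_def using ij(1) by (rule W2)
  have kL: "coprime k L" unfolding k_def by (rule WL)
  \<comment> \<open>Two of the products \<open>W j (j + t)\<close> agree modulo \<open>M\<close>;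
    their quotient \<open>D\<close> is congruent to \<open>1\<close> modulo \<open>M\<close>, and
    \<open>a D\<close> is nonzero.\<close>
  have "\<exists>m0\<ge>1. a (1 + M * m0) \<noteq> 0"
  proof -
    define h where "h = (\<lambda>t. W j (j + t) mod M)"
    have "h t \<in> {..<M}" for t using M0 by (simp add: h_def)
    then obtain s t where st: "s < t" "h s = h t" using pigeonhole_nat[of "{..<M}" h] by (metis finite_lessThan)
    define D where "D = W (j + s) (j + t)"
    have "[W j (j + s) * 1 = W j (j + s) * D] (mod M)"
      using st Wm[of j "j + s" "j + t"] by (simp add: h_def D_def Cong.cong_def)
    moreover have "coprime (W j (j + s)) M"
      using WL[of j "j + s"] Wc[of j j 0 "j + s"] unfolding M_def rk[symmetric] by (simp add: coprime_commute)
    ultimately have "[1 = D] (mod M)" using cong_mult_lcancel_nat by blast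
    hence "[D = 1] (mod M)" by (rule cong_sym)
    moreover have D2: "D \<ge> 2" unfolding D_def using st(1) by (intro W2) simp
    ultimately obtain m where m: "D = m * M + 1" using cong_le_nat[of 1 D M] by auto
    hence "m \<ge> 1" using D2 by (cases m) auto
    moreover have "a (1 + M * m) \<noteq> 0" using aW[of "j + s" "j + t"] m unfolding D_def by (simp add: ac_simps)
    ultimately show ?thesis by blast
  qed
  then obtain m0 where m0: "m0 \<ge> 1" "a (1 + M * m0) \<noteq> 0" by blast
  obtain e \<delta> where \<delta>: "\<delta> \<ge> 1" and ext: "\<And>x i r. (\<And>r. r < L ^ e \<Longrightarrow> a (x * L ^ e + r) = 0) \<Longrightarrow>
     r < L ^ (e + i * \<delta>) \<Longrightarrow> a (x * L ^ (e + i * \<delta>) + r) = 0"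
    using zero_block_extends by blast
  \<comment> \<open>A run of length \<open>2 * L ^ e\<close> contains a full block starting at a
    multiple of \<open>L ^ e\<close>.\<close>
  obtain n where n: "\<And>i. i < 2 * L ^ e \<Longrightarrow> a (n + i) = 0" using zero_run[OF infz, of "2 * L ^ e"] by blast
  define x where "x = n div L ^ e + 1"
  have block: "a (x * L ^ e + r) = 0" if r: "r < L ^ e" for r
  proof -
    have 1: "n div L ^ e * L ^ e + n mod L ^ e = n" by (rule div_mult_mod_eq)
    have 2: "n mod L ^ e < L ^ e" by simp
    have "x * L ^ e + r = n + (L ^ e - n mod L ^ e + r)" using 1 2 unfolding x_def add_mult_distrib by linarith
    moreover have "L ^ e - n mod L ^ e + r < 2 * L ^ e" using r 2 by simp
    ultimately show ?thesis using n by metis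
  qed
  have L\<delta>: "L ^ \<delta> \<ge> 2" using \<delta> L_ge_2 self_le_power[of L \<delta>] by simp
  \<comment> \<open>The base \<open>L ^ \<delta>\<close> matches the exponents to which the zero
    block extends. The bound \<open>x + 1 / 2\<close> leaves room for the summand \<open>1\<close>,
    so that \<open>1 + y\<close> still has the leading digits \<open>x\<close>.\<close>
  have "\<exists>i h. h \<ge> 1 \<and> real x * real (L ^ \<delta>) ^ h < (real (M * m0) / real (L ^ e)) * real k ^ i \<and>
      (real (M * m0) / real (L ^ e)) * real k ^ i < (real x + 1 / 2) * real (L ^ \<delta>) ^ h"
  proof (rule leading_digits)
    show "coprime k (L ^ \<delta>)" using kL by simp
    show "real (M * m0) / real (L ^ e) > 0" using M0 m0 by simp
    show "real x > 0" by (simp add: x_def)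
  qed (use k2 L\<delta> in auto)
  then obtain i h where ih: "h \<ge> 1" "real x * real (L ^ \<delta>) ^ h < (real (M * m0) / real (L ^ e)) * real k ^ i"
      "(real (M * m0) / real (L ^ e)) * real k ^ i < (real x + 1 / 2) * real (L ^ \<delta>) ^ h" by blast
  define E y where "E = L ^ (e + h * \<delta>)" and "y = M * m0 * k ^ i"
  have E: "real E = real (L ^ \<delta>) ^ h * real (L ^ e)" by (simp add: E_def power_add power_mult mult.commute flip: power_mult)
  have Le: "real (L ^ e) > 0" by simp
  have "real (x * E) < real y" using ih(2) Le unfolding of_nat_mult E by (simp add: field_simps y_def)
  hence 1: "x * E < y" by linarith
  have "real (2 * y) < real ((2 * x + 1) * E)" using ih(3) Le unfolding of_nat_mult E by (simp add: field_simps y_def)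
  hence 2: "2 * y < (2 * x + 1) * E" by linarith
  have "1 * 1 \<le> h * \<delta>" using ih(1) \<delta> by (rule mult_le_mono)
  hence "1 \<le> e + h * \<delta>" by linarith
  hence "L ^ 1 \<le> E" unfolding E_def by (rule power_increasing) (use L_ge_2 in simp)
  hence E2: "E \<ge> 2" using L_ge_2 by simp
  define r' where "r' = 1 + y - x * E"
  have "(2 * x + 1) * E = 2 * (x * E) + E" by (simp add: algebra_simps)
  hence r': "1 + y = x * E + r'" "r' < E" using 1 2 E2 unfolding r'_def by linarith+
  have "a (x * E + r') = 0" unfolding E_def by (rule ext[OF block]) (use r' in \<open>auto simp: E_def\<close>)
  hence "a (1 + M * (k ^ i * m0)) = 0" unfolding r'(1)[symmetric] by (simp add: y_def ac_simps)
  thus False using dil' m0 by simp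
qed

end

section \<open>The transformation semigroup of residue classes\<close>

lemma finite_surj_power_id:
  assumes "finite B" "f ` B = B"
  obtains n where "n > 0" "\<And>x. x \<in> B \<Longrightarrow> (f ^^ n) x = x"
proof -
  have img: "(f ^^ i) ` B = B" for i
  proof (induction i)
    case (Suc i)
    have "(f ^^ Suc i) ` B = f ` ((f ^^ i) ` B)" by (simp add: image_comp)
    thus ?case using Suc assms(2) by simp
  qed simp
  define T where "T = (\<lambda>i. restrict (f ^^ i) B)"
  have "T i \<in> B \<rightarrow>\<^sub>E B" for i using img[of i] by (auto simp: T_def)
  moreover have "finite (B \<rightarrow>\<^sub>E B)" using assms(1) by (intro finite_PiE)
  ultimately obtain i j where ij: "i < j" "T i = T j" using pigeonhole_nat[of "B \<rightarrow>\<^sub>E B" T] by metis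
  have "(f ^^ (j - i)) x = x" if x: "x \<in> B" for x
  proof -
    obtain y where y: "y \<in> B" "x = (f ^^ i) y" using img[of i] x by blast
    have "(f ^^ (j - i)) x = (f ^^ (j - i + i)) y" by (simp add: y(2) funpow_add)
    also have "\<dots> = T j y" using ij(1) y(1) by (simp add: T_def)
    also have "\<dots> = T i y" using ij(2) by simp
    also have "\<dots> = x" using y by (simp add: T_def)
    finally show ?thesis .
  qed
  thus ?thesis using that[of "j - i"] ij(1) by simp
qed

context multiplicative_automatic
begin

text \<open>Enlarging the exponent \<open>K + r\<close> does not change this function, see \<open>cls_eval\<close>.\<close>
definition cls :: "nat \<Rightarrow> nat \<Rightarrow> nat \<Rightarrow> complex" where
  "cls R r = (\<lambda>m. a (m * R * L ^ (K + r) + r))"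

lemma cls_eval:
  assumes "Suc r * L ^ K \<le> L ^ c"
  shows "cls R r m = a (m * R * L ^ c + r)"
proof (cases "c \<le> K + r")
  case True
  show ?thesis unfolding cls_def by (rule stable[OF assms True])
next
  case False
  show ?thesis unfolding cls_def by (rule stable[symmetric, OF stable_large]) (use False in auto)
qed

lemma cls_0: "cls R r 0 = a r"
  by (simp add: cls_def)

lemma finite_range_cls: "finite (range (cls R))"
proof -
  have "cls R r \<in> (\<lambda>g m. g (m * R)) ` kernel_of L a" for r
    unfolding cls_def
    by (rule image_eqI[where x = "\<lambda>n. a (n * L ^ (K + r) + r)"])
       (auto intro!: kernel_of_memI less_of_stable stable_large)
  hence "range (cls R) \<subseteq> (\<lambda>g m. g (m * R)) ` kernel_of L a" by blast
  thus ?thesis using fin finite_surj by blast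
qed

text \<open>\<open>R0\<close> is a product of one admissible dilation for each of the finitely many
  pairs. With it, the extra factors produced by multiplying residues do not affect which classes are
  identified.\<close>

lemma ex_uniform_dilation:
  "\<exists>R0>0. \<forall>\<phi>\<in>kernel_of L a. \<forall>\<psi>\<in>kernel_of L a. \<forall>R>0.
     (\<forall>m. \<phi> (m * R) = \<psi> (m * R)) \<longrightarrow> (\<forall>m. \<phi> (m * R0) = \<psi> (m * R0))"
proof -
  define G where "G = {(\<phi>, \<psi>). \<phi> \<in> kernel_of L a \<and> \<psi> \<in> kernel_of L a \<and> (\<exists>R>0. \<forall>m. \<phi> (m * R) = \<psi> (m * R))}"
  have "\<forall>z\<in>G. \<exists>R>0. \<forall>m. fst z (m * R) = snd z (m * R)" by (auto simp: G_def)
  then obtain F where F: "\<And>z. z \<in> G \<Longrightarrow> F z > (0::nat)" "\<And>z m. z \<in> G \<Longrightarrow> fst z (m * F z) = snd z (m * F z)"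
    by metis
  have "G \<subseteq> kernel_of L a \<times> kernel_of L a" by (auto simp: G_def)
  hence finG: "finite G" using fin by (meson finite_SigmaI finite_subset)
  have "\<phi> (m * prod F G) = \<psi> (m * prod F G)"
    if h: "\<phi> \<in> kernel_of L a" "\<psi> \<in> kernel_of L a" "R > 0" "\<forall>m. \<phi> (m * R) = \<psi> (m * R)" for \<phi> \<psi> R m
  proof -
    have z: "(\<phi>, \<psi>) \<in> G" using h by (auto simp: G_def)
    then obtain s where "prod F G = F (\<phi>, \<psi>) * s" using dvd_prodI[OF finG z] by blast
    hence "m * prod F G = (m * s) * F (\<phi>, \<psi>)" by simp
    thus ?thesis using F(2)[OF z, of "m * s"] by (simp only: fst_conv snd_conv)
  qed
  moreover have "prod F G > 0" using F(1) by (intro prod_pos) auto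
  ultimately show ?thesis by blast
qed

text \<open>Only finitely many classes exist, and some of them are avoided by all integers coprime
  to some \<open>Y\<close>. Putting one such \<open>Y\<close> for each of these into
  \<open>P\<close> leaves only classes with representatives coprime to any given number.\<close>

lemma ex_recurrent_modulus:
  assumes "P1 > 0"
  shows "\<exists>P>0. P1 dvd P \<and> (\<forall>r Y. coprime r P \<longrightarrow> Y > 0 \<longrightarrow> (\<exists>r'. coprime r' (P * Y) \<and> cls R r' = cls R r))"
proof -
  define G where "G = {\<beta> \<in> range (cls R). \<exists>Y>0. \<forall>r'. coprime r' Y \<longrightarrow> cls R r' \<noteq> \<beta>}"
  have finG: "finite G" using finite_range_cls[of R] by (simp add: G_def)
  have "\<forall>\<beta>\<in>G. \<exists>Y>0. \<forall>r'. coprime r' Y \<longrightarrow> cls R r' \<noteq> \<beta>" by (auto simp: G_def)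
  then obtain F where F: "\<And>\<beta>. \<beta> \<in> G \<Longrightarrow> F \<beta> > (0::nat)" "\<And>\<beta> r'. \<beta> \<in> G \<Longrightarrow> coprime r' (F \<beta>) \<Longrightarrow> cls R r' \<noteq> \<beta>"
    by metis
  define P where "P = P1 * prod F G"
  have P0: "P > 0" unfolding P_def using assms F(1) by (auto intro!: prod_pos)
  have "\<exists>r'. coprime r' (P * Y) \<and> cls R r' = cls R r" if h: "coprime r P" "Y > 0" for r Y
  proof -
    have "cls R r \<notin> G"
    proof
      assume z: "cls R r \<in> G"
      have "coprime r (prod F G)" using h(1) by (simp add: P_def)
      hence "coprime r (F (cls R r))" using dvd_prodI[OF finG z] by (meson coprime_divisors dvd_refl)
      thus False using F(2)[OF z] by blast
    qed
    moreover have "P * Y > 0" using P0 h(2) by simp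
    ultimately show ?thesis unfolding G_def by blast
  qed
  moreover have "P1 dvd P" by (simp add: P_def)
  ultimately show ?thesis using P0 by blast
qed

end

text \<open>\<open>uniform\<close> and \<open>recurrent\<close> come from
  \<open>ex_uniform_dilation\<close> and \<open>ex_recurrent_modulus\<close>. As \<open>L\<close>
  and \<open>L - 1\<close> divide \<open>P\<close>, a prime not dividing \<open>P\<close> does not
  divide \<open>L ^ Suc c - L ^ c\<close>.\<close>

locale nonvanishing_automatic = multiplicative_automatic +
  fixes P R0 :: nat
  assumes P_pos: "P > 0" and L_dvd_P: "L dvd P" and L1_dvd_P: "(L - 1) dvd P"
    and nonzero: "\<And>n. n > 0 \<Longrightarrow> coprime n P \<Longrightarrow> a n \<noteq> 0"
    and R0_pos: "R0 > 0"
    and uniform: "\<And>\<phi> \<psi> R m. \<phi> \<in> kernel_of L a \<Longrightarrow> \<psi> \<in> kernel_of L a \<Longrightarrow> R > 0 \<Longrightarrow>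
      (\<And>m. \<phi> (m * R) = \<psi> (m * R)) \<Longrightarrow> \<phi> (m * R0) = \<psi> (m * R0)"
    and recurrent: "\<And>r Y. coprime r P \<Longrightarrow> Y > 0 \<Longrightarrow> \<exists>r'. coprime r' (P * Y) \<and> cls R0 r' = cls R0 r"
begin

section \<open>Residue classes and their representatives\<close>

abbreviation \<kappa> :: "nat \<Rightarrow> nat \<Rightarrow> complex" where "\<kappa> \<equiv> cls R0"

text \<open>The factor \<open>P\<close> keeps \<open>r + t * R * L ^ c\<close> coprime to
  \<open>P\<close> whenever \<open>r\<close> is, see \<open>coprime_shift\<close>.\<close>

definition R :: nat where "R = R0 * P"

definition B :: "(nat \<Rightarrow> complex) set" where "B = \<kappa> ` {r. coprime r P}"

lemma P_ge_2: "P \<ge> 2"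
  using L_dvd_P P_pos L_ge_2 by (meson dvd_imp_le le_trans)

lemma coprime_P_pos: "coprime r P \<Longrightarrow> r > 0"
  using P_ge_2 by (intro Nat.gr0I) auto

lemma finite_B: "finite B"
  unfolding B_def using finite_range_cls[of R0] by (meson finite_subset image_mono subset_UNIV)

lemma B_cases: assumes "\<beta> \<in> B" "Y > 0" obtains r where "coprime r P" "coprime r Y" "\<beta> = \<kappa> r"
proof -
  obtain s where s: "coprime s P" "\<beta> = \<kappa> s" using assms(1) by (auto simp: B_def)
  obtain r where "coprime r (P * Y)" "\<kappa> r = \<kappa> s" using recurrent[OF s(1) assms(2)] by blast
  thus ?thesis using that[of r] s by simp
qed

lemma in_B: "coprime r P \<Longrightarrow> \<kappa> r \<in> B"
  by (simp add: B_def)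

text \<open>By \<open>uniform\<close>, agreement along one dilation \<open>S\<close> already gives
  agreement along \<open>R0\<close>.\<close>

lemma \<kappa>_eqI:
  assumes "Suc r * L ^ K \<le> L ^ c" "Suc r' * L ^ K \<le> L ^ c" "S > 0"
    and "\<And>m. a (m * S * L ^ c + r) = a (m * S * L ^ c + r')"
  shows "\<kappa> r = \<kappa> r'"
proof
  fix m
  have "(\<lambda>n. a (n * L ^ c + r)) (m * R0) = (\<lambda>n. a (n * L ^ c + r')) (m * R0)"
    by (rule uniform[OF _ _ assms(3)]) (use assms in \<open>auto intro!: kernel_of_memI less_of_stable\<close>)
  thus "\<kappa> r m = \<kappa> r' m" using cls_eval assms(1,2) by simp
qed

text \<open>The sequence of the shifted class reads the sequence of \<open>r\<close> at the points
  \<open>m * L ^ d + t * P\<close>, hence depends only on the class of \<open>r\<close>.\<close>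

lemma \<kappa>_shift_base:
  assumes "\<kappa> r = \<kappa> r'" "Suc r * L ^ K \<le> L ^ c" "Suc r' * L ^ K \<le> L ^ c"
  shows "\<kappa> (r + t * R * L ^ c) = \<kappa> (r' + t * R * L ^ c)"
proof
  fix m
  define x x' d where "x = r + t * R * L ^ c" and "x' = r' + t * R * L ^ c" and "d = K + x + x'"
  have "\<kappa> x m = a (m * R0 * L ^ (c + d) + x)" by (intro cls_eval stable_large) (simp add: d_def)
  also have "m * R0 * L ^ (c + d) + x = (m * L ^ d + t * P) * R0 * L ^ c + r"
    by (simp add: x_def R_def power_add algebra_simps)
  also have "a \<dots> = \<kappa> r (m * L ^ d + t * P)" using cls_eval[OF assms(2)] by simp
  also have "\<dots> = \<kappa> r' (m * L ^ d + t * P)" using assms(1) by simp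
  also have "\<dots> = a ((m * L ^ d + t * P) * R0 * L ^ c + r')" using cls_eval[OF assms(3)] by simp
  also have "(m * L ^ d + t * P) * R0 * L ^ c + r' = m * R0 * L ^ (c + d) + x'"
    by (simp add: x'_def R_def power_add algebra_simps)
  also have "a \<dots> = \<kappa> x' m" by (intro cls_eval[symmetric] stable_large) (simp add: d_def)
  finally show "\<kappa> (r + t * R * L ^ c) m = \<kappa> (r' + t * R * L ^ c) m" by (simp add: x_def x'_def)
qed

lemma \<kappa>_shift_exponent:
  assumes "Suc r * L ^ K \<le> L ^ c" "c \<le> c'"
  shows "\<kappa> (r + t * R * L ^ c) = \<kappa> (r + t * R * L ^ c')"
proof
  fix m
  define x x' d where "x = r + t * R * L ^ c" and "x' = r + t * R * L ^ c'" and "d = K + x + x'"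
  have "\<kappa> x m = a (m * R0 * L ^ (c + d) + x)" by (intro cls_eval stable_large) (simp add: d_def)
  also have "m * R0 * L ^ (c + d) + x = (m * R0 * L ^ d + t * R) * L ^ c + r"
    by (simp add: x_def power_add algebra_simps)
  also have "a \<dots> = a ((m * R0 * L ^ d + t * R) * L ^ c' + r)" by (rule stable[symmetric, OF assms])
  also have "(m * R0 * L ^ d + t * R) * L ^ c' + r = m * R0 * L ^ (c' + d) + x'"
    by (simp add: x'_def power_add algebra_simps)
  also have "a \<dots> = \<kappa> x' m" by (intro cls_eval[symmetric] stable_large) (simp add: d_def)
  finally show "\<kappa> (r + t * R * L ^ c) m = \<kappa> (r + t * R * L ^ c') m" by (simp add: x_def x'_def)
qed

text \<open>By \<open>\<rho>_eq\<close>, \<open>\<rho> t\<close> maps the class of \<open>r\<close> to that of \<open>r + t * R * L ^ c\<close> for every sufficiently large \<open>c\<close>.\<close>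
definition \<rho> :: "nat \<Rightarrow> (nat \<Rightarrow> complex) \<Rightarrow> (nat \<Rightarrow> complex)" where
  "\<rho> t \<beta> = (let r = SOME r. coprime r P \<and> \<kappa> r = \<beta> in \<kappa> (r + t * R * L ^ (K + r)))"

lemma \<rho>_eq:
  assumes "coprime r P" "Suc r * L ^ K \<le> L ^ c"
  shows "\<rho> t (\<kappa> r) = \<kappa> (r + t * R * L ^ c)"
proof -
  define s where "s = (SOME s. coprime s P \<and> \<kappa> s = \<kappa> r)"
  have s: "coprime s P \<and> \<kappa> s = \<kappa> r" unfolding s_def by (rule someI[of _ r]) (use assms in auto)
  define d where "d = K + s + c"
  have ok: "Suc s * L ^ K \<le> L ^ (K + s)" by (intro stable_large) simp
  have "L ^ (K + s) \<le> L ^ d" "L ^ c \<le> L ^ d" using L_ge_2 by (auto simp: d_def intro!: power_increasing)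
  hence okd: "Suc s * L ^ K \<le> L ^ d" "Suc r * L ^ K \<le> L ^ d" using ok assms(2) by linarith+
  have "\<rho> t (\<kappa> r) = \<kappa> (s + t * R * L ^ (K + s))" by (simp add: \<rho>_def s_def[symmetric])
  also have "\<dots> = \<kappa> (s + t * R * L ^ d)" by (rule \<kappa>_shift_exponent[OF ok]) (simp add: d_def)
  also have "\<dots> = \<kappa> (r + t * R * L ^ d)" by (rule \<kappa>_shift_base[OF _ okd]) (use s in simp)
  also have "\<dots> = \<kappa> (r + t * R * L ^ c)" by (rule \<kappa>_shift_exponent[symmetric, OF assms(2)]) (simp add: d_def)
  finally show ?thesis .
qed

lemma coprime_shift: "coprime (r + t * R * L ^ c) P \<longleftrightarrow> coprime r P"
  using coprime_add_mult_self(1)[of r "t * R0 * L ^ c" P] by (simp add: R_def ac_simps)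

lemma \<rho>_in_B: "\<beta> \<in> B \<Longrightarrow> \<rho> t \<beta> \<in> B"
proof -
  assume "\<beta> \<in> B"
  then obtain r where r: "coprime r P" "\<beta> = \<kappa> r" by (auto simp: B_def)
  show ?thesis unfolding r(2) \<rho>_eq[OF r(1) stable_large[OF order_refl]]
    using r(1) by (intro in_B) (simp only: coprime_shift)
qed

text \<open>The second shift writes \<open>u\<close> above the base-\<open>L\<close> digits of
  \<open>t\<close>. The condition on \<open>e\<close> makes \<open>r + t * R * L ^ c\<close> small
  enough for the exponent \<open>e + c\<close>.\<close>

lemma \<rho>_compose:
  assumes "\<beta> \<in> B" "Suc (t * R) * L ^ K \<le> L ^ e"
  shows "\<rho> u (\<rho> t \<beta>) = \<rho> (t + u * L ^ e) \<beta>"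
proof -
  obtain r where r: "coprime r P" "\<beta> = \<kappa> r" using assms(1) by (auto simp: B_def)
  define c where "c = K + r"
  have ok: "Suc r * L ^ K \<le> L ^ c" by (intro stable_large) (simp add: c_def)
  define x where "x = r + t * R * L ^ c"
  have "Suc x \<le> Suc (t * R) * L ^ c" using less_of_stable[OF ok] by (simp add: x_def)
  hence "Suc x * L ^ K \<le> Suc (t * R) * L ^ c * L ^ K" by (rule mult_right_mono) simp
  also have "\<dots> = (Suc (t * R) * L ^ K) * L ^ c" by (simp only: ac_simps)
  also have "\<dots> \<le> L ^ e * L ^ c" using assms(2) by (rule mult_right_mono) simp
  finally have okx: "Suc x * L ^ K \<le> L ^ (e + c)" by (simp add: power_add)
  have cx: "coprime x P" unfolding x_def using r(1) by (simp only: coprime_shift)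
  have "\<rho> u (\<rho> t \<beta>) = \<rho> u (\<kappa> x)" by (simp add: r(2) x_def \<rho>_eq[OF r(1) ok])
  also have "\<dots> = \<kappa> (x + u * R * L ^ (e + c))" by (rule \<rho>_eq[OF cx okx])
  also have "x + u * R * L ^ (e + c) = r + (t + u * L ^ e) * R * L ^ c" by (simp add: x_def power_add algebra_simps)
  also have "\<kappa> \<dots> = \<rho> (t + u * L ^ e) \<beta>" by (simp only: r(2) \<rho>_eq[OF r(1) ok])
  finally show ?thesis .
qed

text \<open>Since \<open>d\<close> is coprime to \<open>r\<close>, it is coprime to
  \<open>m * d * S * L ^ c + r\<close>, so multiplicativity splits off the nonzero factor
  \<open>a d\<close>. The additional factors \<open>d\<close> in the dilation are absorbed by
  \<open>\<kappa>_eqI\<close>.\<close>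

lemma \<kappa>_mult_cancel:
  assumes d: "coprime d P" and r: "coprime r d" "coprime r' d" "r > 0" "r' > 0"
  shows "\<kappa> (d * r) = \<kappa> (d * r') \<longleftrightarrow> \<kappa> r = \<kappa> r'"
proof -
  have d0: "d > 0" using coprime_P_pos[OF d] .
  have ad: "a d \<noteq> 0" using nonzero[OF d0 d] .
  define c where "c = K + r + r' + d * r + d * r'"
  have ok: "Suc r * L ^ K \<le> L ^ c" "Suc r' * L ^ K \<le> L ^ c"
    "Suc (d * r) * L ^ K \<le> L ^ c" "Suc (d * r') * L ^ K \<le> L ^ c"
    by (rule stable_large; simp add: c_def)+
  have key: "a (m * d * d * S * L ^ c + d * s) = a d * a (m * d * S * L ^ c + s)" if s: "coprime s d" "s > 0" for m S s
  proof -
    have "m * d * d * S * L ^ c + d * s = d * (m * d * S * L ^ c + s)" by (simp add: algebra_simps)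
    moreover have "coprime d (m * d * S * L ^ c + s)"
      using coprime_add_mult_self(1)[of s "m * S * L ^ c" d] s(1) by (simp add: ac_simps coprime_commute)
    ultimately show ?thesis using d0 s(2) multiplicative_seqD[OF mult] by simp
  qed
  show ?thesis
  proof
    assume eq: "\<kappa> (d * r) = \<kappa> (d * r')"
    show "\<kappa> r = \<kappa> r'"
    proof (rule \<kappa>_eqI[OF ok(1,2), of "d * R0"])
      fix m
      have "\<kappa> (d * r) (m * d * d) = \<kappa> (d * r') (m * d * d)" using eq by simp
      thus "a (m * (d * R0) * L ^ c + r) = a (m * (d * R0) * L ^ c + r')"
        unfolding cls_eval[OF ok(3)] cls_eval[OF ok(4)] key[OF r(1,3)] key[OF r(2,4)]
        using ad by (simp add: mult.assoc)
    qed (use d0 R0_pos in simp)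
  next
    assume eq: "\<kappa> r = \<kappa> r'"
    show "\<kappa> (d * r) = \<kappa> (d * r')"
    proof (rule \<kappa>_eqI[OF ok(3,4), of "d * d * R0"])
      fix m
      have "\<kappa> r (m * d) = \<kappa> r' (m * d)" using eq by simp
      hence "a (m * d * R0 * L ^ c + r) = a (m * d * R0 * L ^ c + r')"
        unfolding cls_eval[OF ok(1)] cls_eval[OF ok(2)] .
      hence "a (m * d * d * R0 * L ^ c + d * r) = a (m * d * d * R0 * L ^ c + d * r')"
        unfolding key[OF r(1,3)] key[OF r(2,4)] by simp
      thus "a (m * (d * d * R0) * L ^ c + d * r) = a (m * (d * d * R0) * L ^ c + d * r')" by (simp add: mult.assoc)
    qed (use d0 R0_pos in simp)
  qed
qed

text \<open>For classes in \<open>B\<close>, a representative coprime to \<open>d\<close> exists by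
  \<open>recurrent\<close>; by \<open>\<kappa>_mult_cancel\<close> its choice does not matter, see
  \<open>\<tau>_eq\<close>.\<close>

definition \<tau> :: "nat \<Rightarrow> (nat \<Rightarrow> complex) \<Rightarrow> (nat \<Rightarrow> complex)" where
  "\<tau> d \<beta> = \<kappa> (d * (SOME r. coprime r P \<and> coprime r d \<and> \<kappa> r = \<beta>))"

lemma \<tau>_eq:
  assumes "coprime d P" "coprime r P" "coprime r d"
  shows "\<tau> d (\<kappa> r) = \<kappa> (d * r)"
proof -
  define s where "s = (SOME s. coprime s P \<and> coprime s d \<and> \<kappa> s = \<kappa> r)"
  have s: "coprime s P \<and> coprime s d \<and> \<kappa> s = \<kappa> r" unfolding s_def by (rule someI[of _ r]) (use assms in auto)
  have "\<kappa> (d * s) = \<kappa> (d * r)"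
    using s assms coprime_P_pos by (subst \<kappa>_mult_cancel) auto
  thus ?thesis by (simp add: \<tau>_def s_def[symmetric])
qed

lemma \<tau>_in_B: assumes "coprime d P" "\<beta> \<in> B" shows "\<tau> d \<beta> \<in> B"
proof -
  obtain r where r: "coprime r P" "coprime r d" "\<beta> = \<kappa> r" using B_cases[OF assms(2) coprime_P_pos[OF assms(1)]] .
  show ?thesis unfolding r(3) \<tau>_eq[OF assms(1) r(1,2)] using r(1) assms(1) by (intro in_B) simp
qed

lemma \<tau>_image: assumes "coprime d P" shows "\<tau> d ` B = B"
proof (rule endo_inj_surj[OF finite_B])
  show "\<tau> d ` B \<subseteq> B" using \<tau>_in_B[OF assms] by blast
  show "inj_on (\<tau> d) B"
  proof (rule inj_onI)
    fix \<beta> \<gamma> assume h: "\<beta> \<in> B" "\<gamma> \<in> B" "\<tau> d \<beta> = \<tau> d \<gamma>"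
    have d0: "d > 0" using coprime_P_pos[OF assms] .
    obtain r where r: "coprime r P" "coprime r d" "\<beta> = \<kappa> r" using B_cases[OF h(1) d0] .
    obtain s where s: "coprime s P" "coprime s d" "\<gamma> = \<kappa> s" using B_cases[OF h(2) d0] .
    have "\<kappa> (d * r) = \<kappa> (d * s)" using h(3) \<tau>_eq[OF assms r(1,2)] \<tau>_eq[OF assms s(1,2)] r s by simp
    thus "\<beta> = \<gamma>" using \<kappa>_mult_cancel[OF assms r(2) s(2)] r s coprime_P_pos by simp
  qed
qed

lemma \<tau>_mult:
  assumes "coprime d P" "coprime d' P" "coprime d d'" "\<beta> \<in> B"
  shows "\<tau> (d * d') \<beta> = \<tau> d (\<tau> d' \<beta>)"
proof -
  have "d * d' > 0" using coprime_P_pos assms by simp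
  then obtain r where r: "coprime r P" "coprime r (d * d')" "\<beta> = \<kappa> r" using B_cases[OF assms(4)] by blast
  have "\<tau> d (\<tau> d' \<beta>) = \<tau> d (\<kappa> (d' * r))" using r assms by (simp add: \<tau>_eq)
  also have "\<dots> = \<kappa> (d * (d' * r))" using r assms by (intro \<tau>_eq) (auto simp: coprime_commute)
  also have "\<dots> = \<tau> (d * d') \<beta>" unfolding r(3) using r assms by (subst \<tau>_eq) (auto simp: mult.assoc)
  finally show ?thesis by simp
qed

text \<open>Of two consecutive exponents \<open>c\<close> at least one makes \<open>r + t * R * L ^ c\<close> prime to \<open>q\<close>, because \<open>q\<close> does
  not divide \<open>L - 1\<close>.\<close>
lemma \<rho>_\<tau>_prime_power:
  assumes "prime q" "coprime q P" "\<beta> \<in> B"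
  shows "\<rho> (q ^ j * t) (\<tau> (q ^ j) \<beta>) = \<tau> (q ^ j) (\<rho> t \<beta>)"
proof -
  have q0: "q > 0" using assms(1) by (simp add: prime_gt_0_nat)
  obtain r where r: "coprime r P" "coprime r q" "\<beta> = \<kappa> r" using B_cases[OF assms(3) q0] .
  have dP: "coprime (q ^ j) P" using assms(2) by simp
  define c0 where "c0 = K + r + q ^ j * r"
  have "\<exists>c\<ge>c0. \<not> q dvd r + t * R * L ^ c"
  proof (rule ccontr)
    assume "\<not> (\<exists>c\<ge>c0. \<not> q dvd r + t * R * L ^ c)"
    hence all: "\<And>c. c \<ge> c0 \<Longrightarrow> q dvd r + t * R * L ^ c" by blast
    have 1: "q dvd r + t * R * L ^ c0" and 2: "q dvd r + t * R * L ^ Suc c0"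
      by (rule all[OF order_refl], rule all[OF le_SucI[OF order_refl]])
    have nr: "\<not> q dvd r" using r(2) assms(1) by (metis coprime_common_divisor dvd_refl not_prime_unit)
    have "(r + t * R * L ^ Suc c0) - (r + t * R * L ^ c0) = t * R * L ^ c0 * (L - 1)"
      by (simp add: algebra_simps diff_mult_distrib2)
    hence "q dvd t * R * L ^ c0 * (L - 1)" using dvd_diff_nat[OF 2 1] by (simp only:)
    moreover have "\<not> q dvd L - 1" using L1_dvd_P assms(1,2)
      by (metis coprime_common_divisor dvd_refl dvd_trans not_prime_unit)
    ultimately have "q dvd t * R * L ^ c0" using assms(1) prime_dvd_mult_iff by blast
    hence "q dvd r" using 1 by (simp add: dvd_add_left_iff)
    thus False using nr by simp
  qed
  then obtain c where c: "c \<ge> c0" "\<not> q dvd r + t * R * L ^ c" by blast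
  define x where "x = r + t * R * L ^ c"
  have xP: "coprime x P" unfolding x_def using r(1) by (simp only: coprime_shift)
  have xq: "coprime x (q ^ j)" using prime_imp_coprime[OF assms(1), of x] c(2) by (simp add: x_def coprime_commute)
  have "c \<ge> K + r" "c \<ge> K + q ^ j * r" using c(1) by (auto simp: c0_def)
  note ok = this[THEN stable_large]
  have "\<tau> (q ^ j) (\<rho> t \<beta>) = \<tau> (q ^ j) (\<kappa> x)" by (simp add: r(3) x_def \<rho>_eq[OF r(1) ok(1)])
  also have "\<dots> = \<kappa> (q ^ j * x)" by (rule \<tau>_eq[OF dP xP xq])
  also have "q ^ j * x = q ^ j * r + (q ^ j * t) * R * L ^ c" by (simp add: x_def algebra_simps)
  also have "\<kappa> \<dots> = \<rho> (q ^ j * t) (\<kappa> (q ^ j * r))"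
    using r(1) dP by (intro \<rho>_eq[symmetric] ok) simp
  also have "\<kappa> (q ^ j * r) = \<tau> (q ^ j) \<beta>" unfolding r(3) using r by (intro \<tau>_eq[symmetric] dP) auto
  finally show ?thesis by simp
qed

lemma \<rho>_\<tau>:
  assumes "coprime d P" "\<beta> \<in> B"
  shows "\<rho> (d * t) (\<tau> d \<beta>) = \<tau> d (\<rho> t \<beta>)"
  using assms
proof (induction d arbitrary: \<beta> t rule: less_induct)
  case (less d)
  have d0: "d > 0" using coprime_P_pos less.prems(1) .
  have \<tau>1: "\<tau> 1 \<gamma> = \<gamma>" if "\<gamma> \<in> B" for \<gamma>
    using that \<tau>_eq[of 1] by (auto simp: B_def)
  show ?case
  proof (cases "d = 1")
    case True
    thus ?thesis using \<tau>1 less.prems \<rho>_in_B by simp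
  next
    case False
    then obtain q where q: "prime q" "q dvd d" using prime_factor_nat by blast
    define j where "j = multiplicity q d"
    obtain d' where d': "d = q ^ j * d'" "\<not> q dvd d'" "d' > 0"
      using prime_valuation_decompose[OF q(1) d0] unfolding j_def by blast
    have "j \<noteq> 0" using d' q(2) by (cases j) auto
    hence "q ^ j > 1" using q(1) by (intro one_less_power) (auto simp: prime_gt_Suc_0_nat)
    hence "d' < d" using d' by simp
    have qP: "coprime q P" "coprime d' P" using less.prems(1) q d' by (meson coprime_divisors dvd_refl dvd_triv_right)+
    have cq: "coprime (q ^ j) d'" using prime_imp_coprime[OF q(1) d'(2)] by simp
    have "\<rho> (d * t) (\<tau> d \<beta>) = \<rho> (q ^ j * (d' * t)) (\<tau> (q ^ j) (\<tau> d' \<beta>))"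
      using qP cq less.prems(2) by (simp add: d'(1) \<tau>_mult mult.assoc)
    also have "\<dots> = \<tau> (q ^ j) (\<rho> (d' * t) (\<tau> d' \<beta>))"
      by (rule \<rho>_\<tau>_prime_power[OF q(1) qP(1) \<tau>_in_B[OF qP(2) less.prems(2)]])
    also have "\<dots> = \<tau> (q ^ j) (\<tau> d' (\<rho> t \<beta>))" using less.IH[OF \<open>d' < d\<close> qP(2) less.prems(2)] by simp
    also have "\<dots> = \<tau> d (\<rho> t \<beta>)" using qP cq \<rho>_in_B[OF less.prems(2)] by (simp add: d'(1) \<tau>_mult)
    finally show ?thesis .
  qed
qed

lemma \<rho>_\<tau>_funpow:
  assumes "coprime d P" "\<beta> \<in> B"
  shows "\<rho> (d ^ i * t) ((\<tau> d ^^ i) \<beta>) = (\<tau> d ^^ i) (\<rho> t \<beta>)"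
proof -
  have in_B': "(\<tau> d ^^ i) \<beta> \<in> B" for i by (induction i) (use assms \<tau>_in_B in auto)
  show ?thesis
  proof (induction i)
    case (Suc i)
    have "\<rho> (d ^ Suc i * t) ((\<tau> d ^^ Suc i) \<beta>) = \<rho> (d * (d ^ i * t)) (\<tau> d ((\<tau> d ^^ i) \<beta>))" by (simp add: mult.assoc)
    also have "\<dots> = \<tau> d (\<rho> (d ^ i * t) ((\<tau> d ^^ i) \<beta>))" by (rule \<rho>_\<tau>[OF assms(1) in_B'])
    finally show ?case using Suc by simp
  qed simp
qed

section \<open>Invertibility of the shifts and a shift acting as the identity\<close>

lemma R_pos: "R > 0" using R0_pos P_pos by (simp add: R_def)

text \<open>Some power \<open>k'\<close> of \<open>1 + P\<close> satisfies \<open>\<rho> (k' * t) = \<rho> t\<close>, and some \<open>t * k' ^ i\<close> has the leading digits of \<open>t'\<close>;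
  then \<open>t0\<close> consists of its remaining digits.\<close>
lemma \<rho>_factor:
  assumes "t \<ge> 1" "t' \<ge> 1"
  shows "\<exists>t0. \<forall>\<beta>\<in>B. \<rho> t \<beta> = \<rho> t' (\<rho> t0 \<beta>)"
proof -
  define k where "k = 1 + P"
  have kP: "coprime k P" unfolding k_def using coprime_add_mult_self(1)[of 1 1 P] by simp
  obtain n where n: "n > 0" "\<And>\<beta>. \<beta> \<in> B \<Longrightarrow> (\<tau> k ^^ n) \<beta> = \<beta>"
    using finite_surj_power_id[OF finite_B \<tau>_image[OF kP]] by blast
  define k' where "k' = k ^ n"
  have dil1: "\<rho> (k' * u) \<beta> = \<rho> u \<beta>" if "\<beta> \<in> B" for u \<beta>
    using \<rho>_\<tau>_funpow[OF kP that, of n u] n(2) that \<rho>_in_B by (simp add: k'_def)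
  have dil: "\<rho> (k' ^ i * u) \<beta> = \<rho> u \<beta>" if "\<beta> \<in> B" for i u \<beta>
  proof (induction i)
    case (Suc i) thus ?case using dil1[OF that, of "k' ^ i * u"] by (simp add: mult.assoc)
  qed simp
  have "k \<ge> 2" using P_ge_2 by (simp add: k_def)
  hence k2: "k' \<ge> 2" using self_le_power[of k n] n(1) by (simp add: k'_def)
  have "coprime k L" using kP L_dvd_P by (meson coprime_divisors dvd_refl)
  hence kL: "coprime k' L" by (simp add: k'_def)
  \<comment> \<open>Small enough that a remainder \<open>t0 < \<epsilon> * L ^ e\<close> meets the
    size condition of \<open>\<rho>_compose\<close>.\<close>
  define \<epsilon> where "\<epsilon> = 1 / (2 * real R * real L ^ K)"
  have \<epsilon>: "\<epsilon> > 0" using R_pos by (simp add: \<epsilon>_def)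
  have "\<exists>i e. e \<ge> Suc K \<and> real t' * real L ^ e < real t * real k' ^ i \<and>
      real t * real k' ^ i < (real t' + \<epsilon>) * real L ^ e"
    by (rule leading_digits) (use k2 kL L_ge_2 assms \<epsilon> in auto)
  then obtain i e where ie: "e \<ge> Suc K" "real t' * real L ^ e < real t * real k' ^ i"
      "real t * real k' ^ i < (real t' + \<epsilon>) * real L ^ e" by blast
  have "real (t' * L ^ e) < real (t * k' ^ i)" using ie(2) by simp
  hence less: "t' * L ^ e < t * k' ^ i" by linarith
  define t0 where "t0 = t * k' ^ i - t' * L ^ e"
  have t0: "t * k' ^ i = t0 + t' * L ^ e" using less by (simp add: t0_def)
  have "real t0 + real t' * real L ^ e = real t * real k' ^ i" using t0 by (metis of_nat_add of_nat_mult of_nat_power)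
  hence "real t0 < \<epsilon> * real L ^ e" using ie(3) by (simp add: algebra_simps)
  hence "2 * real t0 * real R * real L ^ K < real L ^ e" using R_pos by (simp add: \<epsilon>_def field_simps)
  hence "real (2 * (t0 * R * L ^ K)) < real (L ^ e)" by (simp add: ac_simps)
  hence 1: "2 * (t0 * R * L ^ K) < L ^ e" by linarith
  have "2 * L ^ K \<le> L * L ^ K" using L_ge_2 by (rule mult_right_mono) simp
  also have "\<dots> = L ^ Suc K" by simp
  also have "\<dots> \<le> L ^ e" using ie(1) L_ge_2 by (intro power_increasing) auto
  finally have "Suc (t0 * R) * L ^ K \<le> L ^ e" using 1 by (simp add: algebra_simps)
  hence "\<rho> t \<beta> = \<rho> t' (\<rho> t0 \<beta>)" if "\<beta> \<in> B" for \<beta>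
    using \<rho>_compose[OF that, of t0 e t'] dil[OF that, of i t] t0 by (simp add: mult.commute)
  thus ?thesis by (intro exI[of _ t0] ballI)
qed

text \<open>By \<open>\<rho>_factor\<close> all \<open>\<rho> t\<close> with
  \<open>t \<ge> 1\<close> have the same image \<open>J\<close>, so \<open>\<rho>_\<tau>\<close>
  makes \<open>J\<close> invariant under every \<open>\<tau> d\<close>. Since
  \<open>\<kappa> s = \<tau> s (\<kappa> 1)\<close> and each \<open>\<tau> r\<close> is a
  permutation of finite order, one class in \<open>J\<close> brings in \<open>\<kappa> 1\<close> and
  then all classes.\<close>

lemma \<rho>_image: "\<rho> 1 ` B = B"
proof -
  define J where "J = \<rho> 1 ` B"
  have sub: "\<rho> t ` B \<subseteq> \<rho> t' ` B" if t: "t \<ge> 1" "t' \<ge> 1" for t t'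
  proof (rule image_subsetI)
    obtain t0 where t0: "\<forall>\<beta>\<in>B. \<rho> t \<beta> = \<rho> t' (\<rho> t0 \<beta>)" by (rule exE[OF \<rho>_factor[OF t]])
    fix \<beta> assume \<beta>: "\<beta> \<in> B"
    show "\<rho> t \<beta> \<in> \<rho> t' ` B" by (rule image_eqI[where f = "\<rho> t'", OF bspec[OF t0 \<beta>] \<rho>_in_B[OF \<beta>]])
  qed
  have img: "\<rho> t ` B = J" if "t \<ge> 1" for t unfolding J_def using that by (intro equalityI sub) auto
  have inv: "\<tau> d ` J = J" if d: "coprime d P" for d
  proof -
    have "\<tau> d ` J = (\<lambda>\<beta>. \<tau> d (\<rho> 1 \<beta>)) ` B" by (simp only: J_def image_image)
    also have "\<dots> = (\<lambda>\<beta>. \<rho> (d * 1) (\<tau> d \<beta>)) ` B" by (intro image_cong refl \<rho>_\<tau>[OF d, symmetric])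
    also have "\<dots> = \<rho> d ` (\<tau> d ` B)" by (simp only: image_image mult_1_right)
    also have "\<dots> = J" using \<tau>_image[OF d] img[of d] coprime_P_pos[OF d] by simp
    finally show ?thesis .
  qed
  have 1: "\<kappa> 1 \<in> B" by (rule in_B) simp
  have "J \<subseteq> B" unfolding J_def using \<rho>_in_B by blast
  moreover have "\<rho> 1 (\<kappa> 1) \<in> J" using 1 by (simp add: J_def)
  ultimately obtain r where r: "coprime r P" "\<kappa> r \<in> J" by (auto simp: B_def)
  obtain n where n: "n > 0" "\<And>\<beta>. \<beta> \<in> B \<Longrightarrow> (\<tau> r ^^ n) \<beta> = \<beta>"
    using finite_surj_power_id[OF finite_B \<tau>_image[OF r(1)]] by blast
  obtain n' where n': "n = Suc n'" using n(1) gr0_implies_Suc by blast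
  have "(\<tau> r ^^ i) \<beta> \<in> J" if "\<beta> \<in> J" for i \<beta> by (induction i) (use that inv[OF r(1)] in auto)
  hence "(\<tau> r ^^ n') (\<kappa> r) \<in> J" using r(2) by blast
  moreover have "\<tau> r (\<kappa> 1) = \<kappa> r" using \<tau>_eq[OF r(1), of 1] by simp
  hence "(\<tau> r ^^ n') (\<kappa> r) = (\<tau> r ^^ n) (\<kappa> 1)" by (simp add: n' funpow_swap1)
  ultimately have \<kappa>1: "\<kappa> 1 \<in> J" using n(2)[OF 1] by simp
  have "\<kappa> s \<in> J" if s: "coprime s P" for s
  proof -
    have "\<tau> s (\<kappa> 1) \<in> J" using \<kappa>1 inv[OF s] by blast
    moreover have "\<tau> s (\<kappa> 1) = \<kappa> s" using \<tau>_eq[OF s, of 1] by simp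
    ultimately show ?thesis by simp
  qed
  hence "B \<subseteq> J" by (auto simp: B_def)
  thus ?thesis using \<open>J \<subseteq> B\<close> by (simp add: J_def)
qed

text \<open>\<open>\<rho> 1\<close> permutes a finite set, and by \<open>\<rho>_compose\<close> each
  of its positive powers is some \<open>\<rho> s\<close>.\<close>

lemma \<rho>_identity: "\<exists>s\<ge>1. \<forall>\<beta>\<in>B. \<rho> s \<beta> = \<beta>"
proof -
  obtain n where n: "n > 0" "\<And>\<beta>. \<beta> \<in> B \<Longrightarrow> (\<rho> 1 ^^ n) \<beta> = \<beta>"
    using finite_surj_power_id[OF finite_B \<rho>_image] by blast
  have "\<exists>s\<ge>1. \<forall>\<beta>\<in>B. (\<rho> 1 ^^ Suc m) \<beta> = \<rho> s \<beta>" for m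
  proof (induction m)
    case 0 show ?case by (intro exI[of _ 1]) simp
  next
    case (Suc m)
    then obtain s where s: "s \<ge> 1" "\<forall>\<beta>\<in>B. (\<rho> 1 ^^ Suc m) \<beta> = \<rho> s \<beta>" by (elim exE conjE)
    define e where "e = K + s * R"
    have "\<rho> 1 (\<rho> s \<beta>) = \<rho> (s + 1 * L ^ e) \<beta>" if "\<beta> \<in> B" for \<beta>
      by (rule \<rho>_compose[OF that stable_large]) (simp add: e_def)
    hence "\<forall>\<beta>\<in>B. (\<rho> 1 ^^ Suc (Suc m)) \<beta> = \<rho> (s + 1 * L ^ e) \<beta>" using s(2) by simp
    thus ?case using s(1) by (intro exI[of _ "s + 1 * L ^ e"]) simp
  qed
  from this[of "n - 1"] show ?thesis using n by auto
qed

text \<open>Conjugation by \<open>\<tau> d\<close> shows that along with \<open>\<rho> s\<close>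
  also \<open>\<rho> (d * s)\<close> is the identity for \<open>d\<close> coprime to
  \<open>P\<close>; at the class of \<open>1\<close> this gives
  \<open>a (1 + d * M) = 1\<close>.\<close>

theorem one_on_progression: "\<exists>M>0. L dvd M \<and> (\<forall>t. a (1 + M * t) = 1)"
proof -
  obtain s where s: "s \<ge> 1" "\<And>\<beta>. \<beta> \<in> B \<Longrightarrow> \<rho> s \<beta> = \<beta>" using \<rho>_identity by blast
  define c where "c = K + 1"
  define M where "M = s * R * L ^ c"
  have ok: "Suc 1 * L ^ K \<le> L ^ c" by (rule stable_large) (simp add: c_def)
  have one: "a (1 + d * M) = 1" if d: "coprime d P" for d
  proof -
    obtain \<beta> where \<beta>: "\<beta> \<in> B" "\<tau> d \<beta> = \<kappa> 1" using \<tau>_image[OF d] in_B[of 1] by (metis coprime_1_left imageE)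
    have "\<kappa> (1 + (d * s) * R * L ^ c) = \<rho> (d * s) (\<kappa> 1)" by (rule \<rho>_eq[symmetric, OF _ ok]) simp
    also have "\<dots> = \<kappa> 1" using \<rho>_\<tau>[OF d \<beta>(1), of s] s(2)[OF \<beta>(1)] \<beta>(2) by simp
    finally have "\<kappa> (1 + (d * s) * R * L ^ c) 0 = \<kappa> 1 0" by simp
    thus ?thesis using a_1 by (simp add: cls_0 M_def mult.assoc)
  qed
  have "a (1 + M * P * t) = 1" for t
  proof -
    define y where "y = 1 + M * P * t"
    have y0: "y > 0" by (simp add: y_def)
    have yP: "coprime y P" unfolding y_def using coprime_add_mult_self(1)[of 1 "M * t" P] by (simp add: ac_simps)
    \<comment> \<open>In the factorization \<open>1 + (y * y + P * t) * M = y * (1 + y * M)\<close>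
      both multipliers of \<open>M\<close>, namely \<open>y * y + P * t\<close> and
      \<open>y\<close>, are coprime to \<open>P\<close>. This yields \<open>a y = 1\<close>,
      although \<open>P * t\<close> itself is not coprime to \<open>P\<close>.\<close>
    have "coprime (y * y + P * t) P" unfolding coprime_add_mult_self using yP by simp
    hence "1 = a (1 + (y * y + P * t) * M)" by (rule one[symmetric])
    also have "1 + (y * y + P * t) * M = y * (1 + y * M)" by (simp add: y_def algebra_simps)
    also have "a \<dots> = a y * a (1 + y * M)"
      using y0 coprime_one_add_mult[of y M] by (intro multiplicative_seqD[OF mult]) auto
    also have "\<dots> = a y" unfolding one[OF yP] by simp
    finally show ?thesis unfolding y_def by simp
  qed
  moreover have "M * P > 0" using s(1) R_pos P_pos by (simp add: M_def)
  moreover have "L dvd M * P" using L_dvd_P by simp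
  ultimately show ?thesis by blast
qed

end

context multiplicative_automatic
begin

lemma one_on_progression_of_nonzero:
  assumes "P0 > 0" and nz: "\<And>n. n > 0 \<Longrightarrow> coprime n P0 \<Longrightarrow> a n \<noteq> 0"
  shows "\<exists>M>0. L dvd M \<and> (\<forall>t. a (1 + M * t) = 1)"
proof -
  obtain R0 where R0: "R0 > 0" "\<And>\<phi> \<psi> R m. \<phi> \<in> kernel_of L a \<Longrightarrow> \<psi> \<in> kernel_of L a \<Longrightarrow> R > 0 \<Longrightarrow>
      (\<And>m. \<phi> (m * R) = \<psi> (m * R)) \<Longrightarrow> \<phi> (m * R0) = \<psi> (m * R0)"
    using ex_uniform_dilation by metis
  have "P0 * L * (L - 1) > 0" using assms(1) L_ge_2 by simp
  then obtain P where P: "P > 0" "P0 * L * (L - 1) dvd P"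
    "\<And>r Y. coprime r P \<Longrightarrow> Y > 0 \<Longrightarrow> \<exists>r'. coprime r' (P * Y) \<and> cls R0 r' = cls R0 r"
    using ex_recurrent_modulus[of "P0 * L * (L - 1)" R0] by metis
  have dvd: "P0 dvd P" "L dvd P" "(L - 1) dvd P"
    using P(2) by (auto elim: dvd_trans[rotated] dest: dvd_mult_left dvd_mult_right)
  interpret nonvanishing_automatic a L K P R0
  proof
    show "a n \<noteq> 0" if "n > 0" "coprime n P" for n
      using nz that dvd(1) by (meson coprime_divisors dvd_refl)
  qed (use P R0 dvd in auto)
  show ?thesis by (rule one_on_progression)
qed

end

section \<open>Prime decompositions\<close>

lemma coprime_iff_no_common_prime:
  fixes n y :: nat
  shows "coprime n y \<longleftrightarrow> (\<forall>q. prime q \<longrightarrow> q dvd y \<longrightarrow> \<not> q dvd n)"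
proof
  assume "coprime n y"
  thus "\<forall>q. prime q \<longrightarrow> q dvd y \<longrightarrow> \<not> q dvd n"
    by (meson coprime_common_divisor not_prime_unit)
next
  assume h: "\<forall>q. prime q \<longrightarrow> q dvd y \<longrightarrow> \<not> q dvd n"
  show "coprime n y"
  proof (rule ccontr)
    assume "\<not> coprime n y"
    hence "gcd n y \<noteq> 1" by (simp add: coprime_iff_gcd_eq_1)
    then obtain q where "prime q" "q dvd gcd n y" using prime_factor_nat by blast
    thus False using h by auto
  qed
qed

lemma periodic_coprime_same_primes:
  assumes "\<And>q. prime q \<Longrightarrow> q dvd y \<longleftrightarrow> q dvd z" "periodic_coprime y a"
  shows "periodic_coprime z a"
proof -
  have "coprime n y \<longleftrightarrow> coprime n z" for n
    unfolding coprime_iff_no_common_prime using assms(1) by auto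
  thus ?thesis using assms(2) by (simp add: periodic_coprime_def)
qed

lemma prime_dvd_prod_primes:
  fixes S :: "nat set"
  assumes "finite S" "\<And>p. p \<in> S \<Longrightarrow> prime p" "prime q"
  shows "q dvd \<Prod>S \<longleftrightarrow> q \<in> S"
proof
  assume "q dvd \<Prod>S"
  then obtain p where "p \<in> S" "q dvd p" using assms(1,3) by (auto simp: prime_dvd_prod_iff)
  thus "q \<in> S" using assms primes_dvd_imp_eq by blast
next
  assume "q \<in> S" thus "q dvd \<Prod>S" using assms(1) by (intro dvd_prodI) auto
qed

text \<open>Induction on the number of removed primes: for distinct \<open>p\<close> and
  \<open>q\<close> in \<open>X\<close>, leaving one of them unremoved gives periodicity for the
  moduli \<open>y * p\<close> and \<open>y * q\<close>, which \<open>periodic_coprime_merge\<close>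
  combines.\<close>

lemma periodic_coprime_remove_primes:
  fixes a :: "nat \<Rightarrow> complex"
  assumes mult: "multiplicative_seq a" and Y: "finite Y" "\<And>p. p \<in> Y \<Longrightarrow> prime p"
    and base: "periodic_coprime (\<Prod>Y) a"
    and one: "\<And>q. q \<in> X \<Longrightarrow> periodic_coprime (\<Prod>(Y - {q})) a"
    and X: "X \<subseteq> Y"
  shows "periodic_coprime (\<Prod>(Y - X)) a"
  using X one
proof (induction "card X" arbitrary: X rule: less_induct)
  case less
  have finX: "finite X" using less.prems(1) Y(1) finite_subset by blast
  show ?case
  proof (cases "\<exists>p\<in>X. \<exists>q\<in>X. p \<noteq> q")
    case False
    hence "X = {} \<or> (\<exists>q. X = {q})" by blast
    thus ?thesis using base less.prems(2) by auto
  next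
    case True
    then obtain p q where pq: "p \<in> X" "q \<in> X" "p \<noteq> q" by blast
    define y where "y = \<Prod>(Y - X)"
    have pr: "prime p" "prime q" using pq less.prems(1) Y(2) by auto
    have y0: "y > 0" unfolding y_def using Y(2) by (intro prod_pos) (auto simp: prime_gt_0_nat)
    have step: "periodic_coprime (y * r) a" if r: "r \<in> X" for r
    proof -
      have "card (X - {r}) < card X" using r finX by (intro psubset_card_mono) auto
      hence "periodic_coprime (\<Prod>(Y - (X - {r}))) a" by (rule less.hyps) (use less.prems in auto)
      moreover have "Y - (X - {r}) = insert r (Y - X)" using r less.prems(1) by blast
      moreover have "\<Prod>(insert r (Y - X)) = r * y" unfolding y_def using Y(1) r by (subst prod.insert) auto
      ultimately show ?thesis by (simp add: mult.commute)
    qed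
    show ?thesis using periodic_coprime_merge[OF mult pr pq(3) y0 step step] pq by (simp add: y_def)
  qed
qed

section \<open>Finite kernels from eventual periodicity\<close>

lemma eventually_periodic_finite_range:
  assumes "eventually_periodic f"
  shows "finite (range f)"
proof -
  obtain N d where d: "d \<ge> 1" "\<And>n. n \<ge> N \<Longrightarrow> f (n + d) = f n"
    using assms unfolding eventually_periodic_def by blast
  have "f n \<in> f ` {..<N + d}" for n
  proof (induction n rule: less_induct)
    case (less n)
    show ?case
    proof (cases "n < N + d")
      case False
      hence "f (n - d) = f n" using d(2)[of "n - d"] by simp
      moreover have "f (n - d) \<in> f ` {..<N + d}" using d(1) False by (intro less) simp
      ultimately show ?thesis by simp
    qed simp
  qed
  hence "range f \<subseteq> f ` {..<N + d}" by blast
  thus ?thesis using finite_subset by blast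
qed

text \<open>From \<open>N\<close> on, a kernel element depends only on \<open>l ^ k\<close> and
  \<open>r\<close> modulo \<open>d\<close>; below \<open>N\<close> it is one of finitely many tuples
  of values.\<close>

lemma eventually_periodic_finite_kernel:
  assumes "eventually_periodic f" "l \<ge> 1"
  shows "finite (kernel_of l f)"
proof -
  obtain N d where d: "d \<ge> 1" "\<And>n. n \<ge> N \<Longrightarrow> f (n + d) = f n"
    using assms unfolding eventually_periodic_def by blast
  \<comment> \<open>The summand \<open>N * d\<close> moves the argument past \<open>N\<close>
    without changing it modulo \<open>d\<close>.\<close>
  define H where "H = (\<lambda>(A, C, v) n. if n < N then v n else f (N * d + (n * A + C) mod d))"
  have "g \<in> H ` ({..<d} \<times> {..<d} \<times> ({..<N} \<rightarrow>\<^sub>E range f))" if h: "g \<in> kernel_of l f" for g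
  proof -
    obtain k r where g: "g = (\<lambda>n. f (n * l ^ k + r))" using h unfolding kernel_of_def by blast
    have eq: "g = H (l ^ k mod d, r mod d, restrict g {..<N})"
    proof
      fix n
      show "g n = H (l ^ k mod d, r mod d, restrict g {..<N}) n"
      proof (cases "n < N")
        case False
        have "n * 1 \<le> n * l ^ k" using assms(2) by (intro mult_left_mono) auto
        hence 1: "n * l ^ k + r \<ge> N" using False by linarith
        have "N * 1 \<le> N * d" using d(1) by (intro mult_left_mono) auto
        hence 2: "N * d + (n * (l ^ k mod d) + r mod d) mod d \<ge> N" by linarith
        have "[n * l ^ k + r = n * (l ^ k mod d) + r mod d] (mod d)"
          by (intro cong_add cong_scalar_left) (simp_all add: Cong.cong_def)
        hence "[n * l ^ k + r = N * d + (n * (l ^ k mod d) + r mod d) mod d] (mod d)"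
          unfolding Cong.cong_def by simp
        from eventually_periodic_cong[of N f d, OF _ 1 2 this]
        have "f (n * l ^ k + r) = f (N * d + (n * (l ^ k mod d) + r mod d) mod d)" using d(2) by blast
        thus ?thesis using False by (simp add: H_def g)
      qed (simp add: H_def)
    qed
    have "restrict g {..<N} \<in> {..<N} \<rightarrow>\<^sub>E range f" by (auto simp: g)
    hence "(l ^ k mod d, r mod d, restrict g {..<N}) \<in> {..<d} \<times> {..<d} \<times> ({..<N} \<rightarrow>\<^sub>E range f)"
      using d(1) by auto
    thus ?thesis by (rule image_eqI[where f = H, OF eq])
  qed
  moreover have "finite ({..<N} \<rightarrow>\<^sub>E range f)"
    using eventually_periodic_finite_range[OF assms(1)] by (rule finite_PiE[OF finite_lessThan])
  hence "finite (H ` ({..<d} \<times> {..<d} \<times> ({..<N} \<rightarrow>\<^sub>E range f)))" by simp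
  ultimately show ?thesis using finite_subset subsetI by meson
qed

lemma prime_decomposition_eval:
  assumes "prime_decomposition p f1 f2 a" "prime p" "x > 0" "\<not> p dvd x"
  shows "a (p ^ i * x) = f1 i * f2 x"
proof -
  have p0: "p > 0" using assms(2) by (simp add: prime_gt_0_nat)
  have "multiplicity p (p ^ i * x) = i"
    using assms(2-4) by (intro multiplicity_eqI) (auto simp: prime_gt_0_nat)
  moreover have "p ^ i * x \<ge> 1" using p0 assms(3) by (simp add: Suc_le_eq)
  ultimately show ?thesis using assms(1) p0 unfolding prime_decomposition_def by simp
qed

lemma prime_decomposition_multiplicative:
  assumes pd: "prime_decomposition p f1 f2 a" and p: "prime p"
  shows "multiplicative_seq a"
  unfolding multiplicative_seq_def
proof (intro allI impI)
  fix m n :: nat assume mn: "m \<ge> 1" "n \<ge> 1" "coprime m n"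
  have mn0: "m > 0" "n > 0" using mn by auto
  define i j where "i = multiplicity p m" and "j = multiplicity p n"
  obtain x where x: "m = p ^ i * x" "\<not> p dvd x" "x > 0"
    using prime_valuation_decompose[OF p mn0(1)] unfolding i_def by blast
  obtain y where y: "n = p ^ j * y" "\<not> p dvd y" "y > 0"
    using prime_valuation_decompose[OF p mn0(2)] unfolding j_def by blast
  have "coprime x y" using mn(3) x y by simp
  have f2: "multiplicative_seq f2" and f1: "f1 0 = 1" using pd by (auto simp: prime_decomposition_def)
  have "i = 0 \<or> j = 0"
  proof (rule ccontr)
    assume "\<not> ?thesis"
    hence "p dvd m" "p dvd n" using x y by (auto simp: dvd_power)
    thus False using mn(3) p coprime_common_divisor not_prime_unit by blast
  qed
  hence 1: "f1 (i + j) = f1 i * f1 j" using f1 by auto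
  have eq: "m * n = p ^ (i + j) * (x * y)" by (simp add: x(1) y(1) power_add)
  have "\<not> p dvd x * y" using x y p by (simp add: prime_dvd_mult_iff)
  hence "a (m * n) = f1 (i + j) * f2 (x * y)" unfolding eq
    using x(3) y(3) by (intro prime_decomposition_eval[OF pd p]) auto
  also have "f2 (x * y) = f2 x * f2 y" using multiplicative_seqD[OF f2 \<open>coprime x y\<close>] x y by simp
  also have "f1 (i + j) * (f2 x * f2 y) = (f1 i * f2 x) * (f1 j * f2 y)" using 1 by simp
  also have "f1 i * f2 x = a m" using prime_decomposition_eval[OF pd p x(3,2), of i] x(1) by simp
  also have "f1 j * f2 y = a n" using prime_decomposition_eval[OF pd p y(3,2), of j] y(1) by simp
  finally show "a (m * n) = a m * a n" .
qed

text \<open>For \<open>r \<noteq> 0\<close> the valuation \<open>j\<close> of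
  \<open>n * p ^ k + r\<close> does not depend on \<open>n\<close>, so the kernel element is
  \<open>f1 j\<close> times one of \<open>f2\<close>. For \<open>r = 0\<close> it is
  \<open>G k\<close>, and \<open>G\<close> is eventually periodic in \<open>k\<close>.\<close>

lemma prime_decomposition_automatic:
  assumes pd: "prime_decomposition p f1 f2 a" and p: "prime p"
  shows "automatic_base p a"
proof -
  have p2: "p \<ge> 2" using p by (rule prime_ge_2_nat)
  have f1: "eventually_periodic f1" and f2: "eventually_periodic f2"
    using pd by (auto simp: prime_decomposition_def)
  obtain N d where d: "d \<ge> 1" "\<And>n. n \<ge> N \<Longrightarrow> f1 (n + d) = f1 n"
    using f1 unfolding eventually_periodic_def by blast
  define G where "G = (\<lambda>k n. if n = 0 then a 0 else f1 (k + multiplicity p n) * f2 (n div p ^ multiplicity p n))"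
  define S where "S = (\<lambda>(z, h) n. z * h n :: complex) ` (range f1 \<times> kernel_of p f2)"
  have Gper: "G (k + d) = G k" if "k \<ge> N" for k
  proof
    fix n
    have "f1 (k + d + multiplicity p n) = f1 (k + multiplicity p n)"
      using d(2)[of "k + multiplicity p n"] that by (simp add: ac_simps)
    thus "G (k + d) n = G k n" by (simp add: G_def)
  qed
  have "eventually_periodic G" unfolding eventually_periodic_def using d(1) Gper by blast
  hence "finite (range G)" by (rule eventually_periodic_finite_range)
  moreover have "finite S" unfolding S_def
    using eventually_periodic_finite_range[OF f1] eventually_periodic_finite_kernel[OF f2, of p] p2 by simp
  moreover have "kernel_of p a \<subseteq> range G \<union> S"
  proof
    fix g assume "g \<in> kernel_of p a"
    then obtain k r where g: "g = (\<lambda>n. a (n * p ^ k + r))" and r: "r < p ^ k"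
      unfolding kernel_of_def by blast
    show "g \<in> range G \<union> S"
    proof (cases "r = 0")
      case True
      have "g = G k"
      proof
        fix n
        show "g n = G k n"
        proof (cases "n = 0")
          case False
          then obtain x where x: "n = p ^ multiplicity p n * x" "\<not> p dvd x" "x > 0"
            using prime_valuation_decompose[OF p, of n] by blast
          have "n div p ^ multiplicity p n = x" using x(1) p2
            by (metis nonzero_mult_div_cancel_left not_numeral_le_zero power_not_zero)
          moreover have "n * p ^ k = p ^ (k + multiplicity p n) * x"
            using x(1) by (metis mult.assoc mult.commute power_add)
          ultimately show ?thesis using prime_decomposition_eval[OF pd p x(3,2)] False True by (simp add: g G_def)
        qed (simp add: g G_def True)
      qed
      thus ?thesis by simp
    next
      case False
      define j where "j = multiplicity p r"
      obtain s where s: "r = p ^ j * s" "\<not> p dvd s" "s > 0"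
        using prime_valuation_decompose[OF p, of r] False unfolding j_def by blast
      have "p ^ j * 1 \<le> p ^ j * s" using s(3) by (intro mult_left_mono) auto
      hence "p ^ j < p ^ k" using r s(1) by linarith
      hence jk: "j < k" using p2 by (simp add: power_less_imp_less_exp)
      then obtain i where i: "k = j + Suc i" by (metis add_Suc_right less_imp_Suc_add)
      have "s < p ^ Suc i" using r p2 unfolding s(1) i power_add by simp
      hence "(\<lambda>n. f2 (n * p ^ Suc i + s)) \<in> kernel_of p f2" by (rule kernel_of_memI)
      moreover have "g n = f1 j * f2 (n * p ^ Suc i + s)" for n
      proof -
        have "\<not> p dvd n * p ^ Suc i + s" using s(2) by (simp add: dvd_add_right_iff)
        moreover have "n * p ^ k + r = p ^ j * (n * p ^ Suc i + s)" by (simp add: s(1) i power_add algebra_simps)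
        ultimately show ?thesis unfolding g using s(3) by (simp add: prime_decomposition_eval[OF pd p])
      qed
      hence "g = (\<lambda>(z, h) n. z * h n) (f1 j, \<lambda>n. f2 (n * p ^ Suc i + s))" by auto
      ultimately have "g \<in> S" unfolding S_def by blast
      thus ?thesis by blast
    qed
  qed
  ultimately have "finite (kernel_of p a)" by (meson finite_UnI finite_subset)
  thus ?thesis using p2 by (simp add: automatic_base_def)
qed

section \<open>Uniqueness of the decomposition\<close>

lemma periodic_coprime_1_iff: "periodic_coprime 1 a \<longleftrightarrow> eventually_periodic (a :: nat \<Rightarrow> complex)"
  by (simp add: periodic_coprime_iff)

lemma prime_decomposition_periodic:
  assumes pd: "prime_decomposition p f1 f2 a" and p: "prime p"
  shows "periodic_coprime p a"
proof -
  obtain N d where d: "d \<ge> 1" "\<And>n. n \<ge> N \<Longrightarrow> f2 (n + d) = f2 n"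
    using pd unfolding prime_decomposition_def eventually_periodic_def by blast
  have eq: "a n = f2 n" if "n \<ge> 1" "coprime n p" for n
  proof -
    have "\<not> p dvd n" using that p by (metis coprime_common_divisor dvd_refl not_prime_unit)
    thus ?thesis using prime_decomposition_eval[OF pd p, of n 0] that pd
      by (simp add: prime_decomposition_def)
  qed
  have "a m = a n" if h: "m \<ge> N + 1" "n \<ge> N + 1" "coprime m p" "coprime n p" "[m = n] (mod d)" for m n
  proof -
    have "f2 m = f2 n" by (rule eventually_periodic_cong[of N f2 d, OF d(2)]) (use h in auto)
    thus ?thesis using eq h by simp
  qed
  thus ?thesis unfolding periodic_coprime_def using d(1) by (metis less_eq_Suc_le One_nat_def)
qed

text \<open>If \<open>f2 1\<close> were \<open>0\<close>, \<open>a\<close> would vanish on the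
  positive integers and be eventually periodic; hence \<open>f2 1 = 1\<close>, and the formula can
  be solved for \<open>f1\<close> and \<open>f2\<close>.\<close>

lemma prime_decomposition_values:
  assumes pd: "prime_decomposition p f1 f2 a" and p: "prime p" and np: "\<not> eventually_periodic a"
  shows "f1 k = a (p ^ k)" "n \<ge> 1 \<Longrightarrow> f2 n = (if p dvd n then 0 else a n)"
proof -
  have f2: "multiplicative_seq f2" and f10: "f1 0 = 1" using pd by (auto simp: prime_decomposition_def)
  have "f2 1 = 1"
  proof (rule ccontr)
    assume "f2 1 \<noteq> 1"
    moreover have "f2 1 = f2 1 * f2 1" using multiplicative_seqD[OF f2, of 1 1] by simp
    ultimately have "f2 1 = 0" by simp
    hence f20: "f2 n = 0" if "n > 0" for n using multiplicative_seqD[OF f2, of 1 n] that by simp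
    have "a n = 0" if n: "n \<ge> 1" for n
    proof -
      have n0: "n > 0" using n by simp
      obtain x where x: "n = p ^ multiplicity p n * x" "\<not> p dvd x" "x > 0"
        using prime_valuation_decompose[OF p n0] by blast
      have "a (p ^ multiplicity p n * x) = 0"
        using prime_decomposition_eval[OF pd p x(3,2)] f20[OF x(3)] by simp
      thus ?thesis using x(1) by simp
    qed
    hence "\<forall>n\<ge>1. a (n + 1) = a n" by simp
    thus False using np unfolding eventually_periodic_def by blast
  qed
  moreover have "\<not> p dvd 1" using p not_prime_unit by blast
  ultimately show "f1 k = a (p ^ k)" using prime_decomposition_eval[OF pd p zero_less_one, of k] by simp
  show "f2 n = (if p dvd n then 0 else a n)" if "n \<ge> 1"
    using prime_decomposition_eval[OF pd p, of n 0] that pd f10 by (auto simp: prime_decomposition_def)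
qed

text \<open>Decompositions at two different primes would make \<open>a\<close> periodic away from
  each of them, and \<open>periodic_coprime_merge\<close> would make it eventually periodic.\<close>

lemma prime_decomposition_unique:
  assumes p: "prime p" "prime_decomposition p f1 f2 a" and q: "prime q" "prime_decomposition q g1 g2 a"
    and np: "\<not> eventually_periodic a"
  shows "p = q \<and> f1 = g1 \<and> (\<forall>n\<ge>1. f2 n = g2 n)"
proof -
  have "p = q"
  proof (rule ccontr)
    assume pq: "p \<noteq> q"
    have "periodic_coprime (1 * p) a" "periodic_coprime (1 * q) a"
      using prime_decomposition_periodic[OF p(2,1)] prime_decomposition_periodic[OF q(2,1)] by simp_all
    hence "periodic_coprime 1 a"
      by (rule periodic_coprime_merge[OF prime_decomposition_multiplicative[OF p(2,1)] p(1) q(1) pq zero_less_one])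
    thus False using np by (simp only: periodic_coprime_1_iff)
  qed
  thus ?thesis using prime_decomposition_values[OF p(2,1) np] prime_decomposition_values[OF q(2,1) np] by auto
qed

lemma prime_decompositionI:
  assumes mult: "multiplicative_seq a" and a1: "a 1 = 1" and p: "prime p"
    and per: "periodic_coprime p a" "eventually_periodic (\<lambda>k. a (p ^ k))"
  shows "prime_decomposition p (\<lambda>k. a (p ^ k)) (\<lambda>n. if coprime n p then a n else 0) a"
proof -
  have 1: "multiplicative_seq (\<lambda>n. if coprime n p then a n else 0)"
    using mult unfolding multiplicative_seq_def by simp
  have 2: "a n = a (p ^ multiplicity p n) *
      (if coprime (n div p ^ multiplicity p n) p then a (n div p ^ multiplicity p n) else 0)" if n: "n \<ge> 1" for n
  proof -
    have n0: "n > 0" using n by simp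
    obtain x where x: "n = p ^ multiplicity p n * x" "\<not> p dvd x" "x > 0"
      using prime_valuation_decompose[OF p n0] by blast
    have "n div p ^ multiplicity p n = x" using x(1) p
      by (metis nonzero_mult_div_cancel_left not_prime_0 power_not_zero)
    moreover have "coprime x p" using prime_imp_coprime[OF p x(2)] by (simp add: coprime_commute)
    moreover have "a n = a (p ^ multiplicity p n) * a x"
      using multiplicative_seq_prime_power[OF mult p x(3,2)] x(1) by metis
    ultimately show ?thesis by simp
  qed
  have 3: "\<not> coprime n p" if "p dvd n" for n
    using that p by (metis coprime_common_divisor dvd_refl not_prime_unit)
  have 4: "eventually_periodic (\<lambda>n. if coprime n p then a n else 0)"
    using per(1) by (simp add: periodic_coprime_iff)
  show ?thesis unfolding prime_decomposition_def
  proof (intro conjI allI impI)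
    show "a (p ^ 0) = 1" using a1 by simp
    show "(if coprime n p then a n else 0) = 0" if "p dvd n" for n using 3[OF that] by simp
  qed (fact per(2) 1 4 2)+
qed

section \<open>Assembling the decomposition\<close>

context multiplicative_automatic
begin

lemma nonzero_of_nonzero_prime_powers:
  assumes "n > 0" "\<And>q. prime q \<Longrightarrow> q dvd n \<Longrightarrow> a (q ^ multiplicity q n) \<noteq> 0"
  shows "a n \<noteq> 0"
  using assms
proof (induction n rule: less_induct)
  case (less n)
  show ?case
  proof (cases "n = 1")
    case True thus ?thesis using a_1 by simp
  next
    case False
    then obtain q where q: "prime q" "q dvd n" using prime_factor_nat by blast
    obtain x where x: "n = q ^ multiplicity q n * x" "\<not> q dvd x" "x > 0"
      using prime_valuation_decompose[OF q(1) less.prems(1)] by blast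
    have "multiplicity q n \<noteq> 0"
    proof
      assume "multiplicity q n = 0"
      hence "n = x" using x(1) by simp
      thus False using x(2) q(2) by simp
    qed
    hence "q ^ multiplicity q n > 1" using q(1) by (intro one_less_power) (auto simp: prime_gt_Suc_0_nat)
    hence "1 * x < q ^ multiplicity q n * x" using x(3) by (rule mult_strict_right_mono)
    hence xn: "x < n" using x(1) by linarith
    have "a (r ^ multiplicity r x) \<noteq> 0" if r: "prime r" "r dvd x" for r
    proof -
      have "r \<noteq> q" using r(2) x(2) by blast
      hence "coprime r (q ^ multiplicity q n)" using primes_coprime[OF r(1) q(1)] by simp
      hence "\<not> r dvd q ^ multiplicity q n" using r(1) by (metis coprime_common_divisor dvd_refl not_prime_unit)
      hence "multiplicity r (q ^ multiplicity q n * x) = multiplicity r x"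
        using x(3) r(1) q(1) by (simp add: prime_elem_multiplicity_mult_distrib not_dvd_imp_multiplicity_0)
      hence "multiplicity r n = multiplicity r x" using x(1) by metis
      moreover have "r dvd n" using r(2) x(1) by (metis dvd_mult)
      ultimately show ?thesis using less.prems(2)[OF r(1)] by simp
    qed
    hence "a x \<noteq> 0" using less.IH[OF xn x(3)] by blast
    moreover have "a (q ^ multiplicity q n) \<noteq> 0" using less.prems(2)[OF q] .
    moreover have "a n = a (q ^ multiplicity q n) * a x"
      using multiplicative_seq_prime_power[OF mult q(1) x(3,2)] x(1) by metis
    ultimately show ?thesis by simp
  qed
qed

lemma one_on_progression_of_infinitely_many_primes:
  assumes inf: "infinite {q. prime q \<and> (\<exists>j\<ge>1. a (q ^ j) \<noteq> 0)}"
  shows "\<exists>M>0. L dvd M \<and> (\<forall>t. a (1 + M * t) = 1)"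
proof -
  define Z where "Z = {q. prime q \<and> (\<exists>j\<ge>1. a (q ^ j) = 0)}"
  have finZ: "finite Z" unfolding Z_def using finitely_many_zero_primes[OF inf] .
  have "\<Prod>Z > 0" unfolding Z_def by (intro prod_pos) (auto simp: prime_gt_0_nat)
  moreover have "a n \<noteq> 0" if n: "n > 0" "coprime n (\<Prod>Z)" for n
  proof (rule nonzero_of_nonzero_prime_powers[OF n(1)])
    fix q :: nat assume q: "prime q" "q dvd n"
    have "\<not> q dvd \<Prod>Z" using n(2) q by (meson coprime_common_divisor not_prime_unit)
    hence "q \<notin> Z" using finZ by (metis dvd_prodI)
    moreover have "multiplicity q n \<ge> 1" using q n(1) by (intro multiplicity_geI) (auto simp: not_prime_unit)
    ultimately show "a (q ^ multiplicity q n) \<noteq> 0" using q(1) unfolding Z_def by blast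
  qed
  ultimately show ?thesis using one_on_progression_of_nonzero by blast
qed

text \<open>Starting from the modulus \<open>M\<close>, \<open>periodic_coprime_remove_prime\<close>
  removes each prime divisor of which \<open>L\<close> is not a power.\<close>

lemma periodic_coprime_of_one_on_progression:
  assumes M: "M > 0" "L dvd M" "\<And>t. a (1 + M * t) = 1"
  shows "periodic_coprime (\<Prod>{p. prime p \<and> p dvd M \<and> (\<exists>i. L = p ^ i)}) a"
proof -
  define Y where "Y = {p. prime p \<and> p dvd M}"
  define X where "X = {q \<in> Y. \<forall>i. L \<noteq> q ^ i}"
  have finY: "finite Y" unfolding Y_def using M(1) by (intro finite_subset[OF _ finite_divisors_nat[of M]]) auto
  have Yp: "prime p" if "p \<in> Y" for p using that by (simp add: Y_def)
  have dvdY: "q dvd \<Prod>S \<longleftrightarrow> q \<in> S" if "S \<subseteq> Y" "prime q" for q S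
    using that finY Yp by (intro prime_dvd_prod_primes) (auto intro: finite_subset)
  have "L \<le> M" using M(1,2) by (intro dvd_imp_le)
  hence M1: "M > 1" using L_ge_2 by linarith
  have "periodic_coprime M a" unfolding periodic_coprime_def
    using coprime_cong_eq(1)[OF M1 M(3)] M(1) by blast
  hence base: "periodic_coprime (\<Prod>Y) a"
    by (rule periodic_coprime_same_primes[rotated]) (simp add: dvdY Y_def)
  have one: "periodic_coprime (\<Prod>(Y - {q})) a" if qX: "q \<in> X" for q
  proof -
    have q: "prime q" "q dvd M" "\<And>i. L \<noteq> q ^ i" using qX by (auto simp: X_def Y_def)
    obtain y where y: "M = q ^ multiplicity q M * y" "\<not> q dvd y"
      using prime_valuation_decompose[OF q(1) M(1)] by blast
    have per: "periodic_coprime y a"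
      by (rule periodic_coprime_remove_prime[OF M(3,2,1) q(1,2) y q(3)])
    have "r dvd y \<longleftrightarrow> r dvd \<Prod>(Y - {q})" if r: "prime r" for r
    proof -
      have "r dvd M \<longleftrightarrow> r dvd q ^ multiplicity q M \<or> r dvd y"
        using r y(1) by (metis prime_dvd_mult_iff)
      moreover have "r dvd q ^ multiplicity q M \<Longrightarrow> r = q"
        using r q(1) prime_dvd_power primes_dvd_imp_eq by blast
      ultimately have "r dvd y \<longleftrightarrow> r dvd M \<and> r \<noteq> q" using y(2) by blast
      thus ?thesis using dvdY[of "Y - {q}" r] r by (auto simp: Y_def)
    qed
    thus ?thesis using per by (rule periodic_coprime_same_primes)
  qed
  have "periodic_coprime (\<Prod>(Y - X)) a"
    by (rule periodic_coprime_remove_primes[OF mult finY Yp base one]) (auto simp: X_def)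
  moreover have "Y - X = {p. prime p \<and> p dvd M \<and> (\<exists>i. L = p ^ i)}" by (auto simp: X_def Y_def)
  ultimately show ?thesis by simp
qed

lemma periodic_coprime_prime_power_base:
  assumes p: "prime p" "L = p ^ i"
  shows "periodic_coprime p a"
proof (cases "finite {q. prime q \<and> (\<exists>j\<ge>1. a (q ^ j) \<noteq> 0)}")
  case True
  show ?thesis by (rule periodic_coprime_of_finitely_many_primes[OF True _ _ p]) auto
next
  case False
  obtain M where M: "M > 0" "L dvd M" "\<And>t. a (1 + M * t) = 1"
    using one_on_progression_of_infinitely_many_primes[OF False] by blast
  have i: "i > 0" using p L_ge_2 by (cases i) auto
  have "q = p" if q: "prime q" "L = q ^ j" for q j
  proof -
    have "p dvd q ^ j" using q p i by (metis dvd_power)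
    thus ?thesis using q(1) p(1) prime_dvd_power primes_dvd_imp_eq by blast
  qed
  moreover have "p dvd M" using M(2) p i by (metis dvd_power dvd_trans)
  ultimately have "{p. prime p \<and> p dvd M \<and> (\<exists>i. L = p ^ i)} = {p}" using p by blast
  thus ?thesis using periodic_coprime_of_one_on_progression[OF M] by simp
qed

lemma periodic_coprime_1_other_base:
  assumes "\<And>p i. prime p \<Longrightarrow> L \<noteq> p ^ i"
  shows "periodic_coprime 1 a"
proof (cases "finite {q. prime q \<and> (\<exists>j\<ge>1. a (q ^ j) \<noteq> 0)}")
  case True
  show ?thesis by (rule eventually_zero_of_finitely_many_primes[OF True]) (use assms in auto)
next
  case False
  obtain M where M: "M > 0" "L dvd M" "\<And>t. a (1 + M * t) = 1"
    using one_on_progression_of_infinitely_many_primes[OF False] by blast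
  have "{p. prime p \<and> p dvd M \<and> (\<exists>i. L = p ^ i)} = {}" using assms by blast
  thus ?thesis using periodic_coprime_of_one_on_progression[OF M] by (simp only: prod.empty)
qed

text \<open>Stability with \<open>r = 0\<close>: for large \<open>k\<close>, multiplying
  \<open>p ^ k\<close> by \<open>L\<close> does not change the value, so \<open>i\<close> is a
  period.\<close>

lemma eventually_periodic_prime_powers:
  assumes "L = p ^ i" "i > 0"
  shows "eventually_periodic (\<lambda>k. a (p ^ k))"
proof -
  have "a (p ^ (k + i)) = a (p ^ k)" if k: "k \<ge> i * K" for k
  proof -
    obtain s where s: "k = i * K + s" using k le_Suc_ex by blast
    have "a (p ^ s * L ^ Suc K + 0) = a (p ^ s * L ^ K + 0)" by (rule stable_Suc) simp
    moreover have "p ^ s * L ^ K = p ^ k" by (simp add: assms(1) s power_add power_mult)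
    moreover have "p ^ s * L ^ Suc K = p ^ (k + i)"
      by (simp add: assms(1) s power_add power_mult)
    ultimately show ?thesis by simp
  qed
  thus ?thesis unfolding eventually_periodic_def using assms(2) by (intro exI[of _ "i * K"] exI[of _ i]) auto
qed

end

lemma periodic_coprime_1_powers:
  assumes "periodic_coprime 1 a" "p \<ge> 2"
  shows "eventually_periodic (\<lambda>k. a (p ^ k))"
proof -
  obtain D N where D: "D > 0" "\<And>m n. m \<ge> N \<Longrightarrow> n \<ge> N \<Longrightarrow> [m = n] (mod D) \<Longrightarrow> a m = a n"
    using assms(1) unfolding periodic_coprime_def by auto
  have "p ^ k mod D \<in> {..<D}" for k using D(1) by simp
  then obtain i j where ij: "i < j" "p ^ i mod D = p ^ j mod D"
    using pigeonhole_nat[of "{..<D}" "\<lambda>k. p ^ k mod D"] by (metis finite_lessThan)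
  have "a (p ^ (k + (j - i))) = a (p ^ k)" if k: "k \<ge> i + N" for k
  proof (rule D(2))
    have big: "p ^ m \<ge> N" if "m \<ge> N" for m
    proof -
      have "m < p ^ m" using assms(2) by (intro power_gt_expt) simp
      thus ?thesis using that by simp
    qed
    show "p ^ (k + (j - i)) \<ge> N" "p ^ k \<ge> N" using k by (auto intro!: big)
    have "[p ^ (k - i) * p ^ j = p ^ (k - i) * p ^ i] (mod D)"
      by (rule cong_scalar_left) (use ij in \<open>simp add: Cong.cong_def\<close>)
    moreover have "p ^ (k - i) * p ^ j = p ^ (k + (j - i))" "p ^ (k - i) * p ^ i = p ^ k"
      using k ij(1) by (simp_all flip: power_add)
    ultimately show "[p ^ (k + (j - i)) = p ^ k] (mod D)" by simp
  qed
  thus ?thesis unfolding eventually_periodic_def using ij(1)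
    by (intro exI[of _ "i + N"] exI[of _ "j - i"]) auto
qed

lemma multiplicative_automatic_decomposition:
  assumes mult: "multiplicative_seq a" and "automatic a"
  shows "\<exists>p. prime p \<and> (\<exists>f1 f2. prime_decomposition p f1 f2 a)"
proof (cases "a 1 = 1")
  case False
  moreover have "a 1 = a 1 * a 1" using multiplicative_seqD[OF mult, of 1 1] by simp
  ultimately have "a 1 = 0" by simp
  hence "a n = 0" if "n \<ge> 1" for n using multiplicative_seqD[OF mult, of 1 n] that by simp
  moreover have "eventually_periodic (\<lambda>_. c :: complex)" for c by (auto simp: eventually_periodic_def)
  \<comment> \<open>Here \<open>a\<close> vanishes on the positive integers, so any prime works with
    \<open>f2\<close> zero.\<close>
  ultimately have "prime_decomposition 2 (\<lambda>_. 1) (\<lambda>_. 0) a"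
    by (auto simp: prime_decomposition_def multiplicative_seq_def)
  thus ?thesis using two_is_prime_nat by blast
next
  case True
  obtain l where l: "automatic_base l a" using assms(2) by (auto simp: automatic_def)
  obtain L K where LK: "L \<ge> 2" "finite (kernel_of L a)"
    "\<forall>r c n. Suc r * L ^ K \<le> L ^ c \<longrightarrow> a (n * L ^ Suc c + r) = a (n * L ^ c + r)"
    using automatic_base_stable[OF l] by (elim exE conjE)
  interpret multiplicative_automatic a L K
    by unfold_locales (use mult True LK in \<open>auto simp del: power_Suc mult_Suc\<close>)
  have "\<exists>p. prime p \<and> periodic_coprime p a \<and> eventually_periodic (\<lambda>k. a (p ^ k))"
  proof (cases "\<exists>p i. prime p \<and> L = p ^ i")
    case True
    then obtain p i where p: "prime p" "L = p ^ i" by blast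
    have "i > 0" using p LK(1) by (cases i) auto
    thus ?thesis using p periodic_coprime_prime_power_base eventually_periodic_prime_powers by blast
  next
    case False
    \<comment> \<open>If \<open>L\<close> is not a prime power, \<open>a\<close> is eventually
      periodic outright, and the prime \<open>2\<close> is an arbitrary choice.\<close>
    hence 1: "periodic_coprime 1 a" by (intro periodic_coprime_1_other_base) blast
    hence "periodic_coprime 2 a" unfolding periodic_coprime_def by auto
    moreover have "eventually_periodic (\<lambda>k. a (2 ^ k))" by (rule periodic_coprime_1_powers[OF 1]) simp
    ultimately show ?thesis using two_is_prime_nat by blast
  qed
  thus ?thesis using prime_decompositionI[OF mult True] by blast
qed

theorem theorem1p1:
  shows
    "(\<forall>a :: nat \<Rightarrow> complex. multiplicative_seq a \<longrightarrow> automatic a \<longrightarrow>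
        (\<exists>p. prime p \<and> automatic_base p a \<and> (\<exists>f1 f2. prime_decomposition p f1 f2 a))) \<and>
     (\<forall>p f1 f2 a. prime p \<longrightarrow> prime_decomposition p f1 f2 a \<longrightarrow>
        multiplicative_seq a \<and> automatic_base p a) \<and>
     (\<forall>p f1 f2 q g1 g2 a. prime p \<longrightarrow> prime q \<longrightarrow>
        prime_decomposition p f1 f2 a \<longrightarrow> prime_decomposition q g1 g2 a \<longrightarrow>
        \<not> eventually_periodic a \<longrightarrow>
        p = q \<and> f1 = g1 \<and> (\<forall>n\<ge>1. f2 n = g2 n))"
proof (intro conjI)
  show "\<forall>a :: nat \<Rightarrow> complex. multiplicative_seq a \<longrightarrow> automatic a \<longrightarrow>
      (\<exists>p. prime p \<and> automatic_base p a \<and> (\<exists>f1 f2. prime_decomposition p f1 f2 a))"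
  proof (intro allI impI)
    fix a :: "nat \<Rightarrow> complex"
    assume "multiplicative_seq a" "automatic a"
    then obtain p f1 f2 where "prime p" "prime_decomposition p f1 f2 a"
      using multiplicative_automatic_decomposition by blast
    thus "\<exists>p. prime p \<and> automatic_base p a \<and> (\<exists>f1 f2. prime_decomposition p f1 f2 a)"
      using prime_decomposition_automatic by blast
  qed
  show "\<forall>p f1 f2 a. prime p \<longrightarrow> prime_decomposition p f1 f2 a \<longrightarrow> multiplicative_seq a \<and> automatic_base p a"
    using prime_decomposition_multiplicative prime_decomposition_automatic by blast
  show "\<forall>p f1 f2 q g1 g2 a. prime p \<longrightarrow> prime q \<longrightarrow>
        prime_decomposition p f1 f2 a \<longrightarrow> prime_decomposition q g1 g2 a \<longrightarrow>
        \<not> eventually_periodic a \<longrightarrow> p = q \<and> f1 = g1 \<and> (\<forall>n\<ge>1. f2 n = g2 n)"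
    by (intro allI impI) (rule prime_decomposition_unique)
qed

end
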